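(* Let $H$ be a complex Hilbert space, let $n=2\ell$, and let $A(\lambda)=A_0+\lambda A_1+\dots+\lambda^nA_n$ be an operator pencil with bounded operators $A_j$ in $H$ such that (i) $\operatorname{Im}(A(\lambda)x,x)\le 0$ for all $x\in H$ and all $\lambda\in\mathbb R$; (ii) there is a point $\lambda_0\in\mathbb R$ such that $0\notin\theta(A(\lambda_0))$. Then both systems $\mathscr E^+$ and $\mathscr E^-$ are linearly independent in the space $H^\ell$.
   Context: Notation. $\theta(B)=\{(Bu,u):\|u\|=1\}$ is the numerical range of $B$; $[\gamma]$ is the largest integer $\le\gamma$; $A^*(\lambda)=[A(\bar\lambda)]^*$; $(\cdot,z)w$ is the operator $x\mapsto (x,z)w$. A possibly infinite system is linearly independent if every finite subsystem is. Chains. Vectors $w^0\ne0,w^1,\dots,w^p$ form a chain of eigen and associated vectors of length $p+1$ at the eigenvalue $c$ if $\sum_{j=0}^{s}\frac1{j!}A^{(j)}(c)w^{s-j}=0$ for $s=0,\dots,p$. A canonical system at $c$ is a family of chains $w_k^0,\dots,w_k^{p_k}$ $(k=1,\dots,N)$ such that $\{w_k^0\}$ is a basis of $\operatorname{Ker}A(c)$ and $\sum_k(p_k+1)$ is the maximal possible. The discrete spectrum $\sigma_d(A)$ consists of the isolated points $c$ of the spectrum of $A(\lambda)$ at which $A^{-1}(\lambda)$ has a pole with principal part of the form $$\sum_{k=1}^N\sum_{s=0}^{p_k}\frac{\sum_{r=0}^{s}(\cdot,z_k^{s-r})w_k^{r}}{(\lambda-c)^{p_k+1-s}},\qquad N<\infty,$$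 for a canonical system $\{w_k^h\}$ at $c$; here $z_k^0,\dots,z_k^{p_k}$ is a canonical system of $A^*(\lambda)$ at $\bar c$, uniquely determined by $\{w_k^h\}$ and called the adjoint canonical system. Keldysh derived chains. Given a canonical system at $c$, put $v_k^h(t)=e^{ict}\sum_{r=0}^h\frac{(it)^r}{r!}w_k^{h-r}$. The Keldysh derived chain of length $m$ corresponding to $w_k^h$ is the vector $\{v_k^h(0),-i(v_k^h)'(0),\dots,(-i)^{m-1}(v_k^h)^{(m-1)}(0)\}\in H^m$. For $m=n$ it is denoted $\tilde w_k^h$, and $\tilde z_k^h$ is formed in the same way from the adjoint chains at $\bar c$. Regular canonical systems and sign characteristics. Let $c\in\sigma_d(A)\cap\mathbb R$. A canonical system at $c$ is called regular if for every $k$ with $p_k=2\ell_k$ even there is $\varepsilon_k\in\{1,-1\}$ such that $\tilde z_k^{\ell_k}-\varepsilon_k\tilde w_k^{\ell_k}$ belongs to the span of $\{\tilde w_j^h:\ 1\le j\le N,\ 0\le h\le[(p_j-1)/2]\}$ (nothing is taken from a chain with $p_j=0$). Regular systems exist for pencils satisfying (i). The numbers $\varepsilon_k$ are the sign characteristics; for chains of even length ($p_k$ odd) one puts $\varepsilon_k=0$. Halves. Number the chains over all eigenvalues $\lambda_k\in\sigma_d(A)$, each repeated according to its geometric multiplicity, using any canonical systems at non-real eigenvalues and regular ones at real eigenvalues. Let $$E^{\pm}=\{w_k^h:\ \pm\operatorname{Im}\lambda_k>0,\ 0\le h\le p_k\}\cup\{w_k^h:\ \lambda_k\in\mathbb R,\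 0\le h\le[(p_k\pm\varepsilon_k)/2]\},$$ where for $p_k=0$ and $\pm\varepsilon_k=-1$ nothing is taken. $\mathscr E^\pm$ is the system of Keldysh derived chains of length $\ell$ corresponding to the vectors of $E^\pm$. *)

theory Defs
  imports "HOL-Analysis.Analysis" "HOL-Library.Function_Algebras"
begin

section \<open>Complex vector spaces and complex Hilbert spaces\<close>

class complex_vector = ab_group_add +
  fixes scaleC :: "complex \<Rightarrow> 'a \<Rightarrow> 'a"  (infixr \<open>*\<^sub>C\<close> 75)
  assumes scaleC_add_right: "a *\<^sub>C (x + y) = a *\<^sub>C x + a *\<^sub>C y"
    and scaleC_add_left: "(a + b) *\<^sub>C x = a *\<^sub>C x + b *\<^sub>C x"
    and scaleC_scaleC: "a *\<^sub>C (b *\<^sub>C x) = (a * b) *\<^sub>C x"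
    and scaleC_one: "1 *\<^sub>C x = x"

global_interpretation complex_vector: vector_space "scaleC :: complex \<Rightarrow> 'a \<Rightarrow> 'a :: complex_vector"
  defines cdependent = complex_vector.dependent
    and cspan = complex_vector.span
  by unfold_locales (rule scaleC_add_right scaleC_add_left scaleC_scaleC scaleC_one)+

text \<open>
  The inner product is linear in the first argument. The library's real inner product, from which
  norm and topology are obtained, is the real part of the complex one, so that
  \<open>cinner x x = (norm x)\<^sup>2\<close>.
\<close>

class complex_hilbert_space = complex_vector + real_inner + complete_space +
  fixes cinner :: "'a \<Rightarrow> 'a \<Rightarrow> complex"
  assumes scaleR_scaleC: "r *\<^sub>R x = of_real r *\<^sub>C x"
    and cinner_commute: "cinner x y = cnj (cinner y x)"
    and cinner_add_left: "cinner (x + y) z = cinner x z + cinner y z"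
    and cinner_scaleC_left: "cinner (a *\<^sub>C x) y = a * cinner x y"
    and inner_eq_Re_cinner: "inner x y = Re (cinner x y)"

lemma cinner_self: "cinner x x = of_real ((norm x)\<^sup>2)"
proof -
  have "Im (cinner x x) = 0"
    using cinner_commute[of x x] by (metis Reals_cnj_iff complex_is_Real_iff)
  then show ?thesis
    by (simp add: complex_eq_iff power2_norm_eq_inner inner_eq_Re_cinner)
qed

instantiation complex :: complex_hilbert_space
begin

definition scaleC_complex :: "complex \<Rightarrow> complex \<Rightarrow> complex"
  where "scaleC_complex a x = a * x"

definition cinner_complex :: "complex \<Rightarrow> complex \<Rightarrow> complex"
  where "cinner_complex x y = x * cnj y"

instance
  by standard
    (auto simp: scaleC_complex_def cinner_complex_def scaleR_conv_of_real inner_complex_def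
       algebra_simps)

end

text \<open>
  The space \<open>H\<^sup>m\<close> is represented by the functions \<open>nat \<Rightarrow> 'a\<close> vanishing outside \<open>{..<m}\<close>.
\<close>

instantiation "fun" :: (type, complex_vector) complex_vector
begin

definition scaleC_fun :: "complex \<Rightarrow> ('a \<Rightarrow> 'b) \<Rightarrow> 'a \<Rightarrow> 'b"
  where "scaleC_fun a f = (\<lambda>x. a *\<^sub>C f x)"

instance
  by standard
    (auto simp: scaleC_fun_def fun_eq_iff scaleC_add_right scaleC_add_left scaleC_scaleC scaleC_one)

end

text \<open>Independence of an indexed system, repetitions counted: no two members may coincide.\<close>

definition lin_indep_family :: "('i \<Rightarrow> 'v :: complex_vector) \<Rightarrow> 'i set \<Rightarrow> bool"
  where "lin_indep_family v I \<longleftrightarrow> inj_on v I \<and> \<not> cdependent (v ` I)"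

section \<open>Bounded operators and operator pencils\<close>

definition bounded_clinear :: "('a :: complex_hilbert_space \<Rightarrow> 'a) \<Rightarrow> bool"
  where "bounded_clinear B \<longleftrightarrow> bounded_linear B \<and> (\<forall>a x. B (a *\<^sub>C x) = a *\<^sub>C B x)"

definition numerical_range :: "('a :: complex_hilbert_space \<Rightarrow> 'a) \<Rightarrow> complex set"
  where "numerical_range B = {cinner (B u) u | u. norm u = 1}"

definition cadjoint :: "('a :: complex_hilbert_space \<Rightarrow> 'a) \<Rightarrow> 'a \<Rightarrow> 'a"
  where "cadjoint B = (THE C. \<forall>x y. cinner (B x) y = cinner x (C y))"

definition pencil :: "nat \<Rightarrow> (nat \<Rightarrow> 'a \<Rightarrow> 'a) \<Rightarrow> complex \<Rightarrow> 'a \<Rightarrow> 'a :: complex_hilbert_space"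
  where "pencil n A \<mu> x = (\<Sum>j\<le>n. \<mu> ^ j *\<^sub>C A j x)"

text \<open>The notions below are stated for operator functions \<open>F\<close>, so that they apply both to a pencil
  \<open>A\<close> and to \<open>A\<^sup>*\<close>.\<close>

definition adjoint_fun ::
  "(complex \<Rightarrow> 'a \<Rightarrow> 'a) \<Rightarrow> complex \<Rightarrow> 'a \<Rightarrow> 'a :: complex_hilbert_space"
  where "adjoint_fun F \<mu> = cadjoint (F (cnj \<mu>))"

definition op_spectrum :: "(complex \<Rightarrow> 'a \<Rightarrow> 'a :: complex_hilbert_space) \<Rightarrow> complex set"
  where "op_spectrum F =
    {\<mu>. \<not> (\<exists>B. bounded_clinear B \<and> B \<circ> F \<mu> = id \<and> F \<mu> \<circ> B = id)}"

section \<open>Chains and canonical systems\<close>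

definition cderiv :: "(complex \<Rightarrow> 'a :: complex_hilbert_space) \<Rightarrow> complex \<Rightarrow> 'a"
  where "cderiv f z = (SOME D. (f has_derivative (\<lambda>h. h *\<^sub>C D)) (at z))"

text \<open>The derivatives of an operator function are taken pointwise on vectors; for operator
  polynomials these are the derivatives in operator norm.\<close>

definition op_deriv ::
  "nat \<Rightarrow> (complex \<Rightarrow> 'a \<Rightarrow> 'a) \<Rightarrow> complex \<Rightarrow> 'a \<Rightarrow> 'a :: complex_hilbert_space"
  where "op_deriv j F c x = (cderiv ^^ j) (\<lambda>\<mu>. F \<mu> x) c"

text \<open>\<open>is_chain F c p w\<close>: the vectors \<open>w 0, \<dots>, w p\<close> form a chain of length \<open>p + 1\<close>.\<close>

definition is_chain ::
  "(complex \<Rightarrow> 'a \<Rightarrow> 'a) \<Rightarrow> complex \<Rightarrow> nat \<Rightarrow> (nat \<Rightarrow> 'a :: complex_hilbert_space) \<Rightarrow> bool"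
  where "is_chain F c p w \<longleftrightarrow>
    w 0 \<noteq> 0 \<and> (\<forall>s\<le>p. (\<Sum>j\<le>s. (1 / fact j) *\<^sub>C op_deriv j F c (w (s - j))) = 0)"

text \<open>Chains are numbered \<open>k = 0, \<dots>, N - 1\<close>; the \<open>k\<close>-th one is \<open>w k 0, \<dots>, w k (p k)\<close>.\<close>

definition chain_family ::
  "(complex \<Rightarrow> 'a \<Rightarrow> 'a) \<Rightarrow> complex \<Rightarrow> nat \<Rightarrow> (nat \<Rightarrow> nat)
    \<Rightarrow> (nat \<Rightarrow> nat \<Rightarrow> 'a :: complex_hilbert_space) \<Rightarrow> bool"
  where "chain_family F c N p w \<longleftrightarrow>
    (\<forall>k<N. is_chain F c (p k) (w k)) \<and>
    lin_indep_family (\<lambda>k. w k 0) {..<N} \<and>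
    cspan ((\<lambda>k. w k 0) ` {..<N}) = {x. F c x = 0}"

definition canonical_system ::
  "(complex \<Rightarrow> 'a \<Rightarrow> 'a) \<Rightarrow> complex \<Rightarrow> nat \<Rightarrow> (nat \<Rightarrow> nat)
    \<Rightarrow> (nat \<Rightarrow> nat \<Rightarrow> 'a :: complex_hilbert_space) \<Rightarrow> bool"
  where "canonical_system F c N p w \<longleftrightarrow>
    chain_family F c N p w \<and>
    (\<forall>N' p' w'. chain_family F c N' p' w' \<longrightarrow> (\<Sum>k<N'. p' k + 1) \<le> (\<Sum>k<N. p k + 1))"

section \<open>The discrete spectrum\<close>

text \<open>
  \<open>G\<close> minus \<open>P\<close> is given by a power series in \<open>\<mu> - c\<close>, convergent in operator norm, on a punctured
  disc around \<open>c\<close>. For \<open>P\<close> a polynomial in \<open>1 / (\<mu> - c)\<close> without constant term this says that \<open>P\<close> is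
  the principal part of the Laurent expansion of \<open>G\<close> at \<open>c\<close>.
\<close>

definition has_principal_part ::
  "(complex \<Rightarrow> 'a \<Rightarrow> 'a :: complex_hilbert_space) \<Rightarrow> complex \<Rightarrow> (complex \<Rightarrow> 'a \<Rightarrow> 'a) \<Rightarrow> bool"
  where "has_principal_part G c P \<longleftrightarrow>
    (\<exists>B r. 0 < r \<and> (\<forall>m. bounded_clinear (B m)) \<and>
      (\<forall>\<mu>. 0 < cmod (\<mu> - c) \<and> cmod (\<mu> - c) < r \<longrightarrow>
        (\<lambda>M. onorm (\<lambda>x. G \<mu> x - P \<mu> x - (\<Sum>m<M. (\<mu> - c) ^ m *\<^sub>C ((B :: nat \<Rightarrow> 'a \<Rightarrow> 'a) m) x)))
          \<longlonglongrightarrow> 0))"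

definition keldysh_principal_part ::
  "complex \<Rightarrow> nat \<Rightarrow> (nat \<Rightarrow> nat) \<Rightarrow> (nat \<Rightarrow> nat \<Rightarrow> 'a) \<Rightarrow> (nat \<Rightarrow> nat \<Rightarrow> 'a)
    \<Rightarrow> complex \<Rightarrow> 'a \<Rightarrow> 'a :: complex_hilbert_space"
  where "keldysh_principal_part c N p w z \<mu> x =
    (\<Sum>k<N. \<Sum>s\<le>p k. (1 / (\<mu> - c) ^ (p k + 1 - s)) *\<^sub>C
      (\<Sum>r\<le>s. cinner x (z k (s - r)) *\<^sub>C w k r))"

text \<open>\<open>z\<close> is the adjoint canonical system of the canonical system \<open>w\<close> at \<open>c\<close>. Outside the spectrum,
  \<open>inv (F \<mu>)\<close> is the bounded inverse of \<open>F \<mu>\<close>.\<close>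

definition adjoint_canonical_system ::
  "(complex \<Rightarrow> 'a \<Rightarrow> 'a) \<Rightarrow> complex \<Rightarrow> nat \<Rightarrow> (nat \<Rightarrow> nat)
    \<Rightarrow> (nat \<Rightarrow> nat \<Rightarrow> 'a) \<Rightarrow> (nat \<Rightarrow> nat \<Rightarrow> 'a :: complex_hilbert_space) \<Rightarrow> bool"
  where "adjoint_canonical_system F c N p w z \<longleftrightarrow>
    canonical_system F c N p w \<and>
    canonical_system (adjoint_fun F) (cnj c) N p z \<and>
    has_principal_part (\<lambda>\<mu>. inv (F \<mu>)) c (keldysh_principal_part c N p w z)"

definition discrete_spectrum ::
  "(complex \<Rightarrow> 'a \<Rightarrow> 'a :: complex_hilbert_space) \<Rightarrow> complex set"
  where "discrete_spectrum F =
    {c. c isolated_in op_spectrum F \<and> (\<exists>N p w z. adjoint_canonical_system F c N p w z)}"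

section \<open>Keldysh derived chains, regular systems, halves\<close>

definition derived_fun ::
  "complex \<Rightarrow> (nat \<Rightarrow> 'a) \<Rightarrow> nat \<Rightarrow> real \<Rightarrow> 'a :: complex_hilbert_space"
  where "derived_fun c w h t =
    exp (\<i> * c * of_real t) *\<^sub>C (\<Sum>r\<le>h. ((\<i> * of_real t) ^ r / fact r) *\<^sub>C w (h - r))"

definition derived_chain ::
  "nat \<Rightarrow> complex \<Rightarrow> (nat \<Rightarrow> 'a) \<Rightarrow> nat \<Rightarrow> nat \<Rightarrow> 'a :: complex_hilbert_space"
  where "derived_chain m c w h =
    (\<lambda>i. if i < m
         then (- \<i>) ^ i *\<^sub>C (((\<lambda>f t. vector_derivative f (at t)) ^^ i) (derived_fun c w h)) 0
         else 0)"

text \<open>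
  Here \<open>n\<close> is the degree of the pencil and \<open>eps\<close> the family of sign characteristics.
  \<open>(int (p j) - 1) div 2\<close> is the rounded-down quotient, which is \<open>-1\<close> for \<open>p j = 0\<close>.
\<close>

definition regular_system ::
  "nat \<Rightarrow> (complex \<Rightarrow> 'a \<Rightarrow> 'a) \<Rightarrow> complex \<Rightarrow> nat \<Rightarrow> (nat \<Rightarrow> nat)
    \<Rightarrow> (nat \<Rightarrow> nat \<Rightarrow> 'a :: complex_hilbert_space) \<Rightarrow> (nat \<Rightarrow> int) \<Rightarrow> bool"
  where "regular_system n F c N p w eps \<longleftrightarrow>
    canonical_system F c N p w \<and>
    (\<exists>z. adjoint_canonical_system F c N p w z \<and>
      (\<forall>k<N. if even (p k)
        then eps k \<in> {1, -1} \<and>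
          derived_chain n (cnj c) (z k) (p k div 2)
            - of_int (eps k) *\<^sub>C derived_chain n c (w k) (p k div 2)
          \<in> cspan {derived_chain n c (w j) h | j h. j < N \<and> int h \<le> (int (p j) - 1) div 2}
        else eps k = 0))"

text \<open>
  Systems chosen at all points \<open>c\<close> of the discrete spectrum are families indexed by \<open>c\<close>; the vector
  \<open>w c k h\<close> has index \<open>(c, k, h)\<close>. The index set of \<open>E\<^sup>+\<close> is obtained for \<open>sg = 1\<close>, that of
  \<open>E\<^sup>-\<close> for \<open>sg = -1\<close>.
\<close>

definition half_index ::
  "(complex \<Rightarrow> 'a \<Rightarrow> 'a :: complex_hilbert_space) \<Rightarrow> (complex \<Rightarrow> nat) \<Rightarrow> (complex \<Rightarrow> nat \<Rightarrow> nat)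
    \<Rightarrow> (complex \<Rightarrow> nat \<Rightarrow> int) \<Rightarrow> int \<Rightarrow> (complex \<times> nat \<times> nat) set"
  where "half_index F N p eps sg =
    {(c, k, h). c \<in> discrete_spectrum F \<and> k < N c \<and>
      (of_int sg * Im c > 0 \<and> h \<le> p c k \<or>
       c \<in> \<real> \<and> int h \<le> (int (p c k) + sg * eps c k) div 2)}"

definition half_system ::
  "nat \<Rightarrow> (complex \<Rightarrow> nat \<Rightarrow> nat \<Rightarrow> 'a) \<Rightarrow> complex \<times> nat \<times> nat \<Rightarrow> nat \<Rightarrow> 'a :: complex_hilbert_space"
  where "half_system m w = (\<lambda>(c, k, h). derived_chain m c (w c k) h)"

end

theory Submission
  imports Defs "HOL-Complex_Analysis.Complex_Analysis"
begin

text \<open>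
  A chain \<open>w\<^sup>0, \<dots>, w\<^sup>h\<close> at \<open>c\<close> is encoded by the rational function
  \<open>R(\<mu>) = (\<Sum>r\<le>h. w\<^bsup>h-r\<^esup> / (\<mu> - c)\<^bsup>r+1\<^esup>)\<close>, the transform of its elementary solution. The entries of its
  derived chain are the coefficients of the expansion of \<open>R\<close> in powers of \<open>1/\<mu>\<close> at infinity
  (\<open>derived_chain_eq\<close>, \<open>power_times_principal_fun\<close>), and the chain equations say that \<open>A(\<mu>) R(\<mu>)\<close> is a
  polynomial (\<open>chain_equations_imp_polynomial\<close>). A linear relation between derived chains of length
  \<open>l\<close> therefore is a combination \<open>V\<close> of such functions with \<open>V(\<mu>) = O(\<mu>\<^bsup>-l-1\<^esup>)\<close>, and since \<open>n = 2l\<close>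
  the polynomial \<open>A V\<close> has degree less than \<open>l\<close>.

  Consider \<open>\<phi>(\<mu>) = (A(\<mu>) V(\<mu>), V(cnj \<mu>))\<close>. This is a scalar rational function with
  \<open>\<mu> \<phi>(\<mu>) \<rightarrow> 0\<close> at infinity, and \<open>Im \<phi> \<le> 0\<close> on the real axis because \<open>A\<close> is dissipative. If \<open>V\<close> is built
  from one of the two halves, then the non-real poles of \<open>\<phi>\<close> lie in one half plane, and the lengths
  \<open>[(p \<plusminus> \<epsilon>)/2]\<close> are just such that every real pole is simple with a residue of the corresponding
  sign (\<open>form_residue\<close>). By the maximum principle \<open>\<phi>\<close> vanishes (\<open>vanishing_poles_half_plane\<close>), that is,
  \<open>(A(t) V(t), V(t)) = 0\<close> for real \<open>t\<close>. The lowest Taylor coefficient of \<open>V\<close>, multiplied by its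
  denominator, at \<open>t\<^sub>0\<close> would then be an isotropic vector of \<open>A(t\<^sub>0)\<close>, so \<open>V = 0\<close>
  (\<open>isotropic_polynomial_eq_zero\<close>). As the eigenvectors at each point are independent, so are the
  partial fractions, and all coefficients of the relation vanish (\<open>coefficients_eq_zero\<close>).

  The residues at a real eigenvalue \<open>c\<close> rest on the non-negative form \<open>b(x, y) = (- Im A(t) x, y)\<close>.
  For \<open>\<psi>(t) = (\<Sum>s. (t - c)\<^sup>s w\<^sup>s)\<close> the chain equations give \<open>A \<psi> = (t - c)\<^bsup>p+1\<^esup> y\<close> with a polynomial \<open>y\<close>.
  Hence \<open>b(\<psi>, \<psi>)\<close> vanishes to order \<open>p + 1\<close>, even to the next even order, and by Cauchy--Schwarz
  \<open>(A f, \<psi>)\<close> is small for every \<open>f\<close>, although \<open>\<psi>\<close> belongs to \<open>A\<close> and not to its adjoint. Only pairs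
  of middle vectors of chains of equal odd length can produce a pole of \<open>\<phi>\<close>, with residue
  \<open>(y\<^sub>j(c), w\<^sub>k\<^sup>0)\<close>. The principal part of \<open>A\<^bsup>-1\<^esup>\<close> gives \<open>(y\<^sub>j(c), z\<^sub>k\<^sup>0) = \<delta>\<^sub>j\<^sub>k\<close> (\<open>biorthogonal\<close>), and regularity of the
  canonical system replaces \<open>z\<^sub>k\<^sup>0\<close> by \<open>\<epsilon>\<^sub>k w\<^sub>k\<^sup>0\<close> up to eigenvectors of longer chains, which are orthogonal to
  \<open>y\<^sub>j(c)\<close> (\<open>sign_characteristic\<close>).
\<close>

section \<open>Complex Hilbert spaces\<close>

definition clinear_map :: "('a :: complex_vector \<Rightarrow> 'b :: complex_vector) \<Rightarrow> bool"
  where "clinear_map f \<longleftrightarrow> (\<forall>x y. f (x + y) = f x + f y) \<and> (\<forall>a x. f (a *\<^sub>C x) = a *\<^sub>C f x)"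

lemma clinear_map_add: "clinear_map f \<Longrightarrow> f (x + y) = f x + f y"
  and clinear_map_scaleC: "clinear_map f \<Longrightarrow> f (a *\<^sub>C x) = a *\<^sub>C f x"
  by (auto simp: clinear_map_def)

lemma clinear_map_zero: "clinear_map f \<Longrightarrow> f 0 = 0"
  by (metis clinear_map_add add_cancel_right_right)

lemma clinear_map_sum: "clinear_map f \<Longrightarrow> f (\<Sum>i\<in>I. g i) = (\<Sum>i\<in>I. f (g i))"
  by (induction I rule: infinite_finite_induct) (auto simp: clinear_map_zero clinear_map_add)

lemmas scaleC_simps [simp] =
  scaleC_one complex_vector.scale_zero_left complex_vector.scale_zero_right

lemmas scaleC_sum_right = complex_vector.scale_sum_right
lemmas scaleC_sum_left = complex_vector.scale_sum_left

lemma cinner_scaleC_right: "cinner x (a *\<^sub>C y) = cnj a * cinner x y"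
  by (metis cinner_commute cinner_scaleC_left complex_cnj_mult)

lemma cinner_add_right: "cinner x (y + z) = cinner x y + cinner x z"
  by (metis cinner_add_left cinner_commute complex_cnj_add)

lemma cinner_zero_left [simp]: "cinner 0 x = 0"
  by (metis cinner_add_left add_cancel_right_right)

lemma cinner_zero_right [simp]: "cinner x 0 = 0"
  by (metis cinner_add_right add_cancel_right_right)

lemma cinner_diff_left: "cinner (x - y) z = cinner x z - cinner y z"
  by (metis add_diff_cancel cinner_add_left diff_add_cancel)

lemma cinner_diff_right: "cinner x (y - z) = cinner x y - cinner x z"
  by (metis add_diff_cancel cinner_add_right diff_add_cancel)

lemma cinner_sum_left: "cinner (\<Sum>i\<in>I. f i) y = (\<Sum>i\<in>I. cinner (f i) y)"
  by (induction I rule: infinite_finite_induct) (auto simp: cinner_add_left)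

lemma cinner_sum_right: "cinner y (\<Sum>i\<in>I. f i) = (\<Sum>i\<in>I. cinner y (f i))"
  by (induction I rule: infinite_finite_induct) (auto simp: cinner_add_right)

lemma cinner_eq_zeroD: "cinner x x = 0 \<Longrightarrow> x = 0"
  by (simp add: cinner_self)

lemma clinear_map_cinner: "clinear_map (\<lambda>x. cinner x y)"
  by (simp add: clinear_map_def cinner_add_left cinner_scaleC_left scaleC_complex_def)

lemma norm_scaleC [simp]: "norm (a *\<^sub>C x) = cmod a * norm (x :: 'a :: complex_hilbert_space)"
proof -
  have "complex_of_real ((norm (a *\<^sub>C x))\<^sup>2) = a * cnj a * cinner x x"
    unfolding cinner_self[symmetric] by (simp add: cinner_scaleC_left cinner_scaleC_right)
  also have "\<dots> = complex_of_real ((cmod a * norm x)\<^sup>2)"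
    by (simp add: cinner_self power_mult_distrib flip: complex_norm_square)
  finally have "(norm (a *\<^sub>C x))\<^sup>2 = (cmod a * norm x)\<^sup>2"
    by (simp only: of_real_eq_iff)
  then show ?thesis
    by (simp add: power2_eq_iff_nonneg)
qed

lemma bounded_bilinear_scaleC:
  "bounded_bilinear (scaleC :: complex \<Rightarrow> 'a \<Rightarrow> 'a :: complex_hilbert_space)"
proof
  show "\<exists>K. \<forall>a b. norm (a *\<^sub>C (b :: 'a)) \<le> norm a * norm b * K"
    by (rule exI[of _ 1]) simp
qed (simp_all add: scaleC_add_left scaleC_add_right scaleR_scaleC scaleC_scaleC
       scaleC_complex_def mult.commute)

text \<open>Multiplying \<open>x\<close> by a phase turns the complex inner product into its modulus, so that the
  bound for the real inner product carries over.\<close>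

lemma norm_cinner_le: "cmod (cinner x y) \<le> norm x * norm (y :: 'a :: complex_hilbert_space)"
proof (cases "cinner x y = 0")
  case False
  define u where "u = cnj (cinner x y) / of_real (cmod (cinner x y))"
  have u: "cmod u = 1"
    using False by (simp add: u_def norm_divide)
  have "cinner (u *\<^sub>C x) y = cnj (cinner x y) * cinner x y / of_real (cmod (cinner x y))"
    by (simp add: cinner_scaleC_left u_def)
  also have "\<dots> = of_real ((cmod (cinner x y))\<^sup>2) / of_real (cmod (cinner x y))"
    using complex_norm_square[of "cinner x y"] by (simp add: mult.commute)
  also have "\<dots> = of_real (cmod (cinner x y))"
    using False by (simp add: power2_eq_square)
  finally have "cmod (cinner x y) = inner (u *\<^sub>C x) y"
    by (simp add: inner_eq_Re_cinner)
  also have "\<dots> \<le> norm (u *\<^sub>C x) * norm y"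
    by (rule norm_cauchy_schwarz)
  finally show ?thesis
    by (simp add: u)
qed auto

lemma bounded_bilinear_cinner:
  "bounded_bilinear (cinner :: 'a \<Rightarrow> 'a :: complex_hilbert_space \<Rightarrow> complex)"
proof
  show "\<exists>K. \<forall>a b :: 'a. norm (cinner a b) \<le> norm a * norm b * K"
    by (rule exI[of _ 1]) (simp add: norm_cinner_le)
qed (simp_all add: cinner_add_left cinner_add_right scaleR_scaleC cinner_scaleC_left
       cinner_scaleC_right scaleC_complex_def)

lemmas tendsto_scaleC [tendsto_intros] = bounded_bilinear.tendsto[OF bounded_bilinear_scaleC]
lemmas tendsto_cinner [tendsto_intros] = bounded_bilinear.tendsto[OF bounded_bilinear_cinner]

lemma bounded_clinear_imp_clinear_map: "bounded_clinear B \<Longrightarrow> clinear_map B"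
  by (simp add: bounded_clinear_def clinear_map_def linear_add bounded_linear.linear)

lemma lin_indep_familyD:
  assumes "lin_indep_family v I" "finite I" "(\<Sum>i\<in>I. a i *\<^sub>C v i) = 0" "i \<in> I"
  shows "a i = 0"
proof -
  have inj: "inj_on v I" and ind: "\<not> cdependent (v ` I)"
    using assms(1) by (auto simp: lin_indep_family_def)
  have "(\<Sum>x\<in>v ` I. a (the_inv_into I v x) *\<^sub>C x) = (\<Sum>i\<in>I. a i *\<^sub>C v i)"
    using inj by (subst sum.reindex) (auto intro!: sum.cong simp: the_inv_into_f_f)
  then have "a (the_inv_into I v (v i)) = 0"
    using complex_vector.independentD[OF ind, of "v ` I" "\<lambda>x. a (the_inv_into I v x)" "v i"]
      assms by auto
  then show ?thesis
    using inj assms(4) by (simp add: the_inv_into_f_f)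
qed

lemma lin_indep_familyI:
  assumes *: "\<And>J a i. finite J \<Longrightarrow> J \<subseteq> I \<Longrightarrow> (\<Sum>i\<in>J. a i *\<^sub>C v i) = 0 \<Longrightarrow> i \<in> J \<Longrightarrow> a i = 0"
  shows "lin_indep_family v I"
  unfolding lin_indep_family_def
proof
  show inj: "inj_on v I"
  proof (rule inj_onI, rule ccontr)
    fix i j assume ij: "i \<in> I" "j \<in> I" "v i = v j" "i \<noteq> j"
    have "(\<Sum>k\<in>{i, j}. (if k = i then 1 else -1) *\<^sub>C v k) = 0"
      using ij by simp
    from *[OF _ _ this, of i] ij show False by simp
  qed
  show "\<not> cdependent (v ` I)"
    unfolding complex_vector.independent_explicit_finite_subsets
  proof (intro allI impI ballI)
    fix T u x assume T: "T \<subseteq> v ` I" "finite T" "(\<Sum>x\<in>T. u x *\<^sub>C x) = 0" "x \<in> T"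
    obtain J where J: "J \<subseteq> I" "T = v ` J"
      using T(1) by (meson subset_imageE)
    have injJ: "inj_on v J"
      using inj J(1) by (rule inj_on_subset)
    have "(\<Sum>i\<in>J. u (v i) *\<^sub>C v i) = 0"
      using T(3) unfolding J(2) by (simp add: sum.reindex[OF injJ] o_def)
    moreover have "finite J"
      using T(2) J(2) injJ finite_imageD by blast
    ultimately show "u x = 0"
      using *[of J "\<lambda>i. u (v i)"] J T(4) by auto
  qed
qed

section \<open>Functions with non-positive imaginary part on the real axis\<close>

lemma frontier_upper_half_plane: "frontier {z. 0 \<le> Im z} \<subseteq> {z. Im z = 0}"
proof -
  have "{z. 0 < Im z} \<subseteq> interior {z. 0 \<le> Im z}"
    by (rule interior_maximal) (auto simp: open_halfspace_Im_gt)
  then show ?thesis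
    by (force simp: frontier_def closure_closed closed_halfspace_Im_ge)
qed

text \<open>The maximum principle for \<open>exp (- \<i> g)\<close>, whose modulus is \<open>exp (Im g)\<close>, on large half discs.\<close>

lemma Im_nonpos_upper_half_plane:
  assumes ana: "g analytic_on {z. 0 \<le> Im z}"
    and inf: "(g \<longlongrightarrow> 0) at_infinity"
    and real: "\<And>t :: real. Im (g (of_real t)) \<le> 0"
    and z: "0 \<le> Im z"
  shows "Im (g z) \<le> 0"
proof (rule ccontr)
  assume "\<not> Im (g z) \<le> 0"
  define \<delta> where "\<delta> = Im (g z) / 2"
  have \<delta>: "0 < \<delta>" "\<delta> < Im (g z)"
    using \<open>\<not> Im (g z) \<le> 0\<close> by (auto simp: \<delta>_def)
  obtain b where b: "\<And>u. cmod u \<ge> b \<Longrightarrow> cmod (g u) < \<delta>"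
    using tendstoD[OF inf \<delta>(1)] by (auto simp: eventually_at_infinity)
  define R where "R = max b (cmod z)"
  define T where "T = cball 0 R \<inter> {z. 0 \<le> Im z}"
  have closed: "closed T"
    by (auto simp: T_def closed_halfspace_Im_ge)
  have "(\<lambda>u. exp (- \<i> * g u)) analytic_on T"
    by (intro analytic_intros analytic_on_subset[OF ana]) (auto simp: T_def)
  then have hol: "(\<lambda>u. exp (- \<i> * g u)) holomorphic_on T"
    by (rule analytic_imp_holomorphic)
  have "cmod (exp (- \<i> * g z)) \<le> exp \<delta>"
  proof (rule maximum_modulus_frontier[where S = T and f = "\<lambda>u. exp (- \<i> * g u)"])
    show "(\<lambda>u. exp (- \<i> * g u)) holomorphic_on interior T"
      using hol interior_subset by (rule holomorphic_on_subset)
    show "continuous_on (closure T) (\<lambda>u. exp (- \<i> * g u))"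
      using hol closed by (simp add: holomorphic_on_imp_continuous_on)
    show "bounded T"
      by (simp add: T_def bounded_Int)
    show "z \<in> T"
      using z by (simp add: T_def R_def)
    fix u assume "u \<in> frontier T"
    then have "u \<in> frontier (cball 0 R) \<or> u \<in> frontier {z. 0 \<le> Im z}"
      using frontier_Int_subset unfolding T_def by blast
    then have "cmod u = R \<or> Im u = 0"
      using frontier_upper_half_plane by auto
    then have "Im (g u) \<le> \<delta>"
    proof
      assume "cmod u = R"
      then have "cmod (g u) < \<delta>"
        by (intro b) (simp add: R_def)
      then show ?thesis
        using abs_Im_le_cmod[of "g u"] by linarith
    next
      assume "Im u = 0"
      then have "u = of_real (Re u)"
        by (simp add: complex_eq_iff)
      then show ?thesis
        using real[of "Re u"] \<delta>(1) by simp
    qed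
    then show "cmod (exp (- \<i> * g u)) \<le> exp \<delta>"
      by simp
  qed
  then show False
    using \<delta>(2) by simp
qed

text \<open>
  Since \<open>z g(z)\<close> tends to \<open>0\<close>, \<open>g(z)\<close> looks like \<open>a / z\<^sup>m\<close> with \<open>m \<ge> 2\<close> at infinity. The argument of \<open>z\<^sup>m\<close> ranges over
  an interval of length at least \<open>2\<pi>\<close>, which contains four values that differ by right angles, and
  only \<open>a = 0\<close> is compatible with a sign of the imaginary part.
\<close>

lemma vanishing_near_infinity:
  assumes hol: "g holomorphic_on {z. R < cmod z}" and R: "0 < R"
    and inf: "((\<lambda>z. z * g z) \<longlongrightarrow> 0) at_infinity"
    and im: "\<And>z. R < cmod z \<Longrightarrow> 0 < Im z \<Longrightarrow> Im (g z) \<le> 0"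
    and z: "R < cmod z"
  shows "g z = 0"
proof -
  define f where "f w = (if w = 0 then 0 else g (inverse w))" for w
  define B where "B = ball (0 :: complex) (inverse R)"
  have f_lim: "((\<lambda>w. f w / w) \<longlongrightarrow> 0) (at 0)"
  proof -
    have "((\<lambda>w. inverse w * g (inverse w)) \<longlongrightarrow> 0) (at 0)"
      using filterlim_compose[OF inf filterlim_inverse_at_infinity] .
    then show ?thesis
      by (rule Lim_transform_eventually)
        (auto simp: f_def eventually_at_filter field_simps)
  qed
  have "((\<lambda>w. w * (f w / w)) \<longlongrightarrow> 0 * 0) (at 0)"
    by (intro tendsto_intros f_lim)
  then have f0: "(f \<longlongrightarrow> 0) (at 0)"
    by simp (rule Lim_transform_eventually, assumption, auto simp: eventually_at_filter)
  have "f holomorphic_on B"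
  proof (rule no_isolated_singularity'[where K = "{0}"])
    have "(\<lambda>w. g (inverse w)) holomorphic_on B - {0}"
    proof (rule holomorphic_on_compose_gen[OF _ hol, unfolded o_def])
      show "inverse holomorphic_on B - {0}"
        by (intro holomorphic_intros) auto
      show "inverse ` (B - {0}) \<subseteq> {z. R < cmod z}"
        using R less_imp_inverse_less[of _ "inverse R"] by (auto simp: B_def norm_inverse)
    qed
    then show "f holomorphic_on B - {0}"
      by (rule holomorphic_transform) (auto simp: f_def)
    show "(f \<longlongrightarrow> f w) (at w within B)" if "w \<in> {0}" for w
      using that f0 by (auto simp: f_def[of 0] intro: tendsto_within_subset)
  qed (auto simp: B_def)
  have "f constant_on B"
  proof (rule ccontr)
    assume nonconst: "\<not> f constant_on B"
    have "open B" "connected B" "0 \<in> B" "f 0 = 0"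
      using R by (auto simp: B_def f_def)
    from holomorphic_factor_zero_nonconstant[OF \<open>f holomorphic_on B\<close> this nonconst]
    obtain h r m where m: "0 < m" and r: "0 < r" "ball 0 r \<subseteq> B"
      and h: "h holomorphic_on ball 0 r" "\<And>w. w \<in> ball 0 r \<Longrightarrow> f w = (w - 0) ^ m * h w"
        "\<And>w. w \<in> ball 0 r \<Longrightarrow> h w \<noteq> 0"
      by metis
    have h0: "h 0 \<noteq> 0"
      using h(3)[of 0] r by simp
    have h_cont: "(h \<longlongrightarrow> h 0) (at 0)"
      using holomorphic_on_imp_continuous_on[OF h(1)] r(1)
      by (simp add: continuous_on_eq_continuous_at isCont_def)
    have ball0: "eventually (\<lambda>w. w \<in> ball 0 r) (at (0 :: complex))"
      using r(1) by (intro eventually_at_in_open') auto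
    have "m \<noteq> 1"
    proof
      assume "m = 1"
      have "eventually (\<lambda>w. f w / w = h w) (at 0)"
        using ball0 by (auto simp: eventually_at_filter h(2) \<open>m = 1\<close> elim!: eventually_mono)
      from Lim_transform_eventually[OF f_lim this] have "h 0 = 0"
        using h_cont LIM_unique by blast
      with h0 show False by simp
    qed
    with m have m2: "2 \<le> m"
      by linarith
    have dir: "Im (cis (- \<theta>) ^ m * h 0) \<le> 0" if \<theta>: "0 < \<theta>" "\<theta> < pi" for \<theta>
    proof -
      define u where "u = cis (- \<theta>)"
      have lim: "((\<lambda>t. of_real t * u) \<longlongrightarrow> 0) (at_right (0 :: real))"
        by (rule tendsto_eq_intros refl | simp)+
      have ev: "eventually (\<lambda>t. t \<in> {0<..<r}) (at_right (0 :: real))"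
        using r(1) by (rule eventually_at_right_real)
      have "filterlim (\<lambda>t. of_real t * u) (at 0) (at_right (0 :: real))"
        unfolding filterlim_at using lim ev
        by (auto simp: u_def elim!: eventually_mono)
      then have hl: "((\<lambda>t. h (of_real t * u)) \<longlongrightarrow> h 0) (at_right (0 :: real))"
        by (rule filterlim_compose[OF h_cont])
      have "((\<lambda>t. Im (u ^ m * h (of_real t * u))) \<longlongrightarrow> Im (u ^ m * h 0)) (at_right (0 :: real))"
        by (intro tendsto_intros hl)
      then show ?thesis
        unfolding u_def[symmetric]
      proof (rule tendsto_upperbound)
        show "eventually (\<lambda>t. Im (u ^ m * h (of_real t * u)) \<le> 0) (at_right (0 :: real))"
          using ev
        proof eventually_elim
          case (elim t)
          let ?w = "of_real t * u"
          have w: "?w \<in> ball 0 r" "?w \<noteq> 0" "?w \<in> B"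
            using elim r(2) by (auto simp: u_def norm_mult)
          have "inverse ?w = of_real (inverse t) * cis \<theta>"
            by (simp add: u_def cis_inverse[symmetric] del: cis_inverse)
          then have "0 < Im (inverse ?w)"
            using elim sin_gt_zero[OF \<theta>] by simp
          moreover have "R < cmod (inverse ?w)"
            using w R less_imp_inverse_less[of "cmod ?w" "inverse R"]
            by (simp add: B_def flip: norm_inverse)
          ultimately have "Im (f ?w) \<le> 0"
            using im[of "inverse ?w"] w by (simp add: f_def)
          moreover have "f ?w = of_real (t ^ m) * (u ^ m * h ?w)"
            using h(2)[OF w(1)] by (simp add: power_mult_distrib)
          ultimately have "t ^ m * Im (u ^ m * h ?w) \<le> 0"
            by (metis Im_complex_of_real Re_complex_of_real add.right_neutral mult_zero_left
                times_complex.sel(2))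
          moreover have "0 < t ^ m"
            using elim by simp
          ultimately show ?case
            using mult_le_cancel_left_pos[of "t ^ m" "Im (u ^ m * h ?w)" 0] by simp
        qed
      qed simp
    qed
    \<comment> \<open>The offset \<open>pi / 8\<close> keeps all four angles, divided by \<open>m\<close>, strictly between \<open>0\<close> and \<open>pi\<close>.\<close>
    define G where "G = cis (- (pi / 8)) * h 0"
    have quarter_turns: "Im (cis (- (of_nat j * (pi / 2))) * G) \<le> 0" if "j \<le> 3" for j :: nat
    proof -
      let ?\<theta> = "(pi / 8 + of_nat j * (pi / 2)) / of_nat m"
      have "pi / 8 + of_nat j * (pi / 2) \<le> pi / 8 + 3 * (pi / 2)"
        using that by simp
      also have "\<dots> < 2 * pi"
        by simp
      also have "\<dots> \<le> of_nat m * pi"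
        using m2 by simp
      finally have "?\<theta> < pi"
        using m by (simp add: field_simps)
      moreover have "0 < pi / 8 + of_nat j * (pi / 2)"
        by (intro add_pos_nonneg) auto
      then have "0 < ?\<theta>"
        using m by (rule divide_pos_pos[OF _ iffD2[OF of_nat_0_less_iff]])
      ultimately have "Im (cis (- ?\<theta>) ^ m * h 0) \<le> 0"
        by (rule dir[rotated])
      moreover have "cis (- ?\<theta>) ^ m = cis (- (of_nat j * (pi / 2))) * cis (- (pi / 8))"
      proof -
        have "of_nat m * - ?\<theta> = - (of_nat j * (pi / 2)) + - (pi / 8)"
          using m by (simp add: field_simps)
        then show ?thesis
          unfolding Complex.DeMoivre cis_mult by (rule arg_cong)
      qed
      ultimately show ?thesis
        by (simp only: G_def mult.assoc)
    qed
    have "sin (3 * pi / 2) = -1" "cos (3 * pi / 2) = 0"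
      using sin_3over2_pi cos_3over2_pi by simp_all
    then have "G = 0"
      using quarter_turns[of 0] quarter_turns[of 1] quarter_turns[of 2] quarter_turns[of 3]
      by (simp add: complex_eq_iff)
    then show False
      using h0 by (simp add: G_def)
  qed
  moreover have "0 \<in> B" "inverse z \<in> B" "z \<noteq> 0"
    using R z by (auto simp: B_def norm_inverse intro: less_imp_inverse_less)
  ultimately have "f (inverse z) = f 0"
    by (metis constant_on_def)
  then show ?thesis
    using \<open>z \<noteq> 0\<close> by (simp add: f_def)
qed

lemma filterlim_of_real_at: "filterlim of_real (at (of_real c :: complex)) (at c)"
  unfolding filterlim_at by (auto intro!: tendsto_intros simp: eventually_at_filter)

lemma filterlim_cnj_at: "filterlim cnj (at (cnj s)) (at s)"
  unfolding filterlim_at by (auto intro!: tendsto_intros simp: eventually_at_filter)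

lemma filterlim_cnj_at_infinity: "filterlim cnj at_infinity at_infinity"
  unfolding filterlim_at_infinity_conv_norm_at_top by (simp add: filterlim_norm_at_top)

lemma eventually_notin_finite:
  "finite S \<Longrightarrow> eventually (\<lambda>z :: complex. z \<notin> S) (at s)"
  by (metis islimpt_finite islimpt_iff_eventually)

lemma eventually_notin_finite_at_infinity:
  assumes "finite S"
  shows "eventually (\<lambda>z :: complex. z \<notin> S) at_infinity"
proof -
  obtain R where "S \<subseteq> ball 0 R"
    using bounded_subset_ballD[OF finite_imp_bounded[OF assms]] by blast
  then show ?thesis
    by (fastforce simp: eventually_at_infinity intro!: exI[of _ R])
qed

text \<open>A pole would make \<open>h\<close> unbounded along the real axis as well.\<close>

lemma complex_limit_from_real_limit:
  assumes mero: "h meromorphic_on {of_real c}"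
    and lim: "((\<lambda>t :: real. h (of_real t)) \<longlongrightarrow> L) (at c)"
  shows "(h \<longlongrightarrow> L) (at (of_real c))"
proof -
  have "not_essential h (of_real c)"
    using mero by (simp add: meromorphic_at_iff)
  then consider x where "(h \<longlongrightarrow> x) (at (of_real c))" | "is_pole h (of_real c)"
    by (auto simp: not_essential_def)
  then show ?thesis
  proof cases
    case (1 x)
    have "((\<lambda>t. h (of_real t)) \<longlongrightarrow> x) (at c)"
      by (rule filterlim_compose[OF 1 filterlim_of_real_at])
    with lim have "x = L"
      using tendsto_unique[of "at c"] by fastforce
    with 1 show ?thesis by simp
  next
    case 2
    then have "filterlim (\<lambda>t. h (of_real t)) at_infinity (at c)"
      unfolding is_pole_def using filterlim_of_real_at by (rule filterlim_compose)
    with lim show ?thesis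
      using not_tendsto_and_filterlim_at_infinity[of "at c"] by fastforce
  qed
qed

lemma filterlim_minus_const_at_infinity:
  "filterlim (\<lambda>z. z - s) at_infinity (at_infinity :: complex filter)"
  using tendsto_add_filterlim_at_infinity[OF tendsto_const[of "- s"] filterlim_ident] by simp

lemma simple_pole_at_infinity: "((\<lambda>z. z * (\<rho> / (z - s))) \<longlongrightarrow> (\<rho> :: complex)) at_infinity"
proof -
  have "((\<lambda>z. \<rho> * (s / (z - s) + 1)) \<longlongrightarrow> \<rho> * (0 + 1)) at_infinity"
    by (intro tendsto_intros tendsto_divide_0[OF tendsto_const] filterlim_minus_const_at_infinity)
  moreover have "eventually (\<lambda>z. z \<notin> {s}) at_infinity"
    by (rule eventually_notin_finite_at_infinity) simp
  ultimately show ?thesis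
    by (auto elim!: Lim_transform_eventually eventually_mono simp: field_simps)
qed

text \<open>
  Subtracting the principal parts \<open>\<rho> / (z - s)\<close> at the real poles does not change the imaginary
  part on the real axis. What remains is holomorphic in the closed upper half plane, hence
  has non-positive imaginary part there, and behaves like \<open>- (\<Sum>s. \<rho> s) / z\<close> at infinity. On the
  imaginary axis this shows that the sum of the residues is non-positive, so all of them vanish.
\<close>

lemma vanishing_poles_lower_half_plane:
  assumes S: "finite S" "\<And>s. s \<in> S \<Longrightarrow> Im s \<le> 0"
    and hol: "\<phi> holomorphic_on - S"
    and res: "\<And>s. s \<in> S \<Longrightarrow> Im s = 0 \<Longrightarrow>
      0 \<le> \<rho> s \<and> ((\<lambda>z. (z - s) * \<phi> z) \<longlongrightarrow> of_real (\<rho> s)) (at s)"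
    and inf: "((\<lambda>z. z * \<phi> z) \<longlongrightarrow> 0) at_infinity"
    and im: "\<And>t :: real. of_real t \<notin> S \<Longrightarrow> Im (\<phi> (of_real t)) \<le> 0"
    and z: "z \<notin> S"
  shows "\<phi> z = 0"
proof -
  define T where "T = {s \<in> S. Im s = 0}"
  have T: "finite T" "T \<subseteq> S"
    using S by (auto simp: T_def)
  define \<psi>0 where "\<psi>0 z = \<phi> z - (\<Sum>s\<in>T. of_real (\<rho> s) / (z - s))" for z
  define \<psi> where "\<psi> = remove_sings \<psi>0"
  have open_S: "open (- S)"
    using S(1) by (simp add: finite_imp_closed open_Compl)
  have hol0: "\<psi>0 holomorphic_on - S"
    unfolding \<psi>0_def using T by (intro holomorphic_intros hol) auto
  then have ana0: "\<psi>0 analytic_on - S"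
    using open_S by (simp add: analytic_on_open)
  have \<psi>_eq: "\<psi> z = \<psi>0 z" if "z \<notin> S" for z
    unfolding \<psi>_def using that by (intro remove_sings_at_analytic analytic_on_subset[OF ana0]) auto
  note near = eventually_notin_finite[OF S(1)]
  have \<psi>_real: "\<psi> analytic_on {s}" if s: "s \<in> T" for s
  proof -
    obtain r where "r > 0" "\<And>z. z \<noteq> s \<Longrightarrow> dist z s < r \<Longrightarrow> z \<notin> S"
      using near[of s] by (auto simp: eventually_at)
    then have r: "r > 0" "ball s r - {s} \<subseteq> - S"
      by (auto simp: dist_commute)
    have hol_ball: "\<psi>0 holomorphic_on ball s r - {s}"
      using hol0 r(2) by (rule holomorphic_on_subset)
    have 1: "((\<lambda>z. (z - s) * \<phi> z) \<longlongrightarrow> of_real (\<rho> s)) (at s)"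
      using res[of s] s by (auto simp: T_def)
    have 2: "((\<lambda>z. \<Sum>x\<in>T. (z - s) * (of_real (\<rho> x) / (z - x)))
        \<longlongrightarrow> (\<Sum>x\<in>T. if x = s then of_real (\<rho> x) else 0)) (at s)"
    proof (rule tendsto_sum)
      fix x
      show "((\<lambda>z. (z - s) * (of_real (\<rho> x) / (z - x))) \<longlongrightarrow> (if x = s then of_real (\<rho> x) else 0)) (at s)"
      proof (cases "x = s")
        case True
        then show ?thesis
          by (auto simp: eventually_at_filter intro!: tendsto_eventually)
      next
        case False
        then have "((\<lambda>z. (z - s) * (of_real (\<rho> x) / (z - x))) \<longlongrightarrow> (s - s) * (of_real (\<rho> x) / (s - x))) (at s)"
          by (intro tendsto_intros) auto
        then show ?thesis
          using False by simp
      qed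
    qed
    have "((\<lambda>z. (z - s) * \<phi> z - (\<Sum>x\<in>T. (z - s) * (of_real (\<rho> x) / (z - x))))
      \<longlongrightarrow> of_real (\<rho> s) - (\<Sum>x\<in>T. if x = s then of_real (\<rho> x) else 0)) (at s)"
      by (intro tendsto_diff 1 2)
    then have "((\<lambda>z. (z - s) * \<psi>0 z) \<longlongrightarrow> 0) (at s)"
      using s T by (simp add: \<psi>0_def right_diff_distrib sum_distrib_left)
    then have "\<exists>g. g holomorphic_on ball s r \<and> (\<forall>z\<in>ball s r - {s}. g z = \<psi>0 z)"
      using holomorphic_on_extend_lim[OF hol_ball] r(1) by auto
    then obtain g where g: "g holomorphic_on ball s r" "\<forall>z\<in>ball s r - {s}. g z = \<psi>0 z"
      by blast
    have "(g \<longlongrightarrow> g s) (at s)"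
      using holomorphic_on_imp_continuous_on[OF g(1)] r(1)
      by (simp add: continuous_on_eq_continuous_at isCont_def)
    moreover have "eventually (\<lambda>z. g z = \<psi>0 z) (at s)"
      using eventually_at_in_open[of "ball s r" s] r(1) g(2) by (auto elim!: eventually_mono)
    ultimately have "(\<psi>0 \<longlongrightarrow> g s) (at s)"
      by (rule Lim_transform_eventually)
    moreover have "isolated_singularity_at \<psi>0 s"
      using hol_ball r(1) by (auto simp: isolated_singularity_at_def analytic_on_open open_delete)
    ultimately show ?thesis
      unfolding \<psi>_def by (intro remove_sings_analytic_at)
  qed
  have ana: "\<psi> analytic_on {z. 0 \<le> Im z}"
    unfolding analytic_on_analytic_at[of _ "{z. 0 \<le> Im z}"]
  proof
    fix z assume z: "z \<in> {z. 0 \<le> Im z}"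
    show "\<psi> analytic_on {z}"
    proof (cases "z \<in> S")
      case True
      then show ?thesis
        using z S(2)[of z] by (intro \<psi>_real) (auto simp: T_def)
    next
      case False
      then show ?thesis
        unfolding \<psi>_def
        by (intro remove_sings_analytic_on analytic_on_subset[OF ana0]) auto
    qed
  qed
  obtain R where R: "R > 0" "S \<subseteq> ball 0 R"
    using bounded_subset_ballD[OF finite_imp_bounded[OF S(1)]] by blast
  have z\<psi>: "((\<lambda>z. z * \<psi> z) \<longlongrightarrow> - of_real (\<Sum>s\<in>T. \<rho> s)) at_infinity"
  proof -
    have "((\<lambda>z. z * \<phi> z - (\<Sum>s\<in>T. z * (of_real (\<rho> s) / (z - s)))) \<longlongrightarrow> 0 - (\<Sum>s\<in>T. of_real (\<rho> s))) at_infinity"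
      by (intro tendsto_intros inf simple_pole_at_infinity)
    then have "((\<lambda>z. z * \<psi>0 z) \<longlongrightarrow> - of_real (\<Sum>s\<in>T. \<rho> s)) at_infinity"
      by (simp add: \<psi>0_def right_diff_distrib sum_distrib_left)
    then show ?thesis
      by (rule Lim_transform_eventually) (use eventually_notin_finite_at_infinity[OF S(1)] in eventually_elim, simp add: \<psi>_eq)
  qed
  have \<psi>_inf: "(\<psi> \<longlongrightarrow> 0) at_infinity"
  proof -
    have "((\<lambda>z. inverse z * (z * \<psi> z)) \<longlongrightarrow> 0 * - of_real (\<Sum>s\<in>T. \<rho> s)) at_infinity"
      by (intro tendsto_mult z\<psi> tendsto_inverse_0)
    moreover have "eventually (\<lambda>z :: complex. z \<noteq> 0) at_infinity"
      by (auto simp: eventually_at_infinity intro!: exI[of _ 1])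
    ultimately show ?thesis
      by (auto elim!: Lim_transform_eventually eventually_mono)
  qed
  have real: "Im (\<psi> (of_real t)) \<le> 0" for t :: real
  proof -
    have *: "Im (\<psi> (of_real x)) \<le> 0" if "of_real x \<notin> S" for x :: real
    proof -
      have "Im (of_real (\<rho> s) / (of_real x - s)) = 0" if "s \<in> T" for s
      proof -
        have "s = of_real (Re s)"
          using that by (simp add: T_def complex_eq_iff)
        then have "of_real (\<rho> s) / (of_real x - s) = of_real (\<rho> s / (x - Re s))"
          by (metis of_real_diff of_real_divide)
        then show ?thesis
          by (simp only: Im_complex_of_real)
      qed
      then show ?thesis
        using im[OF that] by (simp add: \<psi>_eq that \<psi>0_def)
    qed
    have "\<psi> analytic_on {of_real t}"
      by (rule analytic_on_subset[OF ana]) auto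
    then have c: "(\<psi> \<longlongrightarrow> \<psi> (of_real t)) (at (of_real t))"
      by (simp add: analytic_at_imp_isCont isContD)
    have "((\<lambda>x. Im (\<psi> (of_real x))) \<longlongrightarrow> Im (\<psi> (of_real t))) (at t)"
      by (intro tendsto_intros filterlim_compose[OF c filterlim_of_real_at])
    moreover have "eventually (\<lambda>x. Im (\<psi> (of_real x)) \<le> 0) (at t)"
      using filterlim_iff[THEN iffD1, OF filterlim_of_real_at[of t], rule_format, OF near] * by (auto elim!: eventually_mono)
    ultimately show ?thesis
      by (rule tendsto_upperbound) simp
  qed
  have upper: "Im (\<psi> z) \<le> 0" if "0 \<le> Im z" for z
    using Im_nonpos_upper_half_plane[OF ana \<psi>_inf real that] by simp
  \<comment> \<open>The limit along the imaginary axis gives the sign of the sum of the residues.\<close>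
  have "0 \<le> - (\<Sum>s\<in>T. \<rho> s)"
  proof -
    have "filterlim (\<lambda>y. \<i> * of_real y) at_infinity at_top"
      by (rule tendsto_mult_filterlim_at_infinity[OF tendsto_const])
        (auto intro: filterlim_of_real_at_infinity)
    from filterlim_compose[OF z\<psi> this]
    have "((\<lambda>y. Re (\<i> * of_real y * \<psi> (\<i> * of_real y))) \<longlongrightarrow> Re (- of_real (\<Sum>s\<in>T. \<rho> s))) at_top"
      by (intro tendsto_intros)
    then have "((\<lambda>y. Re (\<i> * of_real y * \<psi> (\<i> * of_real y))) \<longlongrightarrow> - (\<Sum>s\<in>T. \<rho> s)) at_top"
      by simp
    then show ?thesis
    proof (rule tendsto_lowerbound)
      show "eventually (\<lambda>y. 0 \<le> Re (\<i> * of_real y * \<psi> (\<i> * of_real y))) at_top"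
        using eventually_ge_at_top[of 0]
        by eventually_elim (simp add: upper mult_nonneg_nonpos)
    qed simp
  qed
  moreover have nonneg: "\<And>s. s \<in> T \<Longrightarrow> 0 \<le> \<rho> s"
    using res by (auto simp: T_def)
  then have "0 \<le> (\<Sum>s\<in>T. \<rho> s)"
    by (rule sum_nonneg)
  ultimately have "(\<Sum>s\<in>T. \<rho> s) = 0"
    by linarith
  then have \<rho>0: "\<forall>s\<in>T. \<rho> s = 0"
    using sum_nonneg_eq_0_iff[OF T(1), of \<rho>] nonneg by blast
  then have \<psi>\<phi>: "\<psi> z = \<phi> z" if "z \<notin> S" for z
    by (simp add: \<psi>_eq that \<psi>0_def \<rho>0)
  have big: "z \<notin> S" if "R < cmod z" for z
    using that R by force
  have far0: "\<phi> z = 0" if "R < cmod z" for z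
  proof (rule vanishing_near_infinity[OF _ R(1) inf _ that])
    show "\<phi> holomorphic_on {z. R < cmod z}"
      by (rule holomorphic_on_subset[OF hol]) (use big in auto)
    show "Im (\<phi> z) \<le> 0" if "R < cmod z" "0 < Im z" for z
      using upper[of z] \<psi>\<phi>[OF big[OF that(1)]] that by simp
  qed
  show ?thesis
  proof (rule analytic_continuation_open[of "{z. R < cmod z}" "- S" \<phi> "\<lambda>_. 0"])
    show "open {z. R < cmod z}"
      by (intro open_Collect_less continuous_intros)
    show "{z. R < cmod z} \<noteq> {}"
      using R(1) by (auto intro!: exI[of _ "of_real (R + 1)"] simp del: of_real_add)
    show "connected (- S)"
      using connected_open_delete_finite[of UNIV S] S(1) connected_UNIV by (simp add: Compl_eq_Diff_UNIV)
    show "{z. R < cmod z} \<subseteq> - S"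
      using big by auto
  qed (use open_S hol far0 z in auto)
qed

text \<open>The case \<open>sg = -1\<close> follows by passing to \<open>- cnj (\<phi> (cnj z))\<close>, which reflects the poles but keeps
  the sign of the imaginary part on the real axis.\<close>

lemma vanishing_poles_half_plane:
  fixes sg :: real
  assumes sg: "sg = 1 \<or> sg = -1"
    and S: "finite S" "\<And>s. s \<in> S \<Longrightarrow> sg * Im s \<le> 0"
    and hol: "\<phi> holomorphic_on - S"
    and res: "\<And>s. s \<in> S \<Longrightarrow> Im s = 0 \<Longrightarrow>
      0 \<le> sg * \<rho> s \<and> ((\<lambda>z. (z - s) * \<phi> z) \<longlongrightarrow> of_real (\<rho> s)) (at s)"
    and inf: "((\<lambda>z. z * \<phi> z) \<longlongrightarrow> 0) at_infinity"
    and im: "\<And>t :: real. of_real t \<notin> S \<Longrightarrow> Im (\<phi> (of_real t)) \<le> 0"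
    and z: "z \<notin> S"
  shows "\<phi> z = 0"
proof (cases "sg = 1")
  case True
  then show ?thesis
    using vanishing_poles_lower_half_plane[OF S(1) _ hol, of \<rho>] assms by simp
next
  case False
  with sg have sg: "sg = -1" by simp
  define \<phi>' where "\<phi>' z = - cnj (\<phi> (cnj z))" for z
  have S_iff: "z \<in> cnj ` S \<longleftrightarrow> cnj z \<in> S" for z
    by (auto intro: rev_image_eqI)
  have "\<phi>' (cnj z) = 0"
  proof (rule vanishing_poles_lower_half_plane[where \<phi> = \<phi>' and S = "cnj ` S" and \<rho> = "\<lambda>s. - \<rho> (cnj s)"])
    show "finite (cnj ` S)"
      using S(1) by simp
    show "Im s \<le> 0" if "s \<in> cnj ` S" for s
      using that S(2) sg by fastforce
    have "cnj ` (- (cnj ` S)) = - S"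
      using bij_image_Compl_eq[OF involuntory_imp_bij[of cnj]] by (simp add: image_image)
    then have "(cnj \<circ> \<phi> \<circ> cnj) holomorphic_on - (cnj ` S)"
      using S(1) hol by (intro holomorphic_on_compose_cnj_cnj)
        (simp_all add: finite_imp_closed open_Compl)
    then have "(\<lambda>z. - (cnj \<circ> \<phi> \<circ> cnj) z) holomorphic_on - (cnj ` S)"
      by (intro holomorphic_intros)
    then show "\<phi>' holomorphic_on - (cnj ` S)"
      by (simp add: \<phi>'_def[abs_def] o_def)
    show "0 \<le> - \<rho> (cnj s) \<and> ((\<lambda>z. (z - s) * \<phi>' z) \<longlongrightarrow> of_real (- \<rho> (cnj s))) (at s)"
      if s: "s \<in> cnj ` S" "Im s = 0" for s
    proof
      have s': "cnj s \<in> S" "Im (cnj s) = 0"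
        using s by (auto simp: S_iff)
      show "0 \<le> - \<rho> (cnj s)"
        using res[OF s'] sg by simp
      from filterlim_compose[OF conjunct2[OF res[OF s']] filterlim_cnj_at]
      have "((\<lambda>z. - cnj ((cnj z - cnj s) * \<phi> (cnj z))) \<longlongrightarrow> - cnj (of_real (\<rho> (cnj s)))) (at s)"
        by (intro tendsto_intros)
      then show "((\<lambda>z. (z - s) * \<phi>' z) \<longlongrightarrow> of_real (- \<rho> (cnj s))) (at s)"
        by (simp add: \<phi>'_def)
    qed
    from filterlim_compose[OF inf filterlim_cnj_at_infinity]
    have "((\<lambda>z. - cnj (cnj z * \<phi> (cnj z))) \<longlongrightarrow> - cnj 0) at_infinity"
      by (intro tendsto_intros)
    then show "((\<lambda>z. z * \<phi>' z) \<longlongrightarrow> 0) at_infinity"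
      by (simp add: \<phi>'_def)
    show "Im (\<phi>' (of_real t)) \<le> 0" if "of_real t \<notin> cnj ` S" for t :: real
      using that im[of t] by (simp add: \<phi>'_def S_iff)
    show "cnj z \<notin> cnj ` S"
      using z by (simp add: S_iff)
  qed
  then show ?thesis
    by (simp add: \<phi>'_def)
qed

section \<open>Chains, derived chains and partial fractions\<close>

text \<open>Up to the factor \<open>-\<i>\<close> this is \<open>\<integral>\<^sub>0\<^sup>\<infinity> exp (- \<i> * \<mu> * t) * derived_fun c w h t dt\<close>, which
  converges for \<open>Im \<mu> < Im c\<close>.\<close>

definition principal_fun :: "complex \<Rightarrow> (nat \<Rightarrow> 'a) \<Rightarrow> nat \<Rightarrow> complex \<Rightarrow> 'a :: complex_vector"
  where "principal_fun c w h \<mu> = (\<Sum>r\<le>h. (1 / (\<mu> - c) ^ (r + 1)) *\<^sub>C w (h - r))"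

text \<open>The coefficient of \<open>1 / \<mu>\<^bsup>i+1\<^esup>\<close> in the expansion of \<open>principal_fun c w h \<mu>\<close> at infinity.\<close>

definition derived_vector :: "complex \<Rightarrow> (nat \<Rightarrow> 'a) \<Rightarrow> nat \<Rightarrow> nat \<Rightarrow> 'a :: complex_vector"
  where "derived_vector c w h i = (\<Sum>r\<le>h. (of_nat (i choose r) * c ^ (i - r)) *\<^sub>C w (h - r))"

text \<open>The coefficient of \<open>(\<mu> - c)\<^sup>i\<close> in \<open>(\<Sum>j\<le>n. \<mu> ^ j *\<^sub>C G j x)\<close>, that is, the \<open>i\<close>-th derivative at \<open>c\<close>
  divided by \<open>i!\<close>.\<close>

definition taylor_coeff :: "nat \<Rightarrow> (nat \<Rightarrow> 'a \<Rightarrow> 'b) \<Rightarrow> complex \<Rightarrow> nat \<Rightarrow> 'a \<Rightarrow> 'b :: complex_vector"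
  where "taylor_coeff n G c i x = (\<Sum>j\<le>n. (of_nat (j choose i) * c ^ (j - i)) *\<^sub>C G j x)"

subsection \<open>Derived chains\<close>

text \<open>Pascal's rule for the coefficients \<open>(i choose r) * c ^ (i - r)\<close>; the truncated exponent is harmless
  because the binomial coefficient vanishes whenever the exponent is truncated.\<close>

lemma binomial_power_step:
  "of_nat (Suc i choose Suc r) * (c :: complex) ^ (Suc i - Suc r) =
    c * (of_nat (i choose Suc r) * c ^ (i - Suc r)) + of_nat (i choose r) * c ^ (i - r)"
proof (cases "Suc r \<le> i")
  case True
  then have "c * c ^ (i - Suc r) = c ^ (i - r)"
    by (metis Suc_diff_Suc Suc_le_eq power_Suc)
  then have "c * (of_nat (i choose Suc r) * c ^ (i - Suc r)) = of_nat (i choose Suc r) * c ^ (i - r)"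
    by (simp add: mult.left_commute)
  then show ?thesis
    by (simp only: binomial_Suc_Suc of_nat_add diff_Suc_Suc distrib_right add.commute)
next
  case False
  then show ?thesis
    by (simp add: binomial_eq_0)
qed

lemma pascal_sum:
  "(\<Sum>r\<le>h. (c * (of_nat (i choose r) * c ^ (i - r))) *\<^sub>C f (h - r)) +
    (\<Sum>r\<le>h. (of_nat (i choose r) * c ^ (i - r)) *\<^sub>C (if r < h then f (h - Suc r) else 0)) =
   (\<Sum>r\<le>h. (of_nat (Suc i choose r) * c ^ (Suc i - r)) *\<^sub>C f (h - r))"
proof -
  define k where "k i r = of_nat (i choose r) * c ^ (i - r)" for i r
  have k: "c * k i (Suc r) + k i r = k (Suc i) (Suc r)" "c * k i 0 = k (Suc i) 0" for r
    unfolding k_def by (rule binomial_power_step[symmetric], simp)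
  have "(\<Sum>r\<le>h. k i r *\<^sub>C (if r < h then f (h - Suc r) else 0)) = (\<Sum>r<h. k i r *\<^sub>C f (h - Suc r))"
    by (rule sum.mono_neutral_cong_right) auto
  moreover have "(\<Sum>r\<le>h. (c * k i r) *\<^sub>C f (h - r)) + (\<Sum>r<h. k i r *\<^sub>C f (h - Suc r)) =
    (\<Sum>r\<le>h. k (Suc i) r *\<^sub>C f (h - r))"
    using k by (cases h) (simp_all add: sum.atMost_Suc_shift lessThan_Suc_atMost add.assoc
        sum.distrib[symmetric] scaleC_add_left[symmetric] del: sum.atMost_Suc)
  ultimately show ?thesis
    by (simp add: k_def)
qed

lemma derived_fun_Suc:
  "(derived_fun c w (Suc h) has_vector_derivative
    (\<i> * c) *\<^sub>C derived_fun c w (Suc h) t + \<i> *\<^sub>C derived_fun c w h t) (at t)" and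
  derived_fun_0:
  "(derived_fun c w 0 has_vector_derivative (\<i> * c) *\<^sub>C derived_fun c w 0 t) (at t)"
  for w :: "nat \<Rightarrow> 'a :: complex_hilbert_space"
proof -
  define e where "e r t = exp (\<i> * c * of_real t) * ((\<i> * of_real t) ^ r / fact r)" for r and t :: real
  have scaled: "((\<lambda>t. f t *\<^sub>C x) has_vector_derivative d *\<^sub>C x) (at t)"
    if "(f has_vector_derivative d) (at t)" for f d and x :: 'a
    using bounded_linear.has_vector_derivative[OF
        bounded_bilinear.bounded_linear_left[OF bounded_bilinear_scaleC] that] .
  have e0: "(e 0 has_vector_derivative (\<i> * c) * e 0 t) (at t)"
    unfolding e_def by (auto intro!: derivative_eq_intros has_vector_derivative_real_field)
  have eS: "(e (Suc r) has_vector_derivative (\<i> * c) * e (Suc r) t + \<i> * e r t) (at t)" for r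
  proof -
    have fact: "of_nat (Suc r) * (x / fact (Suc r)) = x / fact r" for x :: complex
      by (simp del: of_nat_Suc)
    have "((\<lambda>z. exp (\<i> * c * z) * ((\<i> * z) ^ Suc r / fact (Suc r))) has_field_derivative
      exp (\<i> * c * z) * (\<i> * c) * ((\<i> * z) ^ Suc r / fact (Suc r))
      + of_nat (Suc r) * (\<i> * (\<i> * z) ^ r / fact (Suc r)) * exp (\<i> * c * z)) (at z)" for z
      by (intro derivative_eq_intros) (auto simp del: of_nat_Suc power_Suc fact_Suc)
    from this[unfolded fact, of "of_real t"]
    have "((\<lambda>z. exp (\<i> * c * z) * ((\<i> * z) ^ Suc r / fact (Suc r))) has_field_derivative
      (\<i> * c) * (exp (\<i> * c * of_real t) * ((\<i> * of_real t) ^ Suc r / fact (Suc r)))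
      + \<i> * (exp (\<i> * c * of_real t) * ((\<i> * of_real t) ^ r / fact r))) (at (of_real t))"
      by (rule DERIV_cong) (simp only: times_divide_eq_right mult_ac)
    then show ?thesis
      unfolding e_def by (rule has_vector_derivative_real_field)
  qed
  have df: "derived_fun c w h t = (\<Sum>r\<le>h. e r t *\<^sub>C w (h - r))" for h t
    by (simp add: derived_fun_def e_def scaleC_sum_right scaleC_scaleC)
  show "(derived_fun c w 0 has_vector_derivative (\<i> * c) *\<^sub>C derived_fun c w 0 t) (at t)"
    using scaled[OF e0] by (simp add: df[abs_def] scaleC_scaleC)
  have "((\<lambda>t. e 0 t *\<^sub>C w (Suc h) + (\<Sum>r\<le>h. e (Suc r) t *\<^sub>C w (h - r))) has_vector_derivative
    ((\<i> * c) * e 0 t) *\<^sub>C w (Suc h) +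
      (\<Sum>r\<le>h. ((\<i> * c) * e (Suc r) t + \<i> * e r t) *\<^sub>C w (h - r))) (at t)"
    by (intro derivative_intros scaled e0 eS)
  then show "(derived_fun c w (Suc h) has_vector_derivative
    (\<i> * c) *\<^sub>C derived_fun c w (Suc h) t + \<i> *\<^sub>C derived_fun c w h t) (at t)"
    by (simp add: df[abs_def] sum.atMost_Suc_shift scaleC_add_right scaleC_add_left
        scaleC_sum_right scaleC_scaleC sum.distrib add.assoc del: sum.atMost_Suc)
qed

lemma derived_fun_at_0: "derived_fun c w h 0 = w h"
proof -
  have "(\<Sum>r\<le>h. (0 ^ r / fact r) *\<^sub>C w (h - r)) = w h"
    by (subst sum.remove[of _ 0]) (auto intro!: sum.neutral)
  then show ?thesis
    by (simp add: derived_fun_def)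
qed

text \<open>On the elementary solutions of a chain, \<open>-\<i> d/dt\<close> acts as \<open>c\<close> plus the shift \<open>h \<mapsto> h - 1\<close>, so that its
  powers are given by the binomial theorem.\<close>

lemma iterated_derivative_derived_fun:
  fixes w :: "nat \<Rightarrow> 'a :: complex_hilbert_space"
  shows "((\<lambda>f t. vector_derivative f (at t)) ^^ i) (derived_fun c w h) =
    (\<lambda>t. \<i> ^ i *\<^sub>C (\<Sum>r\<le>h. (of_nat (i choose r) * c ^ (i - r)) *\<^sub>C derived_fun c w (h - r) t))"
proof (induction i)
  case 0
  have "(\<Sum>r\<le>h. (of_nat (0 choose r) * c ^ (0 - r)) *\<^sub>C derived_fun c w (h - r) t) =
    derived_fun c w h t" for t
    by (subst sum.remove[of _ 0]) (auto intro!: sum.neutral)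
  then show ?case
    by simp
next
  case (Suc i)
  have "vector_derivative (\<lambda>t. \<i> ^ i *\<^sub>C
      (\<Sum>r\<le>h. (of_nat (i choose r) * c ^ (i - r)) *\<^sub>C derived_fun c w (h - r) t)) (at t) =
    \<i> ^ Suc i *\<^sub>C (\<Sum>r\<le>h. (of_nat (Suc i choose r) * c ^ (Suc i - r)) *\<^sub>C derived_fun c w (h - r) t)"
    (is "?L = ?R") for t
  proof -
    define k where "k i r = of_nat (i choose r) * c ^ (i - r)" for i r
    define d where "d r = (if r < h then derived_fun c w (h - Suc r) t else 0)" for r
    have deriv: "(derived_fun c w (h - r) has_vector_derivative
      (\<i> * c) *\<^sub>C derived_fun c w (h - r) t + \<i> *\<^sub>C d r) (at t)" if "r \<le> h" for r
    proof (cases "r = h")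
      case True
      then show ?thesis
        using derived_fun_0[of c w t] by (simp add: d_def)
    next
      case False
      then have "h - r = Suc (h - Suc r)" "r < h"
        using that by auto
      then show ?thesis
        using derived_fun_Suc[of c w "h - Suc r" t] by (simp add: d_def)
    qed
    have scale: "((\<lambda>t. a *\<^sub>C f t) has_vector_derivative a *\<^sub>C f') (at t)"
      if "(f has_vector_derivative f') (at t)" for a f and f' :: 'a
      using bounded_linear.has_vector_derivative[OF
          bounded_bilinear.bounded_linear_right[OF bounded_bilinear_scaleC] that] .
    have "?L = \<i> ^ i *\<^sub>C (\<Sum>r\<le>h. k i r *\<^sub>C ((\<i> * c) *\<^sub>C derived_fun c w (h - r) t + \<i> *\<^sub>C d r))"
      unfolding k_def
      by (intro vector_derivative_at scale has_vector_derivative_sum deriv) auto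
    also have "\<dots> = \<i> ^ Suc i *\<^sub>C ((\<Sum>r\<le>h. (c * k i r) *\<^sub>C derived_fun c w (h - r) t) + (\<Sum>r\<le>h. k i r *\<^sub>C d r))"
      by (simp add: scaleC_add_right scaleC_sum_right scaleC_scaleC sum.distrib mult_ac)
    also have "\<dots> = \<i> ^ Suc i *\<^sub>C (\<Sum>r\<le>h. k (Suc i) r *\<^sub>C derived_fun c w (h - r) t)"
      unfolding k_def d_def
      by (rule arg_cong[OF pascal_sum[where f = "\<lambda>g. derived_fun c w g t"], of "scaleC _"])
    finally show ?thesis
      by (simp add: k_def)
  qed
  then show ?case
    by (simp add: Suc.IH del: power_Suc)
qed

lemma derived_chain_eq:
  "derived_chain m c w h = (\<lambda>i. if i < m then derived_vector c w h i else 0)"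
proof
  fix i
  have "(- \<i>) ^ i * \<i> ^ i = (1 :: complex)"
    by (simp flip: power_mult_distrib)
  then show "derived_chain m c w h i = (if i < m then derived_vector c w h i else 0)"
    by (simp add: derived_chain_def iterated_derivative_derived_fun derived_fun_at_0
        scaleC_scaleC derived_vector_def)
qed

subsection \<open>Multiplication of partial fractions by powers\<close>

lemma principal_fun_step:
  assumes "\<mu> \<noteq> c"
  shows "(\<mu> - c) *\<^sub>C principal_fun c w h \<mu> =
    w h + (if h = 0 then 0 else principal_fun c w (h - 1) \<mu>)"
proof -
  have frac: "(\<mu> - c) * (1 / (\<mu> - c) ^ (s + 1)) = 1 / (\<mu> - c) ^ s" for s
    using assms by (simp add: field_simps)
  have "(\<mu> - c) *\<^sub>C principal_fun c w h \<mu> = (\<Sum>s\<le>h. (1 / (\<mu> - c) ^ s) *\<^sub>C w (h - s))"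
    unfolding principal_fun_def scaleC_sum_right scaleC_scaleC frac ..
  then show ?thesis
    by (cases h) (simp_all add: principal_fun_def sum.atMost_Suc_shift del: sum.atMost_Suc)
qed

text \<open>Multiplication by \<open>\<mu>\<close> acts on the partial fractions of a chain like \<open>-\<i> d/dt\<close> on its elementary
  solutions, as \<open>c\<close> plus a shift, except that a constant splits off in every step. These constants
  make up the polynomial, whose coefficients are the derived vectors.\<close>

lemma power_times_principal_fun:
  assumes "\<mu> \<noteq> c"
  shows "\<mu> ^ j *\<^sub>C principal_fun c w h \<mu> =
    (\<Sum>i<j. \<mu> ^ (j - 1 - i) *\<^sub>C derived_vector c w h i) +
    (\<Sum>r\<le>h. (of_nat (j choose r) * c ^ (j - r)) *\<^sub>C principal_fun c w (h - r) \<mu>)"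
proof (induction j)
  case 0
  have "(\<Sum>r\<le>h. (of_nat (0 choose r) * c ^ (0 - r)) *\<^sub>C principal_fun c w (h - r) \<mu>) =
    principal_fun c w h \<mu>"
    by (subst sum.remove[of _ 0]) (auto intro!: sum.neutral)
  then show ?case
    by simp
next
  case (Suc j)
  define k where "k i r = of_nat (i choose r) * c ^ (i - r)" for i r
  define P where "P g = principal_fun c w g \<mu>" for g
  define d where "d r = (if r < h then P (h - Suc r) else 0)" for r
  have step: "\<mu> *\<^sub>C P (h - r) = w (h - r) + c *\<^sub>C P (h - r) + d r" if "r \<le> h" for r
  proof -
    have "(\<mu> - c) *\<^sub>C P (h - r) = w (h - r) + d r"
      using principal_fun_step[OF assms, of w "h - r"] that by (simp add: P_def d_def)
    then show ?thesis
      by (simp add: complex_vector.scale_left_diff_distrib algebra_simps)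
  qed
  have "\<mu> ^ Suc j *\<^sub>C P h = \<mu> *\<^sub>C ((\<Sum>i<j. \<mu> ^ (j - 1 - i) *\<^sub>C derived_vector c w h i) +
      (\<Sum>r\<le>h. k j r *\<^sub>C P (h - r)))"
    using Suc.IH by (simp add: P_def k_def flip: scaleC_scaleC)
  also have "\<dots> = (\<Sum>i<j. \<mu> ^ (Suc j - 1 - i) *\<^sub>C derived_vector c w h i) +
      (\<Sum>r\<le>h. k j r *\<^sub>C (\<mu> *\<^sub>C P (h - r)))"
  proof -
    have "\<mu> * \<mu> ^ (j - 1 - i) = \<mu> ^ (Suc j - 1 - i)" if "i < j" for i
    proof -
      have "Suc j - 1 - i = Suc (j - 1 - i)"
        using that by simp
      then show ?thesis by simp
    qed
    then show ?thesis
      by (simp add: scaleC_add_right scaleC_sum_right scaleC_scaleC mult.commute)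
  qed
  also have "(\<Sum>r\<le>h. k j r *\<^sub>C (\<mu> *\<^sub>C P (h - r))) =
    (\<Sum>r\<le>h. k j r *\<^sub>C w (h - r)) + ((\<Sum>r\<le>h. (c * k j r) *\<^sub>C P (h - r)) + (\<Sum>r\<le>h. k j r *\<^sub>C d r))"
    by (simp add: step scaleC_add_right scaleC_scaleC sum.distrib mult_ac add_ac)
  also have "(\<Sum>r\<le>h. k j r *\<^sub>C w (h - r)) = \<mu> ^ (Suc j - 1 - j) *\<^sub>C derived_vector c w h j"
    by (simp add: derived_vector_def k_def)
  also have "(\<Sum>r\<le>h. (c * k j r) *\<^sub>C P (h - r)) + (\<Sum>r\<le>h. k j r *\<^sub>C d r) = (\<Sum>r\<le>h. k (Suc j) r *\<^sub>C P (h - r))"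
    unfolding k_def d_def by (rule pascal_sum)
  finally show ?case
    by (simp add: P_def k_def add.assoc)
qed

text \<open>The chain equations say precisely that the second sum of the preceding lemma drops out after
  application of \<open>G\<close>. They are stated for an arbitrary family \<open>G\<close> of linear maps, so that the result
  covers both \<open>A(\<mu>)\<close> itself and the functionals \<open>u \<mapsto> cinner u (A(cnj \<mu>) x)\<close>.\<close>

definition chain_equations :: "nat \<Rightarrow> (nat \<Rightarrow> 'a \<Rightarrow> 'b :: complex_vector) \<Rightarrow> complex \<Rightarrow> nat \<Rightarrow> (nat \<Rightarrow> 'a) \<Rightarrow> bool"
  where "chain_equations n G c h w \<longleftrightarrow> (\<forall>s\<le>h. (\<Sum>i\<le>s. taylor_coeff n G c i (w (s - i))) = 0)"

lemma chain_equations_mono: "chain_equations n G c h w \<Longrightarrow> g \<le> h \<Longrightarrow> chain_equations n G c g w"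
  by (auto simp: chain_equations_def)

lemma clinear_map_taylor_coeff:
  "(\<And>j. j \<le> n \<Longrightarrow> clinear_map (G j)) \<Longrightarrow> clinear_map (taylor_coeff n G c i)"
  by (simp add: clinear_map_def taylor_coeff_def scaleC_add_right sum.distrib scaleC_sum_right
      scaleC_scaleC mult.commute)

text \<open>The polynomial part of \<open>(\<Sum>j\<le>n. \<mu> ^ j *\<^sub>C G j (R \<mu>))\<close> at infinity, if \<open>R\<close> has the expansion
  \<open>(\<Sum>i. d i / \<mu>\<^bsup>i+1\<^esup>)\<close> there.\<close>

definition polynomial_part ::
  "nat \<Rightarrow> (nat \<Rightarrow> 'a \<Rightarrow> 'b) \<Rightarrow> (nat \<Rightarrow> 'a) \<Rightarrow> complex \<Rightarrow> 'b :: complex_vector"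
  where "polynomial_part n G d \<mu> = (\<Sum>j\<le>n. \<Sum>i<j. \<mu> ^ (j - 1 - i) *\<^sub>C G j (d i))"

lemma chain_equations_imp_polynomial:
  assumes G: "\<And>j. j \<le> n \<Longrightarrow> clinear_map (G j)"
    and chain: "chain_equations n G c h w"
    and \<mu>: "\<mu> \<noteq> c"
  shows "(\<Sum>j\<le>n. \<mu> ^ j *\<^sub>C G j (principal_fun c w h \<mu>)) = polynomial_part n G (derived_vector c w h) \<mu>"
proof -
  have "(\<Sum>j\<le>n. \<mu> ^ j *\<^sub>C G j (principal_fun c w h \<mu>)) = (\<Sum>j\<le>n. G j (\<mu> ^ j *\<^sub>C principal_fun c w h \<mu>))"
    by (simp add: clinear_map_scaleC[OF G])
  also have "\<dots> = polynomial_part n G (derived_vector c w h) \<mu> +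
    (\<Sum>j\<le>n. \<Sum>r\<le>h. (of_nat (j choose r) * c ^ (j - r)) *\<^sub>C G j (principal_fun c w (h - r) \<mu>))"
    by (simp add: power_times_principal_fun[OF \<mu>] clinear_map_add[OF G] clinear_map_sum[OF G]
        clinear_map_scaleC[OF G] polynomial_part_def sum.distrib)
  also have "(\<Sum>j\<le>n. \<Sum>r\<le>h. (of_nat (j choose r) * c ^ (j - r)) *\<^sub>C G j (principal_fun c w (h - r) \<mu>)) =
    (\<Sum>r\<le>h. taylor_coeff n G c r (principal_fun c w (h - r) \<mu>))"
    unfolding taylor_coeff_def by (rule sum.swap)
  also have "\<dots> = (\<Sum>r\<le>h. \<Sum>s\<le>h - r. (1 / (\<mu> - c) ^ (s + 1)) *\<^sub>C taylor_coeff n G c r (w (h - r - s)))"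
    by (simp add: principal_fun_def clinear_map_sum[OF clinear_map_taylor_coeff[OF G]]
        clinear_map_scaleC[OF clinear_map_taylor_coeff[OF G]])
  also have "\<dots> = (\<Sum>s\<le>h. \<Sum>r\<le>h - s. (1 / (\<mu> - c) ^ (s + 1)) *\<^sub>C taylor_coeff n G c r (w (h - r - s)))"
    unfolding sum.Sigma[OF finite_atMost ballI[OF finite_atMost]]
    by (rule sum.reindex_bij_witness[of _ "\<lambda>(a, b). (b, a)" "\<lambda>(a, b). (b, a)"]) auto
  also have "\<dots> = (\<Sum>s\<le>h. (1 / (\<mu> - c) ^ (s + 1)) *\<^sub>C (\<Sum>r\<le>h - s. taylor_coeff n G c r (w (h - s - r))))"
    by (simp add: scaleC_sum_right add.commute)
  also have "\<dots> = 0"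
    using chain by (simp add: chain_equations_def del: diff_diff_left)
  finally show ?thesis
    by simp
qed

section \<open>Operator pencils\<close>

lemma cderiv_eqI:
  assumes "(f has_derivative (\<lambda>h. h *\<^sub>C D)) (at z)"
  shows "cderiv f z = D"
proof -
  have "(f has_derivative (\<lambda>h. h *\<^sub>C cderiv f z)) (at z)"
    unfolding cderiv_def using assms by (rule someI)
  then have "(\<lambda>h. h *\<^sub>C cderiv f z) = (\<lambda>h. h *\<^sub>C D)"
    using assms by (rule has_derivative_unique)
  from fun_cong[OF this, of 1] show ?thesis
    by simp
qed

lemma op_deriv_pencil: "op_deriv i (pencil n A) c x = fact i *\<^sub>C taylor_coeff n A c i x"
proof -
  have "(cderiv ^^ i) (\<lambda>\<mu>. \<Sum>j\<le>n. \<mu> ^ j *\<^sub>C A j x) =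
    (\<lambda>\<mu>. \<Sum>j\<le>n. (fact i * of_nat (j choose i) * \<mu> ^ (j - i)) *\<^sub>C A j x)"
  proof (induction i)
    case (Suc i)
    have "cderiv (\<lambda>\<mu>. \<Sum>j\<le>n. (fact i * of_nat (j choose i) * \<mu> ^ (j - i)) *\<^sub>C A j x) z =
      (\<Sum>j\<le>n. (fact (Suc i) * of_nat (j choose Suc i) * z ^ (j - Suc i)) *\<^sub>C A j x)" for z
    proof (rule cderiv_eqI)
      have "((\<lambda>\<mu>. (fact i * of_nat (j choose i) * \<mu> ^ (j - i)) *\<^sub>C A j x) has_derivative
        (\<lambda>h. h *\<^sub>C (fact (Suc i) * of_nat (j choose Suc i) * z ^ (j - Suc i)) *\<^sub>C A j x)) (at z)" for j
      proof -
        have "(j - i) * (j choose i) = Suc i * (j choose Suc i)"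
          by (simp only: binomial_absorb_comp binomial_absorption)
        then have b: "of_nat (j - i) * of_nat (j choose i) = (of_nat (Suc i) * of_nat (j choose Suc i) :: complex)"
          by (metis of_nat_mult)
        have "((\<lambda>\<mu>. fact i * of_nat (j choose i) * \<mu> ^ (j - i)) has_field_derivative
          fact i * of_nat (j choose i) * (of_nat (j - i) * z ^ (j - i - Suc 0))) (at z)"
          by (auto intro!: derivative_eq_intros)
        then have "((\<lambda>\<mu>. fact i * of_nat (j choose i) * \<mu> ^ (j - i)) has_field_derivative
          fact (Suc i) * of_nat (j choose Suc i) * z ^ (j - Suc i)) (at z)"
        proof (rule DERIV_cong)
          have "fact i * of_nat (j choose i) * (of_nat (j - i) * z ^ (j - i - Suc 0)) =
            fact i * (of_nat (j - i) * of_nat (j choose i)) * z ^ (j - Suc i)"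
            by (simp add: mult_ac)
          also have "\<dots> = fact (Suc i) * of_nat (j choose Suc i) * z ^ (j - Suc i)"
            unfolding b by (simp add: mult_ac del: of_nat_Suc)
          finally show "fact i * of_nat (j choose i) * (of_nat (j - i) * z ^ (j - i - Suc 0)) =
            fact (Suc i) * of_nat (j choose Suc i) * z ^ (j - Suc i)" .
        qed
        from bounded_linear.has_derivative[OF
            bounded_bilinear.bounded_linear_left[OF bounded_bilinear_scaleC]
            this[unfolded has_field_derivative_def], of "A j x"]
        show ?thesis
          by (simp add: scaleC_scaleC mult_ac)
      qed
      then show "((\<lambda>\<mu>. \<Sum>j\<le>n. (fact i * of_nat (j choose i) * \<mu> ^ (j - i)) *\<^sub>C A j x) has_derivative
        (\<lambda>h. h *\<^sub>C (\<Sum>j\<le>n. (fact (Suc i) * of_nat (j choose Suc i) * z ^ (j - Suc i)) *\<^sub>C A j x))) (at z)"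
        unfolding scaleC_sum_right by (intro has_derivative_sum)
    qed
    then show ?case
      by (simp add: Suc.IH)
  qed simp
  then show ?thesis
    by (simp add: op_deriv_def pencil_def taylor_coeff_def scaleC_sum_right scaleC_scaleC mult.assoc)
qed

lemma is_chain_pencil_iff:
  "is_chain (pencil n A) c p w \<longleftrightarrow> w 0 \<noteq> 0 \<and> chain_equations n A c p w"
  by (simp add: is_chain_def chain_equations_def op_deriv_pencil scaleC_scaleC)

lemma power_shift_expansion:
  "(\<mu> :: complex) ^ j = (\<Sum>i\<le>j. of_nat (j choose i) * (\<mu> - c) ^ i * c ^ (j - i))"
  using binomial_ring[of "\<mu> - c" c j] by simp

lemma pencil_taylor:
  "pencil n A \<mu> x = (\<Sum>i\<le>n. (\<mu> - c) ^ i *\<^sub>C taylor_coeff n A c i x)"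
proof -
  have "\<mu> ^ j = (\<Sum>i\<le>n. (\<mu> - c) ^ i * (of_nat (j choose i) * c ^ (j - i)))" if "j \<le> n" for j
    unfolding power_shift_expansion[of \<mu> j c] using that
    by (intro sum.mono_neutral_cong_left) (auto simp: binomial_eq_0 mult_ac)
  then have "pencil n A \<mu> x = (\<Sum>j\<le>n. (\<Sum>i\<le>n. (\<mu> - c) ^ i * (of_nat (j choose i) * c ^ (j - i))) *\<^sub>C A j x)"
    by (simp add: pencil_def)
  also have "\<dots> = (\<Sum>i\<le>n. (\<mu> - c) ^ i *\<^sub>C taylor_coeff n A c i x)"
    unfolding taylor_coeff_def scaleC_sum_left scaleC_sum_right scaleC_scaleC
    by (rule sum.swap)
  finally show ?thesis .
qed

text \<open>Vector polynomials. The centre is recorded because the coefficients at an eigenvalue are compared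
  with chains there.\<close>

definition polynomial_at :: "complex \<Rightarrow> (complex \<Rightarrow> 'a :: complex_vector) \<Rightarrow> bool"
  where "polynomial_at c f \<longleftrightarrow> (\<exists>D u. \<forall>\<mu>. f \<mu> = (\<Sum>d\<le>D. (\<mu> - c) ^ d *\<^sub>C u d))"

lemma polynomial_at_monomial: "polynomial_at c (\<lambda>\<mu>. \<mu> ^ j *\<^sub>C x)"
  unfolding polynomial_at_def
  by (rule exI[of _ j], rule exI[of _ "\<lambda>d. (of_nat (j choose d) * c ^ (j - d)) *\<^sub>C x"])
    (simp add: power_shift_expansion[of _ j c] scaleC_sum_left scaleC_scaleC mult_ac)

lemma polynomial_at_add:
  assumes "polynomial_at c f" "polynomial_at c g"
  shows "polynomial_at c (\<lambda>\<mu>. f \<mu> + g \<mu>)"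
proof -
  obtain D u E v where
    f: "\<And>\<mu>. f \<mu> = (\<Sum>d\<le>D. (\<mu> - c) ^ d *\<^sub>C u d)" and g: "\<And>\<mu>. g \<mu> = (\<Sum>d\<le>E. (\<mu> - c) ^ d *\<^sub>C v d)"
    using assms by (auto simp: polynomial_at_def)
  have pad: "(\<Sum>d\<le>D. (\<mu> - c) ^ d *\<^sub>C u d) = (\<Sum>d\<le>max D E. (\<mu> - c) ^ d *\<^sub>C (if d \<le> D then u d else 0))"
    for \<mu> D E and u :: "nat \<Rightarrow> 'a"
    by (intro sum.mono_neutral_cong_left) auto
  have eq: "f \<mu> + g \<mu> = (\<Sum>d\<le>max D E. (\<mu> - c) ^ d *\<^sub>C ((if d \<le> D then u d else 0) + (if d \<le> E then v d else 0)))" for \<mu>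
    using pad[of \<mu> u D E] pad[of \<mu> v E D]
    by (simp add: f g scaleC_add_right sum.distrib max.commute)
  show ?thesis
    unfolding polynomial_at_def by - ((rule exI)+, rule allI, rule eq)
qed

lemma polynomial_at_sum:
  "(\<And>i. i \<in> I \<Longrightarrow> polynomial_at c (f i)) \<Longrightarrow> polynomial_at c (\<lambda>\<mu>. \<Sum>i\<in>I. f i \<mu>)"
proof (induction I rule: infinite_finite_induct)
  case (insert i I)
  then show ?case
    by (simp add: polynomial_at_add)
qed (use polynomial_at_monomial[of c 0 0] in auto)

lemma polynomial_at_polynomial_part: "polynomial_at c (polynomial_part n G d)"
  unfolding polynomial_part_def[abs_def]
  by (intro polynomial_at_sum polynomial_at_monomial)

section \<open>Leading coefficients at an eigenvalue\<close>

lemma principal_fun_scaled_limit: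
  fixes w :: "nat \<Rightarrow> 'a :: complex_hilbert_space"
  assumes "h \<le> M"
  shows "((\<lambda>\<mu>. (\<mu> - c) ^ (M + 1) *\<^sub>C principal_fun c w h \<mu>) \<longlongrightarrow> (if h = M then w 0 else 0)) (at c)"
proof -
  have "((\<lambda>\<mu>. \<Sum>r\<le>h. (\<mu> - c) ^ (M - r) *\<^sub>C w (h - r)) \<longlongrightarrow> (\<Sum>r\<le>h. (c - c) ^ (M - r) *\<^sub>C w (h - r))) (at c)"
    by (intro tendsto_intros)
  moreover have "eventually (\<lambda>\<mu>. (\<Sum>r\<le>h. (\<mu> - c) ^ (M - r) *\<^sub>C w (h - r)) =
    (\<mu> - c) ^ (M + 1) *\<^sub>C principal_fun c w h \<mu>) (at c)"
    unfolding eventually_at_filter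
  proof (intro always_eventually allI impI)
    fix \<mu> assume "\<mu> \<noteq> c"
    then have "(\<mu> - c) ^ (M + 1) * (1 / (\<mu> - c) ^ (r + 1)) = (\<mu> - c) ^ (M - r)" if "r \<le> h" for r
      using that assms power_diff[of "\<mu> - c" "r + 1" "M + 1"] by simp
    then show "(\<Sum>r\<le>h. (\<mu> - c) ^ (M - r) *\<^sub>C w (h - r)) = (\<mu> - c) ^ (M + 1) *\<^sub>C principal_fun c w h \<mu>"
      by (simp add: principal_fun_def scaleC_sum_right scaleC_scaleC)
  qed
  moreover have "(\<Sum>r\<le>h. (c - c) ^ (M - r) *\<^sub>C w (h - r)) = (if h = M then w 0 else 0)"
  proof (cases "h = M")
    case True
    then show ?thesis
      by (subst sum.remove[of _ M]) (auto intro!: sum.neutral)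
  next
    case False
    then show ?thesis
      using assms by (auto intro!: sum.neutral)
  qed
  ultimately show ?thesis
    by (simp add: Lim_transform_eventually)
qed

lemma eigenvector_coefficients_zero:
  fixes w :: "nat \<Rightarrow> nat \<Rightarrow> 'a :: complex_hilbert_space"
  assumes indep: "lin_indep_family (\<lambda>k. w k 0) {..<N}"
    and J: "finite J" "J \<subseteq> {..<N} \<times> UNIV"
    and zero: "(\<Sum>(k, h)\<in>J. if h = M then a k h *\<^sub>C w k 0 else 0) = 0" and kM: "(k, M) \<in> J"
  shows "a k M = 0"
proof -
  have "(\<Sum>(k, h)\<in>J. if h = M then a k h *\<^sub>C w k 0 else 0) =
    (\<Sum>(k, h)\<in>{..<N} \<times> {M}. (if (k, h) \<in> J then a k h else 0) *\<^sub>C w k 0)"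
    using J by (intro sum.mono_neutral_cong) (auto split: if_splits)
  also have "\<dots> = (\<Sum>k<N. (if (k, M) \<in> J then a k M else 0) *\<^sub>C w k 0)"
    by (simp add: sum.cartesian_product[symmetric])
  finally have "(\<Sum>k<N. (if (k, M) \<in> J then a k M else 0) *\<^sub>C w k 0) = 0"
    using zero by simp
  from lin_indep_familyD[OF indep _ this, of k] show ?thesis
    using J(2) kM by auto
qed

text \<open>
  Multiplication by \<open>(\<mu> - c)\<^bsup>M+1\<^esup>\<close> isolates the poles of highest order, whose coefficients are
  eigenvectors. The independence of the eigenvectors forces them to vanish one order after the
  other, until the order \<open>m + 1\<close> of the remainder \<open>X\<close> is reached.
\<close>

lemma leading_coefficients:
  fixes w :: "nat \<Rightarrow> nat \<Rightarrow> 'a :: complex_hilbert_space"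
  assumes indep: "lin_indep_family (\<lambda>k. w k 0) {..<N}"
    and J: "finite J" "J \<subseteq> {..<N} \<times> UNIV"
    and zero: "eventually (\<lambda>\<mu>. (\<Sum>(k, h)\<in>J. a k h *\<^sub>C principal_fun c (w k) h \<mu>) + X \<mu> = 0) (at c)"
    and X: "((\<lambda>\<mu>. (\<mu> - c) ^ (m + 1) *\<^sub>C X \<mu>) \<longlongrightarrow> x) (at c)"
  shows "\<And>k h. (k, h) \<in> J \<Longrightarrow> m < h \<Longrightarrow> a k h = 0"
    and "(\<Sum>(k, h)\<in>J. if h = m then a k h *\<^sub>C w k 0 else 0) + x = 0"
proof -
  have top: "(\<Sum>(k, h)\<in>J. if h = M then a k h *\<^sub>C w k 0 else 0) + (if M = m then x else 0) = 0"
    if M: "m \<le> M" and high: "\<And>k h. (k, h) \<in> J \<Longrightarrow> M < h \<Longrightarrow> a k h = 0" for M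
  proof -
    have lim: "((\<lambda>\<mu>. a k h *\<^sub>C (\<mu> - c) ^ (M + 1) *\<^sub>C principal_fun c (w k) h \<mu>) \<longlongrightarrow>
      (if h = M then a k h *\<^sub>C w k 0 else 0)) (at c)" if kh: "(k, h) \<in> J" for k h
    proof (cases "h \<le> M")
      case True
      have "((\<lambda>\<mu>. a k h *\<^sub>C (\<mu> - c) ^ (M + 1) *\<^sub>C principal_fun c (w k) h \<mu>) \<longlongrightarrow>
        a k h *\<^sub>C (if h = M then w k 0 else 0)) (at c)"
        by (intro tendsto_intros principal_fun_scaled_limit True)
      then show ?thesis
        by (cases "h = M") simp_all
    next
      case False
      then show ?thesis
        using high[OF kh] by simp
    qed
    have e1: "(\<mu> - c) ^ (M - m) *\<^sub>C (\<mu> - c) ^ (m + 1) *\<^sub>C X \<mu> = (\<mu> - c) ^ (M + 1) *\<^sub>C X \<mu>" for \<mu>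
      using M by (simp only: scaleC_scaleC flip: power_add) simp
    have e2: "(c - c) ^ (M - m) *\<^sub>C x = (if M = m then x else 0)"
      using M by simp
    have "((\<lambda>\<mu>. (\<mu> - c) ^ (M - m) *\<^sub>C (\<mu> - c) ^ (m + 1) *\<^sub>C X \<mu>) \<longlongrightarrow> (c - c) ^ (M - m) *\<^sub>C x) (at c)"
      by (intro tendsto_intros X)
    then have "((\<lambda>\<mu>. (\<mu> - c) ^ (M + 1) *\<^sub>C X \<mu>) \<longlongrightarrow> (if M = m then x else 0)) (at c)"
      by (simp only: e1 e2)
    then have "((\<lambda>\<mu>. (\<Sum>(k, h)\<in>J. a k h *\<^sub>C (\<mu> - c) ^ (M + 1) *\<^sub>C principal_fun c (w k) h \<mu>) +
        (\<mu> - c) ^ (M + 1) *\<^sub>C X \<mu>) \<longlongrightarrow>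
        (\<Sum>(k, h)\<in>J. if h = M then a k h *\<^sub>C w k 0 else 0) + (if M = m then x else 0)) (at c)"
    proof (intro tendsto_add tendsto_sum)
      fix x assume "x \<in> J"
      then show "((\<lambda>\<mu>. case x of (k, h) \<Rightarrow> a k h *\<^sub>C (\<mu> - c) ^ (M + 1) *\<^sub>C principal_fun c (w k) h \<mu>) \<longlongrightarrow>
        (case x of (k, h) \<Rightarrow> if h = M then a k h *\<^sub>C w k 0 else 0)) (at c)"
        using lim[of "fst x" "snd x"] by (simp only: case_prod_unfold prod.collapse)
    qed
    moreover have "eventually (\<lambda>\<mu>. (\<Sum>(k, h)\<in>J. a k h *\<^sub>C (\<mu> - c) ^ (M + 1) *\<^sub>C principal_fun c (w k) h \<mu>) +
        (\<mu> - c) ^ (M + 1) *\<^sub>C X \<mu> = 0) (at c)"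
      using zero
    proof eventually_elim
      case (elim \<mu>)
      have "(\<Sum>(k, h)\<in>J. a k h *\<^sub>C (\<mu> - c) ^ (M + 1) *\<^sub>C principal_fun c (w k) h \<mu>) +
        (\<mu> - c) ^ (M + 1) *\<^sub>C X \<mu> =
        (\<mu> - c) ^ (M + 1) *\<^sub>C ((\<Sum>(k, h)\<in>J. a k h *\<^sub>C principal_fun c (w k) h \<mu>) + X \<mu>)"
        by (simp add: scaleC_add_right scaleC_sum_right scaleC_scaleC case_prod_unfold mult_ac)
      then show ?case
        using elim by simp
    qed
    ultimately show ?thesis
      using tendsto_unique[OF at_neq_bot _ tendsto_eventually] by blast
  qed
  show high: "a k h = 0" if "(k, h) \<in> J" "m < h" for k h
  proof (rule ccontr)
    assume "a k h \<noteq> 0"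
    define H where "H = {h. m < h \<and> (\<exists>k. (k, h) \<in> J \<and> a k h \<noteq> 0)}"
    have "finite H"
      by (rule finite_subset[of _ "snd ` J"]) (use J(1) in \<open>force simp: H_def\<close>)+
    moreover have "h \<in> H"
      using that \<open>a k h \<noteq> 0\<close> by (auto simp: H_def)
    ultimately have M: "Max H \<in> H" "\<And>h. h \<in> H \<Longrightarrow> h \<le> Max H"
      using Max_in by auto
    define M where "M = Max H"
    have "m < M"
      using M(1) by (simp add: M_def H_def)
    have high: "a k h = 0" if "(k, h) \<in> J" "M < h" for k h
      using M(2)[of h] that \<open>m < M\<close> unfolding M_def H_def by fastforce
    have "(\<Sum>(k, h)\<in>J. if h = M then a k h *\<^sub>C w k 0 else 0) = 0"
      using top[of M] high \<open>m < M\<close> by simp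
    from eigenvector_coefficients_zero[where w = w and a = a, OF indep J this]
    have "(k, M) \<in> J \<Longrightarrow> a k M = 0" for k .
    then show False
      using M(1) by (auto simp: M_def H_def)
  qed
  show "(\<Sum>(k, h)\<in>J. if h = m then a k h *\<^sub>C w k 0 else 0) + x = 0"
    using top[of m] high by simp
qed

text \<open>Partial fractions built on independent eigenvectors are independent modulo functions that grow
  more slowly than a simple pole.\<close>

corollary coefficients_eq_zero:
  fixes w :: "nat \<Rightarrow> nat \<Rightarrow> 'a :: complex_hilbert_space"
  assumes indep: "lin_indep_family (\<lambda>k. w k 0) {..<N}"
    and J: "finite J" "J \<subseteq> {..<N} \<times> UNIV"
    and zero: "eventually (\<lambda>\<mu>. (\<Sum>(k, h)\<in>J. a k h *\<^sub>C principal_fun c (w k) h \<mu>) + X \<mu> = 0) (at c)"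
    and X: "((\<lambda>\<mu>. (\<mu> - c) *\<^sub>C X \<mu>) \<longlongrightarrow> 0) (at c)"
    and kh: "(k, h) \<in> J"
  shows "a k h = 0"
proof (cases "h = 0")
  case False
  then show ?thesis
    using leading_coefficients(1)[OF indep J zero, of 0 0] X kh by simp
next
  case True
  have "(\<Sum>(k, h)\<in>J. if h = 0 then a k h *\<^sub>C w k 0 else 0) = 0"
    using leading_coefficients(2)[OF indep J zero, of 0 0] X by simp
  from eigenvector_coefficients_zero[where w = w and a = a, OF indep J this] show ?thesis
    using kh True by simp
qed

section \<open>The principal part of the inverse\<close>

text \<open>Growth below that of a simple pole suffices to be invisible among partial fractions, and is
  easier to propagate than boundedness.\<close>

definition negligible_at :: "complex \<Rightarrow> (complex \<Rightarrow> 'a :: complex_hilbert_space) \<Rightarrow> bool"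
  where "negligible_at c X \<longleftrightarrow> ((\<lambda>\<mu>. (\<mu> - c) *\<^sub>C X \<mu>) \<longlongrightarrow> 0) (at c)"

lemma negligible_at_add: "negligible_at c X \<Longrightarrow> negligible_at c Y \<Longrightarrow> negligible_at c (\<lambda>\<mu>. X \<mu> + Y \<mu>)"
  unfolding negligible_at_def scaleC_add_right by (rule tendsto_add_zero)

lemma negligible_at_diff: "negligible_at c X \<Longrightarrow> negligible_at c Y \<Longrightarrow> negligible_at c (\<lambda>\<mu>. X \<mu> - Y \<mu>)"
  unfolding negligible_at_def complex_vector.scale_right_diff_distrib
  using tendsto_diff[of "\<lambda>\<mu>. (\<mu> - c) *\<^sub>C X \<mu>" 0 "at c" "\<lambda>\<mu>. (\<mu> - c) *\<^sub>C Y \<mu>" 0] by simp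

lemma negligible_at_sum:
  "(\<And>i. i \<in> I \<Longrightarrow> negligible_at c (X i)) \<Longrightarrow> negligible_at c (\<lambda>\<mu>. \<Sum>i\<in>I. X i \<mu>)"
  unfolding negligible_at_def scaleC_sum_right by (rule tendsto_null_sum)

lemma negligible_at_tendsto: "(f \<longlongrightarrow> x) (at c) \<Longrightarrow> negligible_at c f"
  unfolding negligible_at_def by (rule tendsto_eq_intros refl | simp)+

lemma negligible_at_scaleC:
  assumes "(f \<longlongrightarrow> a) (at c)" "negligible_at c X"
  shows "negligible_at c (\<lambda>\<mu>. f \<mu> *\<^sub>C X \<mu>)"
proof -
  have "((\<lambda>\<mu>. f \<mu> *\<^sub>C (\<mu> - c) *\<^sub>C X \<mu>) \<longlongrightarrow> a *\<^sub>C 0) (at c)"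
    using assms unfolding negligible_at_def by (intro tendsto_intros)
  then show ?thesis
    by (simp add: negligible_at_def scaleC_scaleC mult.commute)
qed

lemma negligible_at_cong:
  assumes "negligible_at c X" "eventually (\<lambda>\<mu>. X \<mu> = Y \<mu>) (at c)"
  shows "negligible_at c Y"
  using assms(1) unfolding negligible_at_def
  by (rule Lim_transform_eventually) (use assms(2) in eventually_elim, simp)

text \<open>Each factor \<open>\<mu> - c\<close> lowers the order of all poles by one and splits off a polynomial.\<close>

lemma negligible_at_shift:
  "negligible_at c (\<lambda>\<mu>. (\<mu> - c) ^ d *\<^sub>C principal_fun c w h \<mu> -
    (if d \<le> h then principal_fun c w (h - d) \<mu> else 0))"
proof (induction d arbitrary: h)
  case 0
  show ?case
    by (simp add: negligible_at_def)
next
  case (Suc d)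
  have "negligible_at c (\<lambda>\<mu>. (\<mu> - c) ^ d *\<^sub>C w h + (if h = 0 then 0 else
    (\<mu> - c) ^ d *\<^sub>C principal_fun c w (h - 1) \<mu> -
    (if d \<le> h - 1 then principal_fun c w (h - 1 - d) \<mu> else 0)))"
  proof (rule negligible_at_add)
    show "negligible_at c (\<lambda>\<mu>. (\<mu> - c) ^ d *\<^sub>C w h)"
      by (rule negligible_at_tendsto[of _ "(c - c) ^ d *\<^sub>C w h"]) (intro tendsto_intros)
    show "negligible_at c (\<lambda>\<mu>. if h = 0 then 0 else
      (\<mu> - c) ^ d *\<^sub>C principal_fun c w (h - 1) \<mu> -
      (if d \<le> h - 1 then principal_fun c w (h - 1 - d) \<mu> else 0))"
      using Suc.IH[of "h - 1"] by (cases "h = 0") (simp_all add: negligible_at_def)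
  qed
  moreover have "eventually (\<lambda>\<mu>. (\<mu> - c) ^ d *\<^sub>C w h + (if h = 0 then 0 else
    (\<mu> - c) ^ d *\<^sub>C principal_fun c w (h - 1) \<mu> -
    (if d \<le> h - 1 then principal_fun c w (h - 1 - d) \<mu> else 0)) =
    (\<mu> - c) ^ Suc d *\<^sub>C principal_fun c w h \<mu> -
    (if Suc d \<le> h then principal_fun c w (h - Suc d) \<mu> else 0)) (at c)"
    unfolding eventually_at_filter
  proof (intro always_eventually allI impI)
    fix \<mu> assume "\<mu> \<noteq> c"
    have "(\<mu> - c) ^ Suc d *\<^sub>C principal_fun c w h \<mu> = (\<mu> - c) ^ d *\<^sub>C (\<mu> - c) *\<^sub>C principal_fun c w h \<mu>"
      by (simp add: scaleC_scaleC mult.commute)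
    then show "(\<mu> - c) ^ d *\<^sub>C w h + (if h = 0 then 0 else
      (\<mu> - c) ^ d *\<^sub>C principal_fun c w (h - 1) \<mu> -
      (if d \<le> h - 1 then principal_fun c w (h - 1 - d) \<mu> else 0)) =
      (\<mu> - c) ^ Suc d *\<^sub>C principal_fun c w h \<mu> -
      (if Suc d \<le> h then principal_fun c w (h - Suc d) \<mu> else 0)"
      unfolding principal_fun_step[OF \<open>\<mu> \<noteq> c\<close>]
      by (cases h) (auto simp: scaleC_add_right)
  qed
  ultimately show ?case
    by (rule negligible_at_cong)
qed

text \<open>Collecting the terms with the same \<open>z k i\<close> turns the principal part into partial fractions of
  truncated chains.\<close>

lemma keldysh_principal_part_eq:
  "keldysh_principal_part c N p w z \<mu> x =
    (\<Sum>k<N. \<Sum>i\<le>p k. cinner x (z k i) *\<^sub>C principal_fun c (w k) (p k - i) \<mu>)"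
  unfolding keldysh_principal_part_def
proof (rule sum.cong[OF refl])
  fix k
  let ?q = "p k"
  show "(\<Sum>s\<le>?q. (1 / (\<mu> - c) ^ (?q + 1 - s)) *\<^sub>C (\<Sum>r\<le>s. cinner x (z k (s - r)) *\<^sub>C w k r)) =
    (\<Sum>i\<le>?q. cinner x (z k i) *\<^sub>C principal_fun c (w k) (?q - i) \<mu>)"
    unfolding principal_fun_def scaleC_sum_right scaleC_scaleC
      sum.Sigma[OF finite_atMost ballI[OF finite_atMost]]
    by (rule sum.reindex_bij_witness[of _ "\<lambda>(i, r). (?q - r, ?q - i - r)" "\<lambda>(s, r). (s - r, ?q - s)"])
      (auto simp: mult.commute Suc_diff_le)
qed

lemma eventually_invertible:
  assumes "c isolated_in op_spectrum F"
  shows "eventually (\<lambda>\<mu>. bounded_clinear (inv (F \<mu>)) \<and> bij (F \<mu>)) (at c)"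
proof -
  obtain T where T: "open T" "c \<in> T" "op_spectrum F \<inter> T = {c}"
    using assms by (auto simp: isolated_in_def)
  have "eventually (\<lambda>\<mu>. \<mu> \<in> T - {c}) (at c)"
    using T by (intro eventually_at_in_open) auto
  then show ?thesis
  proof eventually_elim
    case (elim \<mu>)
    then have "\<mu> \<notin> op_spectrum F"
      using T by auto
    then obtain B where B: "bounded_clinear B" "B \<circ> F \<mu> = id" "F \<mu> \<circ> B = id"
      by (auto simp: op_spectrum_def)
    then show ?case
      using inv_unique_comp[of "F \<mu>" B] o_bij[of B "F \<mu>"] by auto
  qed
qed

lemma bounded_linear_keldysh_principal_part:
  "bounded_linear (keldysh_principal_part c N p w z \<mu>)"
proof -
  have "bounded_linear (\<lambda>x. cinner x y *\<^sub>C v)" for y v :: 'a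
    using bounded_linear_compose[OF
        bounded_bilinear.bounded_linear_left[OF bounded_bilinear_scaleC]
        bounded_bilinear.bounded_linear_left[OF bounded_bilinear_cinner]] .
  then show ?thesis
    unfolding keldysh_principal_part_eq[abs_def] by (intro bounded_linear_sum)
qed

text \<open>The regular part is a power series in \<open>\<mu> - c\<close> with values in \<open>H\<close>; since it converges
  somewhere outside \<open>c\<close>, it is bounded near \<open>c\<close>.\<close>

lemma negligible_regular_part:
  fixes G P :: "complex \<Rightarrow> 'a \<Rightarrow> 'a :: complex_hilbert_space"
  assumes pp: "has_principal_part G c P"
    and G: "eventually (\<lambda>\<mu>. bounded_linear (G \<mu>)) (at c)" and P: "\<And>\<mu>. bounded_linear (P \<mu>)"
  shows "negligible_at c (\<lambda>\<mu>. G \<mu> x - P \<mu> x)"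
proof -
  obtain B r where r: "0 < r" and B: "\<And>m. bounded_clinear (B m)"
    and lim: "\<And>\<mu>. 0 < cmod (\<mu> - c) \<Longrightarrow> cmod (\<mu> - c) < r \<Longrightarrow>
      (\<lambda>M. onorm (\<lambda>x. G \<mu> x - P \<mu> x - (\<Sum>m<M. (\<mu> - c) ^ m *\<^sub>C (B m) x))) \<longlonglongrightarrow> 0"
    using pp unfolding has_principal_part_def by blast
  obtain r' where r': "0 < r'" "\<And>\<mu>. \<mu> \<noteq> c \<Longrightarrow> dist \<mu> c < r' \<Longrightarrow> bounded_linear (G \<mu>)"
    using G by (auto simp: eventually_at)
  define \<rho> where "\<rho> = min r r' / 2"
  have \<rho>: "0 < \<rho>" "\<rho> < r" "\<rho> < r'"
    using r r'(1) by (auto simp: \<rho>_def)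
  have series: "(\<lambda>m. (\<mu> - c) ^ m *\<^sub>C B m x) sums (G \<mu> x - P \<mu> x)"
    if \<mu>: "\<mu> \<noteq> c" "cmod (\<mu> - c) \<le> \<rho>" for \<mu>
  proof -
    have "bounded_linear (\<lambda>x. (\<mu> - c) ^ m *\<^sub>C B m x)" for m
      using B[of m] bounded_linear_compose[OF
          bounded_bilinear.bounded_linear_right[OF bounded_bilinear_scaleC]]
      by (auto simp: bounded_clinear_def)
    then have bl: "bounded_linear (\<lambda>x. G \<mu> x - P \<mu> x - (\<Sum>m<M. (\<mu> - c) ^ m *\<^sub>C (B m) x))" for M
      using r'(2)[of \<mu>] \<mu> \<rho> by (intro bounded_linear_sub bounded_linear_sum P) (auto simp: dist_norm)
    have "(\<lambda>M. onorm (\<lambda>x. G \<mu> x - P \<mu> x - (\<Sum>m<M. (\<mu> - c) ^ m *\<^sub>C (B m) x)) * norm x) \<longlonglongrightarrow> 0"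
      using tendsto_mult_right[OF lim[of \<mu>], of "norm x"] \<mu> \<rho> by simp
    then have "(\<lambda>M. G \<mu> x - P \<mu> x - (\<Sum>m<M. (\<mu> - c) ^ m *\<^sub>C (B m) x)) \<longlonglongrightarrow> 0"
      by (rule Lim_null_comparison[rotated]) (intro always_eventually allI onorm[OF bl])
    from tendsto_diff[OF tendsto_const this, of "G \<mu> x - P \<mu> x"] show ?thesis
      by (simp add: sums_def)
  qed
  have "summable (\<lambda>m. (c + of_real \<rho> - c) ^ m *\<^sub>C B m x)"
    using series[of "c + of_real \<rho>"] \<rho>(1) by (auto intro: sums_summable)
  then have "Bseq (\<lambda>m. of_real \<rho> ^ m *\<^sub>C B m x)"
    using summable_LIMSEQ_zero convergentI convergent_imp_Bseq by (metis add_diff_cancel_left')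
  then obtain K where K: "0 < K" "\<And>m. norm (of_real \<rho> ^ m *\<^sub>C B m x) \<le> K"
    by (auto simp: Bseq_def)
  have bound: "norm (G \<mu> x - P \<mu> x) \<le> 2 * K" if \<mu>: "\<mu> \<noteq> c" "cmod (\<mu> - c) \<le> \<rho> / 2" for \<mu>
  proof (rule Lim_bounded)
    show "(\<lambda>M. norm (\<Sum>m<M. (\<mu> - c) ^ m *\<^sub>C B m x)) \<longlonglongrightarrow> norm (G \<mu> x - P \<mu> x)"
      using series[of \<mu>] \<mu> \<rho>(1) unfolding sums_def by (intro tendsto_norm) auto
    have "norm (\<Sum>m<M. (\<mu> - c) ^ m *\<^sub>C B m x) \<le> 2 * K" for M
    proof -
      have "norm (\<Sum>m<M. (\<mu> - c) ^ m *\<^sub>C B m x) \<le> (\<Sum>m<M. K * (1 / 2) ^ m)"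
      proof (rule sum_norm_le)
        fix m
        have "norm ((\<mu> - c) ^ m *\<^sub>C B m x) \<le> (\<rho> / 2) ^ m * norm (B m x)"
          using \<mu>(2) by (auto simp: norm_power intro!: mult_right_mono power_mono)
        also have "\<dots> = norm (of_real \<rho> ^ m *\<^sub>C B m x) * (1 / 2) ^ m"
          using \<rho>(1) by (simp add: norm_power power_divide)
        also have "\<dots> \<le> K * (1 / 2) ^ m"
          by (intro mult_right_mono K) auto
        finally show "norm ((\<mu> - c) ^ m *\<^sub>C B m x) \<le> K * (1 / 2) ^ m" .
      qed
      also have "\<dots> = K * (\<Sum>m<M. (1 / 2) ^ m)"
        by (simp add: sum_distrib_left)
      also have "\<dots> \<le> K * 2"
        using K(1) sum_le_suminf[OF summable_geometric, of "1 / 2 :: real" "{..<M}"]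
        by (intro mult_left_mono) (auto simp: suminf_geometric)
      finally show ?thesis by simp
    qed
    then show "\<forall>M\<ge>0. norm (\<Sum>m<M. (\<mu> - c) ^ m *\<^sub>C B m x) \<le> 2 * K"
      by blast
  qed
  have "((\<lambda>\<mu>. cmod (\<mu> - c) * (2 * K)) \<longlongrightarrow> cmod (c - c) * (2 * K)) (at c)"
    by (intro tendsto_intros)
  then have "((\<lambda>\<mu>. cmod (\<mu> - c) * (2 * K)) \<longlongrightarrow> 0) (at c)"
    by simp
  moreover have "eventually (\<lambda>\<mu>. norm ((\<mu> - c) *\<^sub>C (G \<mu> x - P \<mu> x)) \<le> cmod (\<mu> - c) * (2 * K)) (at c)"
    unfolding eventually_at
    by (rule exI[of _ "\<rho> / 2"]) (use \<rho>(1) bound in \<open>auto simp: dist_norm intro!: mult_left_mono\<close>)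
  ultimately show ?thesis
    unfolding negligible_at_def by (rule Lim_null_comparison[rotated])
qed

text \<open>
  Near \<open>c\<close> the inverse is a sum of partial fractions and a regular part. Multiplication by \<open>(\<mu> - c)\<^sup>d\<close>
  lowers the order of every partial fraction by \<open>d\<close>, up to a regular term.
\<close>

lemma inverse_on_polynomial:
  fixes F :: "complex \<Rightarrow> 'a \<Rightarrow> 'a :: complex_hilbert_space"
  assumes iso: "c isolated_in op_spectrum F"
    and pp: "has_principal_part (\<lambda>\<mu>. inv (F \<mu>)) c (keldysh_principal_part c N p w z)"
    and u: "\<And>d. D < d \<Longrightarrow> u d = 0"
  shows "negligible_at c (\<lambda>\<mu>. inv (F \<mu>) (\<Sum>d\<le>D. (\<mu> - c) ^ d *\<^sub>C u d) -
    (\<Sum>(k, h)\<in>Sigma {..<N} (\<lambda>k. {..p k}).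
      (\<Sum>i\<le>p k - h. cinner (u (p k - h - i)) (z k i)) *\<^sub>C principal_fun c (w k) h \<mu>))"
proof -
  let ?P = "keldysh_principal_part c N p w z"
  have inv: "eventually (\<lambda>\<mu>. bounded_clinear (inv (F \<mu>))) (at c)"
    using eventually_invertible[OF iso] by eventually_elim simp
  have reg: "negligible_at c (\<lambda>\<mu>. inv (F \<mu>) x - ?P \<mu> x)" for x
    by (rule negligible_regular_part[OF pp _ bounded_linear_keldysh_principal_part])
      (use inv in eventually_elim, simp add: bounded_clinear_def)
  define E where "E k i d \<mu> = (\<mu> - c) ^ d *\<^sub>C principal_fun c (w k) (p k - i) \<mu> -
    (if d \<le> p k - i then principal_fun c (w k) (p k - i - d) \<mu> else 0)" for k i d \<mu>
  have E: "negligible_at c (\<lambda>\<mu>. a *\<^sub>C E k i d \<mu>)" for a k i d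
    unfolding E_def by (rule negligible_at_scaleC[OF tendsto_const negligible_at_shift])
  have "negligible_at c (\<lambda>\<mu>. (\<mu> - c) ^ d *\<^sub>C (inv (F \<mu>) (u d) - ?P \<mu> (u d)) +
    (\<Sum>k<N. \<Sum>i\<le>p k. cinner (u d) (z k i) *\<^sub>C E k i d \<mu>))" for d
    by (intro negligible_at_add negligible_at_sum E negligible_at_scaleC[OF _ reg, of _ "(c - c) ^ d"] tendsto_intros)
  then have "negligible_at c (\<lambda>\<mu>. \<Sum>d\<le>D. (\<mu> - c) ^ d *\<^sub>C (inv (F \<mu>) (u d) - ?P \<mu> (u d)) +
    (\<Sum>k<N. \<Sum>i\<le>p k. cinner (u d) (z k i) *\<^sub>C E k i d \<mu>))"
    by (rule negligible_at_sum)
  then show ?thesis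
  proof (rule negligible_at_cong)
    show "eventually (\<lambda>\<mu>. (\<Sum>d\<le>D. (\<mu> - c) ^ d *\<^sub>C (inv (F \<mu>) (u d) - ?P \<mu> (u d)) +
      (\<Sum>k<N. \<Sum>i\<le>p k. cinner (u d) (z k i) *\<^sub>C E k i d \<mu>)) =
      inv (F \<mu>) (\<Sum>d\<le>D. (\<mu> - c) ^ d *\<^sub>C u d) -
      (\<Sum>(k, h)\<in>Sigma {..<N} (\<lambda>k. {..p k}).
        (\<Sum>i\<le>p k - h. cinner (u (p k - h - i)) (z k i)) *\<^sub>C principal_fun c (w k) h \<mu>)) (at c)"
      using inv
    proof eventually_elim
      case (elim \<mu>)
      define R where "R k h = principal_fun c (w k) h \<mu>" for k h
      have lin: "clinear_map (inv (F \<mu>))"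
        using elim by (rule bounded_clinear_imp_clinear_map)
      have "(\<mu> - c) ^ d *\<^sub>C ?P \<mu> (u d) = (\<Sum>k<N. \<Sum>i\<le>p k. cinner (u d) (z k i) *\<^sub>C E k i d \<mu>) +
        (\<Sum>k<N. \<Sum>i\<le>p k. cinner (u d) (z k i) *\<^sub>C (if d \<le> p k - i then R k (p k - i - d) else 0))" for d
        unfolding keldysh_principal_part_eq E_def R_def sum.distrib[symmetric] scaleC_sum_right
        by (simp add: complex_vector.scale_right_diff_distrib scaleC_scaleC mult.commute)
      then have "(\<Sum>d\<le>D. (\<mu> - c) ^ d *\<^sub>C (inv (F \<mu>) (u d) - ?P \<mu> (u d)) +
        (\<Sum>k<N. \<Sum>i\<le>p k. cinner (u d) (z k i) *\<^sub>C E k i d \<mu>)) =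
        inv (F \<mu>) (\<Sum>d\<le>D. (\<mu> - c) ^ d *\<^sub>C u d) -
        (\<Sum>d\<le>D. \<Sum>k<N. \<Sum>i\<le>p k. cinner (u d) (z k i) *\<^sub>C (if d \<le> p k - i then R k (p k - i - d) else 0))"
        by (simp add: clinear_map_sum[OF lin] clinear_map_scaleC[OF lin] sum.distrib sum_subtractf
            complex_vector.scale_right_diff_distrib)
      also have "(\<Sum>d\<le>D. \<Sum>k<N. \<Sum>i\<le>p k. cinner (u d) (z k i) *\<^sub>C (if d \<le> p k - i then R k (p k - i - d) else 0)) =
        (\<Sum>k<N. \<Sum>d\<le>D. \<Sum>i\<le>p k. cinner (u d) (z k i) *\<^sub>C (if d \<le> p k - i then R k (p k - i - d) else 0))"
        by (rule sum.swap)
      also have "\<dots> = (\<Sum>k<N. \<Sum>h\<le>p k. (\<Sum>i\<le>p k - h. cinner (u (p k - h - i)) (z k i)) *\<^sub>C R k h)"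
      proof (rule sum.cong[OF refl])
        fix k
        have "(\<Sum>d\<le>D. \<Sum>i\<le>p k. cinner (u d) (z k i) *\<^sub>C (if d \<le> p k - i then R k (p k - i - d) else 0)) =
          (\<Sum>i\<le>p k. \<Sum>d\<le>D. cinner (u d) (z k i) *\<^sub>C (if d \<le> p k - i then R k (p k - i - d) else 0))"
          by (rule sum.swap)
        also have "\<dots> = (\<Sum>i\<le>p k. \<Sum>d\<le>p k - i. cinner (u d) (z k i) *\<^sub>C R k (p k - i - d))"
          using u by (intro sum.cong refl sum.mono_neutral_cong) (auto split: if_splits simp: not_le)
        also have "\<dots> = (\<Sum>h\<le>p k. \<Sum>i\<le>p k - h. cinner (u (p k - h - i)) (z k i) *\<^sub>C R k h)"
          unfolding sum.Sigma[OF finite_atMost ballI[OF finite_atMost]]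
          by (rule sum.reindex_bij_witness[of _ "\<lambda>(h, i). (i, p k - h - i)" "\<lambda>(i, d). (p k - i - d, i)"]) auto
        finally show "(\<Sum>d\<le>D. \<Sum>i\<le>p k. cinner (u d) (z k i) *\<^sub>C (if d \<le> p k - i then R k (p k - i - d) else 0)) =
          (\<Sum>h\<le>p k. (\<Sum>i\<le>p k - h. cinner (u (p k - h - i)) (z k i)) *\<^sub>C R k h)"
          by (simp add: scaleC_sum_left)
      qed
      finally show ?case
        by (simp add: R_def sum.Sigma)
    qed
  qed
qed

text \<open>Two expansions of \<open>F(\<mu>)\<inverse> u(\<mu>)\<close> into partial fractions can be compared coefficientwise. With a known
  expansion on the right, this yields linear relations for the adjoint vectors \<open>z k i\<close>.\<close>

lemma coefficients_of_inverse:
  fixes F :: "complex \<Rightarrow> 'a \<Rightarrow> 'a :: complex_hilbert_space"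
  assumes iso: "c isolated_in op_spectrum F"
    and indep: "lin_indep_family (\<lambda>k. w k 0) {..<N}"
    and pp: "has_principal_part (\<lambda>\<mu>. inv (F \<mu>)) c (keldysh_principal_part c N p w z)"
    and u: "\<And>d. D < d \<Longrightarrow> u d = 0"
    and eq: "eventually (\<lambda>\<mu>. inv (F \<mu>) (\<Sum>d\<le>D. (\<mu> - c) ^ d *\<^sub>C u d) =
      (\<Sum>(k, h)\<in>Sigma {..<N} (\<lambda>k. {..p k}). a k h *\<^sub>C principal_fun c (w k) h \<mu>) + Y \<mu>) (at c)"
    and Y: "negligible_at c Y"
    and kh: "k < N" "h \<le> p k"
  shows "(\<Sum>i\<le>p k - h. cinner (u (p k - h - i)) (z k i)) = a k h"
proof -
  define b where "b k h = (\<Sum>i\<le>p k - h. cinner (u (p k - h - i)) (z k i))" for k h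
  let ?J = "Sigma {..<N} (\<lambda>k. {..p k})"
  define X where "X \<mu> = - (\<Sum>(k, h)\<in>?J. (b k h - a k h) *\<^sub>C principal_fun c (w k) h \<mu>)" for \<mu>
  have "negligible_at c (\<lambda>\<mu>. inv (F \<mu>) (\<Sum>d\<le>D. (\<mu> - c) ^ d *\<^sub>C u d) -
    (\<Sum>(k, h)\<in>?J. b k h *\<^sub>C principal_fun c (w k) h \<mu>) - Y \<mu>)"
    unfolding b_def by (intro negligible_at_diff inverse_on_polynomial[OF iso pp] u Y)
  then have "negligible_at c X"
    by (rule negligible_at_cong)
      (use eq in eventually_elim, simp add: X_def case_prod_unfold
        complex_vector.scale_left_diff_distrib sum_subtractf)
  then have "((\<lambda>\<mu>. (\<mu> - c) *\<^sub>C X \<mu>) \<longlongrightarrow> 0) (at c)"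
    by (simp add: negligible_at_def)
  moreover have "eventually (\<lambda>\<mu>. (\<Sum>(k, h)\<in>?J. (b k h - a k h) *\<^sub>C principal_fun c (w k) h \<mu>) + X \<mu> = 0) (at c)"
    by (simp add: X_def)
  ultimately have "b k h - a k h = 0"
    using kh indep by (intro coefficients_eq_zero[where w = w and N = N and J = ?J and a = "\<lambda>k h. b k h - a k h"]) auto
  then show ?thesis
    by (simp add: b_def)
qed

section \<open>Orders of vanishing along the real axis\<close>

definition vanishes_to :: "nat \<Rightarrow> real \<Rightarrow> (real \<Rightarrow> 'a :: real_normed_vector) \<Rightarrow> bool"
  where "vanishes_to m c f \<longleftrightarrow> (\<exists>K\<ge>0. eventually (\<lambda>t. norm (f t) \<le> K * \<bar>t - c\<bar> ^ m) (at c))"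

lemma vanishes_toI:
  assumes "eventually (\<lambda>t. norm (f t) \<le> K * \<bar>t - c\<bar> ^ m) (at c)"
  shows "vanishes_to m c f"
  unfolding vanishes_to_def
proof (intro exI conjI)
  show "eventually (\<lambda>t. norm (f t) \<le> \<bar>K\<bar> * \<bar>t - c\<bar> ^ m) (at c)"
    using assms
  proof eventually_elim
    case (elim t)
    have "K * \<bar>t - c\<bar> ^ m \<le> \<bar>K\<bar> * \<bar>t - c\<bar> ^ m"
      by (intro mult_right_mono) auto
    with elim show ?case by linarith
  qed
qed simp

lemma vanishes_to_bound:
  assumes "vanishes_to m c g" "eventually (\<lambda>t. norm (f t) \<le> C * norm (g t)) (at c)"
  shows "vanishes_to m c f"
proof -
  obtain K where K: "K \<ge> 0" "eventually (\<lambda>t. norm (g t) \<le> K * \<bar>t - c\<bar> ^ m) (at c)"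
    using assms(1) by (auto simp: vanishes_to_def)
  show ?thesis
  proof (rule vanishes_toI)
    show "eventually (\<lambda>t. norm (f t) \<le> (\<bar>C\<bar> * K) * \<bar>t - c\<bar> ^ m) (at c)"
      using K(2) assms(2)
    proof eventually_elim
      case (elim t)
      have "C * norm (g t) \<le> \<bar>C\<bar> * norm (g t)"
        by (intro mult_right_mono) auto
      also have "\<dots> \<le> \<bar>C\<bar> * (K * \<bar>t - c\<bar> ^ m)"
        using elim(1) by (intro mult_left_mono) auto
      finally show ?case
        using elim(2) by (simp add: mult.assoc)
    qed
  qed
qed

lemma vanishes_to_cong:
  assumes "vanishes_to m c f" "eventually (\<lambda>t. f t = g t) (at c)"
  shows "vanishes_to m c g"
  using assms(1) by (rule vanishes_to_bound[where C = 1]) (use assms(2) in eventually_elim, simp)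

lemma vanishes_to_mono:
  assumes "vanishes_to m c f" "l \<le> m"
  shows "vanishes_to l c f"
proof -
  obtain K where K: "K \<ge> 0" "eventually (\<lambda>t. norm (f t) \<le> K * \<bar>t - c\<bar> ^ m) (at c)"
    using assms(1) by (auto simp: vanishes_to_def)
  have "eventually (\<lambda>t. \<bar>t - c\<bar> < 1) (at c)"
    unfolding eventually_at by (rule exI[of _ 1]) (auto simp: dist_norm)
  with K(2) have "eventually (\<lambda>t. norm (f t) \<le> K * \<bar>t - c\<bar> ^ l) (at c)"
  proof eventually_elim
    case (elim t)
    have "\<bar>t - c\<bar> ^ m \<le> \<bar>t - c\<bar> ^ l"
      using elim(2) assms(2) by (intro power_decreasing) auto
    then have "K * \<bar>t - c\<bar> ^ m \<le> K * \<bar>t - c\<bar> ^ l"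
      using K(1) by (rule mult_left_mono)
    with elim(1) show ?case by linarith
  qed
  then show ?thesis by (rule vanishes_toI)
qed

lemma vanishes_to_add:
  assumes "vanishes_to m c f" "vanishes_to m c g"
  shows "vanishes_to m c (\<lambda>t. f t + g t)"
proof -
  obtain K L where K: "eventually (\<lambda>t. norm (f t) \<le> K * \<bar>t - c\<bar> ^ m) (at c)"
    and L: "eventually (\<lambda>t. norm (g t) \<le> L * \<bar>t - c\<bar> ^ m) (at c)"
    using assms by (auto simp: vanishes_to_def)
  have "eventually (\<lambda>t. norm (f t + g t) \<le> (K + L) * \<bar>t - c\<bar> ^ m) (at c)"
    using K L
  proof eventually_elim
    case (elim t)
    then show ?case
      using norm_triangle_ineq[of "f t" "g t"] by (simp add: distrib_right)
  qed
  then show ?thesis by (rule vanishes_toI)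
qed

lemma vanishes_to_zero: "vanishes_to m c (\<lambda>_. 0)"
  by (rule vanishes_toI[where K = 0]) simp

lemma vanishes_to_sum:
  "(\<And>i. i \<in> I \<Longrightarrow> vanishes_to m c (f i)) \<Longrightarrow> vanishes_to m c (\<lambda>t. \<Sum>i\<in>I. f i t)"
  by (induction I rule: infinite_finite_induct) (auto intro: vanishes_to_add vanishes_to_zero)

lemma vanishes_to_minus: "vanishes_to m c f \<Longrightarrow> vanishes_to m c (\<lambda>t. - f t)"
  by (simp add: vanishes_to_def)

lemma vanishes_to_diff:
  "vanishes_to m c f \<Longrightarrow> vanishes_to m c g \<Longrightarrow> vanishes_to m c (\<lambda>t. f t - g t)"
  using vanishes_to_add[OF _ vanishes_to_minus, of m c f g] by simp

lemma vanishes_to_tendsto: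
  assumes "(f \<longlongrightarrow> x) (at c)"
  shows "vanishes_to 0 c f"
proof (rule vanishes_toI[where K = "norm x + 1"])
  show "eventually (\<lambda>t. norm (f t) \<le> (norm x + 1) * \<bar>t - c\<bar> ^ 0) (at c)"
    using order_tendstoD(2)[OF tendsto_norm[OF assms], of "norm x + 1"]
    by (auto elim!: eventually_mono)
qed

lemma vanishes_to_product:
  assumes f: "vanishes_to l c f" and g: "vanishes_to m c g"
    and le: "eventually (\<lambda>t. norm (h t) \<le> norm (f t) * norm (g t)) (at c)"
  shows "vanishes_to (l + m) c h"
proof -
  obtain K L where KL: "K \<ge> 0" "L \<ge> 0"
    and K: "eventually (\<lambda>t. norm (f t) \<le> K * \<bar>t - c\<bar> ^ l) (at c)"
    and L: "eventually (\<lambda>t. norm (g t) \<le> L * \<bar>t - c\<bar> ^ m) (at c)"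
    using f g by (auto simp: vanishes_to_def)
  have "eventually (\<lambda>t. norm (h t) \<le> (K * L) * \<bar>t - c\<bar> ^ (l + m)) (at c)"
    using K L le
  proof eventually_elim
    case (elim t)
    have "norm (f t) * norm (g t) \<le> (K * \<bar>t - c\<bar> ^ l) * (L * \<bar>t - c\<bar> ^ m)"
      using elim KL by (intro mult_mono) auto
    with elim(3) show ?case
      by (simp add: power_add mult_ac)
  qed
  then show ?thesis by (rule vanishes_toI)
qed

lemma vanishes_to_cinner:
  fixes f g :: "real \<Rightarrow> 'a :: complex_hilbert_space"
  shows "vanishes_to l c f \<Longrightarrow> vanishes_to m c g \<Longrightarrow> vanishes_to (l + m) c (\<lambda>t. cinner (f t) (g t))"
  by (rule vanishes_to_product) (auto intro!: always_eventually norm_cinner_le)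

lemma vanishes_to_power_scaleC:
  fixes f :: "real \<Rightarrow> 'a :: complex_hilbert_space"
  assumes "vanishes_to m c f"
  shows "vanishes_to (d + m) c (\<lambda>t. (of_real t - of_real c) ^ d *\<^sub>C f t)"
proof (rule vanishes_to_product[OF _ assms])
  show "vanishes_to d c (\<lambda>t. \<bar>t - c\<bar> ^ d)"
    by (rule vanishes_toI[where K = 1]) simp
  show "eventually (\<lambda>t. norm ((of_real t - of_real c) ^ d *\<^sub>C f t) \<le> norm (\<bar>t - c\<bar> ^ d) * norm (f t)) (at c)"
    by (simp add: norm_power flip: of_real_diff)
qed

lemma vanishes_to_sqrt:
  assumes f: "vanishes_to (2 * l) c f" and g: "vanishes_to (2 * m) c g"
    and le: "eventually (\<lambda>t. (norm (h t))\<^sup>2 \<le> norm (f t) * norm (g t)) (at c)"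
  shows "vanishes_to (l + m) c h"
proof -
  have "vanishes_to (2 * l + 2 * m) c (\<lambda>t. (norm (h t))\<^sup>2)"
    by (rule vanishes_to_product[OF f g]) (use le in simp)
  then obtain K where K: "K \<ge> 0"
    "eventually (\<lambda>t. (norm (h t))\<^sup>2 \<le> K * \<bar>t - c\<bar> ^ (2 * l + 2 * m)) (at c)"
    by (auto simp: vanishes_to_def)
  have "eventually (\<lambda>t. norm (h t) \<le> sqrt K * \<bar>t - c\<bar> ^ (l + m)) (at c)"
    using K(2)
  proof eventually_elim
    case (elim t)
    have "2 * l + 2 * m = (l + m) * 2"
      by simp
    then have "K * \<bar>t - c\<bar> ^ (2 * l + 2 * m) = (sqrt K * \<bar>t - c\<bar> ^ (l + m))\<^sup>2"
      using K(1) by (simp only: power_mult power_mult_distrib real_sqrt_pow2)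
    with elim show ?case
      using K(1) by (auto intro: power2_le_imp_le)
  qed
  then show ?thesis by (rule vanishes_toI)
qed

lemma vanishes_to_imp_tendsto:
  fixes f :: "real \<Rightarrow> 'a :: complex_hilbert_space"
  assumes "vanishes_to (Suc d) c f"
  shows "((\<lambda>t. (1 / (of_real t - of_real c) ^ d) *\<^sub>C f t) \<longlongrightarrow> 0) (at c)"
proof -
  obtain K where K: "eventually (\<lambda>t. norm (f t) \<le> K * \<bar>t - c\<bar> ^ Suc d) (at c)"
    using assms by (auto simp: vanishes_to_def)
  have "((\<lambda>t. K * \<bar>t - c\<bar>) \<longlongrightarrow> K * \<bar>c - c\<bar>) (at c)"
    by (intro tendsto_intros)
  then have "((\<lambda>t. K * \<bar>t - c\<bar>) \<longlongrightarrow> 0) (at c)"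
    by simp
  moreover have "eventually (\<lambda>t. norm ((1 / (of_real t - of_real c) ^ d) *\<^sub>C f t) \<le> K * \<bar>t - c\<bar>) (at c)"
    using K eventually_neq_at_within[of c c]
  proof eventually_elim
    case (elim t)
    have "norm ((1 / (of_real t - of_real c) ^ d) *\<^sub>C f t) = norm (f t) / \<bar>t - c\<bar> ^ d"
      by (simp add: norm_divide norm_power flip: of_real_diff)
    also have "\<dots> \<le> K * \<bar>t - c\<bar>"
      using elim by (simp add: divide_le_eq mult_ac)
    finally show ?case .
  qed
  ultimately show ?thesis
    by (rule Lim_null_comparison[rotated])
qed

lemma vanishes_to_polynomial:
  fixes u :: "nat \<Rightarrow> 'a :: complex_hilbert_space"
  assumes "vanishes_to m c (\<lambda>t. \<Sum>d\<le>D. (of_real t - of_real c) ^ d *\<^sub>C u d)" "e < m" "e \<le> D"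
  shows "u e = 0"
  using assms(2,3)
proof (induction e rule: less_induct)
  case (less e)
  have "((\<lambda>t. (1 / (of_real t - of_real c) ^ e) *\<^sub>C (\<Sum>d\<le>D. (of_real t - of_real c) ^ d *\<^sub>C u d)) \<longlongrightarrow> 0) (at c)"
    using less.prems by (intro vanishes_to_imp_tendsto vanishes_to_mono[OF assms(1)]) auto
  moreover have "eventually (\<lambda>t. (1 / (of_real t - of_real c) ^ e) *\<^sub>C (\<Sum>d\<le>D. (of_real t - of_real c) ^ d *\<^sub>C u d) =
    (\<Sum>d\<in>{e..D}. (of_real t - of_real c) ^ (d - e) *\<^sub>C u d)) (at c)"
    using eventually_neq_at_within[of c c]
  proof eventually_elim
    case (elim t)
    have "(\<Sum>d\<le>D. (of_real t - of_real c) ^ d *\<^sub>C u d) = (\<Sum>d\<in>{e..D}. (of_real t - of_real c) ^ d *\<^sub>C u d)"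
      using less by (intro sum.mono_neutral_right) (auto simp: not_le)
    then show ?case
      using elim by (simp add: scaleC_sum_right scaleC_scaleC power_diff)
  qed
  ultimately have "((\<lambda>t. \<Sum>d\<in>{e..D}. (of_real t - of_real c) ^ (d - e) *\<^sub>C u d) \<longlongrightarrow> 0) (at c)"
    by (rule Lim_transform_eventually)
  moreover have "((\<lambda>t. \<Sum>d\<in>{e..D}. (of_real t - of_real c) ^ (d - e) *\<^sub>C u d) \<longlongrightarrow>
    (\<Sum>d\<in>{e..D}. (of_real c - of_real c) ^ (d - e) *\<^sub>C u d)) (at c)"
    by (intro tendsto_intros)
  ultimately have "(\<Sum>d\<in>{e..D}. (of_real c - of_real c) ^ (d - e) *\<^sub>C u d) = 0"
    using tendsto_unique[of "at c"] by force
  moreover have "(\<Sum>d\<in>{e..D}. (of_real c - of_real c) ^ (d - e) *\<^sub>C u d) = u e"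
    using less.prems by (subst sum.remove[of _ e]) (auto intro!: sum.neutral)
  ultimately show ?case
    by simp
qed

lemma polynomial_at_tendsto:
  fixes f :: "complex \<Rightarrow> 'a :: complex_hilbert_space"
  assumes "polynomial_at c f"
  shows "(f \<longlongrightarrow> f z) (at z)"
proof -
  obtain D u where f: "f = (\<lambda>\<mu>. \<Sum>d\<le>D. (\<mu> - c) ^ d *\<^sub>C u d)"
    using assms by (auto simp: polynomial_at_def)
  show ?thesis
    unfolding f by (intro tendsto_intros)
qed

lemma polynomial_at_tendsto_real:
  fixes f :: "complex \<Rightarrow> 'a :: complex_hilbert_space"
  assumes "polynomial_at c f"
  shows "((\<lambda>t :: real. f (of_real t)) \<longlongrightarrow> f (of_real s)) (at s)"
  by (rule filterlim_compose[OF polynomial_at_tendsto[OF assms] filterlim_of_real_at])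

lemma polynomial_at_first_order:
  fixes f :: "complex \<Rightarrow> 'a :: complex_hilbert_space"
  assumes "polynomial_at (of_real c) f"
  shows "vanishes_to 1 c (\<lambda>t. f (of_real t) - f (of_real c))"
proof -
  obtain D u where f: "\<And>\<mu>. f \<mu> = (\<Sum>d\<le>D. (\<mu> - of_real c) ^ d *\<^sub>C u d)"
    using assms by (auto simp: polynomial_at_def)
  define g where "g t = (\<Sum>d<D. (of_real t - of_real c) ^ d *\<^sub>C u (Suc d))" for t
  have "f (of_real t) - f (of_real c) = (of_real t - of_real c) ^ 1 *\<^sub>C g t" for t
  proof -
    have "f \<mu> = u 0 + (\<Sum>d<D. (\<mu> - of_real c) ^ Suc d *\<^sub>C u (Suc d))" for \<mu>
      unfolding f by (subst sum.atMost_shift) simp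
    then show ?thesis
      by (simp add: g_def scaleC_sum_right scaleC_scaleC)
  qed
  moreover have "vanishes_to (1 + 0) c (\<lambda>t. (of_real t - of_real c) ^ 1 *\<^sub>C g t)"
    unfolding g_def by (intro vanishes_to_power_scaleC tendsto_intros
        vanishes_to_tendsto[where x = "\<Sum>d<D. (of_real c - of_real c) ^ d *\<^sub>C u (Suc d)"])
  ultimately show ?thesis
    by simp
qed

section \<open>Dissipative pencils\<close>

lemma pencil_cmod_bound:
  fixes A :: "nat \<Rightarrow> 'a \<Rightarrow> 'a :: complex_hilbert_space"
  assumes "\<And>j. j \<le> n \<Longrightarrow> bounded_clinear (A j)"
  obtains C where "\<And>\<mu> x. cmod (\<mu> - c) \<le> 1 \<Longrightarrow> norm (pencil n A \<mu> x) \<le> C * norm x"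
proof
  fix \<mu> x assume \<mu>: "cmod (\<mu> - c) \<le> 1"
  then have le: "cmod \<mu> \<le> cmod c + 1"
    using norm_triangle_ineq[of c "\<mu> - c"] by simp
  have "norm (pencil n A \<mu> x) \<le> (\<Sum>j\<le>n. (cmod c + 1) ^ j * (onorm (A j) * norm x))"
    unfolding pencil_def
  proof (rule sum_norm_le)
    fix j assume "j \<in> {..n}"
    then have "bounded_linear (A j)"
      using assms by (simp add: bounded_clinear_def)
    then show "norm (\<mu> ^ j *\<^sub>C A j x) \<le> (cmod c + 1) ^ j * (onorm (A j) * norm x)"
      using le by (auto simp: norm_power intro!: mult_mono power_mono onorm)
  qed
  then show "norm (pencil n A \<mu> x) \<le> (\<Sum>j\<le>n. (cmod c + 1) ^ j * onorm (A j)) * norm x"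
    by (simp add: sum_distrib_right mult.assoc)
qed

lemma clinear_map_pencil:
  assumes "\<And>j. j \<le> n \<Longrightarrow> clinear_map (A j)"
  shows "clinear_map (pencil n A \<mu>)"
  using assms by (simp add: clinear_map_def pencil_def scaleC_add_right sum.distrib
      scaleC_sum_right scaleC_scaleC mult.commute)

locale dissipative_pencil =
  fixes n :: nat and A :: "nat \<Rightarrow> 'a \<Rightarrow> 'a :: complex_hilbert_space"
  assumes bounded: "\<And>j. j \<le> n \<Longrightarrow> bounded_clinear (A j)"
    and dissipative: "\<And>x (t :: real). Im (cinner (pencil n A (of_real t) x) x) \<le> 0"
begin

abbreviation form :: "real \<Rightarrow> 'a \<Rightarrow> 'a \<Rightarrow> complex"
  where "form t x y \<equiv> cinner (pencil n A (of_real t) x) y"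

lemma clinear_A: "j \<le> n \<Longrightarrow> clinear_map (A j)"
  using bounded by (rule bounded_clinear_imp_clinear_map)

lemma clinear_pencil: "clinear_map (pencil n A \<mu>)"
  using clinear_A by (rule clinear_map_pencil)

text \<open>The Hermitian form of \<open>- Im A(t)\<close>, which is non-negative because \<open>A\<close> is dissipative. It measures
  how far the form of \<open>A(t)\<close> is from being Hermitian.\<close>

definition energy :: "real \<Rightarrow> 'a \<Rightarrow> 'a \<Rightarrow> complex"
  where "energy t x y = \<i> / 2 *
    (form t x y - cnj (form t y x))"

lemma energy_self: "energy t x x = of_real (- Im (form t x x))"
  by (simp add: energy_def complex_eq_iff)

lemma energy_nonneg: "0 \<le> Re (energy t x x)"
  by (simp add: energy_self dissipative)

lemma energy_cnj: "cnj (energy t x y) = energy t y x"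
  by (simp add: energy_def algebra_simps)

lemma energy_diff_left: "energy t (x - y) v = energy t x v - energy t y v"
  using clinear_map_add[OF clinear_pencil, of "of_real t" "x - y" y]
  by (simp add: energy_def cinner_diff_left cinner_diff_right algebra_simps cinner_add_left)

lemma energy_scaleC_left: "energy t (a *\<^sub>C x) v = a * energy t x v"
  by (simp add: energy_def clinear_map_scaleC[OF clinear_pencil] cinner_scaleC_left
      cinner_scaleC_right algebra_simps)

lemma energy_diff_right: "energy t v (x - y) = energy t v x - energy t v y"
  by (metis energy_cnj energy_diff_left complex_cnj_diff)

lemma energy_scaleC_right: "energy t v (a *\<^sub>C x) = cnj a * energy t v x"
  by (metis energy_cnj energy_scaleC_left complex_cnj_mult)

text \<open>The form need not be definite. The quadratic polynomial \<open>r \<mapsto> energy t (x - r u y) (x - r u y)\<close>, with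
  the phase \<open>u\<close> of \<open>energy t x y\<close>, is non-negative, and degenerates to a linear one if \<open>y\<close> has energy \<open>0\<close>.\<close>

lemma energy_cauchy_schwarz: "(cmod (energy t x y))\<^sup>2 \<le> cmod (energy t x x) * cmod (energy t y y)"
proof (cases "energy t x y = 0")
  case False
  define B where "B = cmod (energy t x y)"
  define u where "u = energy t x y / of_real B"
  have B: "0 < B"
    using False by (simp add: B_def)
  have u: "cnj u * energy t x y = of_real B" "u * energy t y x = of_real B" "u * cnj u = 1"
  proof -
    have "energy t x y * cnj (energy t x y) = of_real (B * B)"
      by (simp add: B_def complex_norm_square[symmetric] power2_eq_square flip: of_real_mult)
    then show "cnj u * energy t x y = of_real B" "u * energy t y x = of_real B" "u * cnj u = 1"
      using B by (simp_all add: u_def mult.commute energy_cnj[symmetric, of t y x] field_simps)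
  qed
  have quad: "0 \<le> Re (energy t x x) - 2 * r * B + r\<^sup>2 * Re (energy t y y)" for r :: real
  proof -
    define a where "a = of_real r * u"
    have "energy t (x - a *\<^sub>C y) (x - a *\<^sub>C y) =
      energy t x x - cnj a * energy t x y - a * energy t y x + a * cnj a * energy t y y"
      by (simp add: energy_diff_left energy_diff_right energy_scaleC_left energy_scaleC_right algebra_simps)
    also have "\<dots> = energy t x x - of_real r * (cnj u * energy t x y) - of_real r * (u * energy t y x)
      + of_real (r\<^sup>2) * (u * cnj u) * energy t y y"
      by (simp add: a_def power2_eq_square mult_ac)
    also have "\<dots> = energy t x x - of_real (2 * r * B) + of_real (r\<^sup>2) * energy t y y"
      unfolding u by simp
    finally show ?thesis
      using energy_nonneg[of t "x - a *\<^sub>C y"] by (simp del: of_real_mult of_real_power)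
  qed
  have abs: "cmod (energy t v v) = Re (energy t v v)" for v
    using energy_nonneg[of t v] by (simp add: energy_self)
  let ?C = "Re (energy t y y)"
  have "?C \<noteq> 0"
  proof
    assume "?C = 0"
    then show False
      using quad[of "(Re (energy t x x) + 1) / (2 * B)"] B by simp
  qed
  then have C: "0 < ?C"
    using energy_nonneg[of t y] by simp
  have "0 \<le> (Re (energy t x x) - 2 * (B / ?C) * B + (B / ?C)\<^sup>2 * ?C) * ?C"
    using quad[of "B / ?C"] C by simp
  also have "\<dots> = Re (energy t x x) * ?C - B\<^sup>2"
    using C by (simp add: field_simps power2_eq_square)
  finally show ?thesis
    by (simp add: abs B_def)
qed simp

lemma pencil_form_swap:
  "form t x y =
    cnj (form t y x) - 2 * \<i> * energy t x y"
  by (simp add: energy_def)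

lemma vanishes_to_pencil:
  assumes "vanishes_to m c f"
  shows "vanishes_to m c (\<lambda>t. pencil n A (of_real t) (f t))"
proof -
  obtain C where C: "\<And>\<mu> x. cmod (\<mu> - of_real c) \<le> 1 \<Longrightarrow> norm (pencil n A \<mu> x) \<le> C * norm x"
    using pencil_cmod_bound[where c = "complex_of_real c"] bounded by metis
  have "eventually (\<lambda>t. \<bar>t - c\<bar> < 1) (at c)"
    unfolding eventually_at by (rule exI[of _ 1]) (auto simp: dist_norm)
  then have "eventually (\<lambda>t. norm (pencil n A (of_real t) (f t)) \<le> C * norm (f t)) (at c)"
    by eventually_elim (auto intro!: C simp flip: of_real_diff)
  with assms show ?thesis
    by (rule vanishes_to_bound)
qed

lemma vanishes_to_energy:
  assumes "vanishes_to (2 * l) c (\<lambda>t. energy t (f t) (f t))"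
    and "vanishes_to (2 * m) c (\<lambda>t. energy t (g t) (g t))"
  shows "vanishes_to (l + m) c (\<lambda>t. energy t (f t) (g t))"
  using assms by (rule vanishes_to_sqrt) (simp add: energy_cauchy_schwarz)

end

section \<open>Real eigenvalues\<close>

text \<open>The chain equations of \<open>(\<Sum>j. \<mu>\<^sup>j A\<^sub>j\<^sup>*)\<close> at \<open>c\<close>, tested against all vectors \<open>x\<close>; in this form no adjoint
  operators are involved.\<close>

definition adjoint_chain :: "nat \<Rightarrow> (nat \<Rightarrow> 'a \<Rightarrow> 'a) \<Rightarrow> complex \<Rightarrow> nat \<Rightarrow> (nat \<Rightarrow> 'a :: complex_hilbert_space) \<Rightarrow> bool"
  where "adjoint_chain n A c h w \<longleftrightarrow> (\<forall>x. chain_equations n (\<lambda>j u. cinner u (A j x)) c h w)"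

lemma adjoint_chain_iff:
  "adjoint_chain n A (of_real c) h w \<longleftrightarrow>
    (\<forall>x. \<forall>s\<le>h. (\<Sum>i\<le>s. cinner (w (s - i)) (taylor_coeff n A (of_real c) i x)) = 0)"
proof -
  have "taylor_coeff n (\<lambda>j u. cinner u (A j x)) (of_real c) i u = cinner u (taylor_coeff n A (of_real c) i x)" for i x u
    by (simp add: taylor_coeff_def cinner_sum_right cinner_scaleC_right scaleC_complex_def)
  then show ?thesis
    by (simp add: adjoint_chain_def chain_equations_def)
qed

lemma adjoint_chain_mono: "adjoint_chain n A c h w \<Longrightarrow> g \<le> h \<Longrightarrow> adjoint_chain n A c g w"
  unfolding adjoint_chain_def using chain_equations_mono by blast

lemma adjoint_chain_imp_polynomial:
  assumes "adjoint_chain n A c h w" "\<mu> \<noteq> c"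
  shows "cinner (principal_fun c w h \<mu>) (pencil n A (cnj \<mu>) x) =
    polynomial_part n (\<lambda>j u. cinner u (A j x)) (derived_vector c w h) \<mu>"
proof -
  have "(\<Sum>j\<le>n. \<mu> ^ j *\<^sub>C cinner (principal_fun c w h \<mu>) (A j x)) =
    polynomial_part n (\<lambda>j u. cinner u (A j x)) (derived_vector c w h) \<mu>"
    using assms by (intro chain_equations_imp_polynomial clinear_map_cinner) (auto simp: adjoint_chain_def)
  then show ?thesis
    by (simp add: pencil_def cinner_sum_right cinner_scaleC_right scaleC_complex_def)
qed

lemma polynomial_part_sum:
  assumes "\<And>j. j \<le> n \<Longrightarrow> clinear_map (G j)"
  shows "polynomial_part n G (\<lambda>i. \<Sum>q\<in>I. a q *\<^sub>C d q i) \<mu> = (\<Sum>q\<in>I. a q *\<^sub>C polynomial_part n G (d q) \<mu>)"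
proof -
  have "polynomial_part n G (\<lambda>i. \<Sum>q\<in>I. a q *\<^sub>C d q i) \<mu> =
    (\<Sum>j\<le>n. \<Sum>i<j. \<Sum>q\<in>I. a q *\<^sub>C \<mu> ^ (j - 1 - i) *\<^sub>C G j (d q i))"
    by (simp add: polynomial_part_def clinear_map_sum[OF assms] clinear_map_scaleC[OF assms]
        scaleC_sum_right scaleC_scaleC mult.commute)
  also have "\<dots> = (\<Sum>q\<in>I. \<Sum>j\<le>n. \<Sum>i<j. a q *\<^sub>C \<mu> ^ (j - 1 - i) *\<^sub>C G j (d q i))"
    by (subst sum.swap[of _ I]) (intro sum.cong refl sum.swap)
  finally show ?thesis
    by (simp add: polynomial_part_def scaleC_sum_right)
qed

text \<open>Adjoint chains are determined by their derived chains of length \<open>n\<close>: if the latter cancel,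
  the combination is orthogonal to the range of \<open>A(\<mu>)\<close>.\<close>

lemma adjoint_chains_cancel:
  fixes v :: "'q \<Rightarrow> nat \<Rightarrow> 'a :: complex_hilbert_space"
  assumes ch: "\<And>q. q \<in> I \<Longrightarrow> adjoint_chain n A c (h q) (v q)"
    and zero: "\<And>i. i < n \<Longrightarrow> (\<Sum>q\<in>I. a q *\<^sub>C derived_vector c (v q) (h q) i) = 0"
    and \<mu>: "\<mu> \<noteq> c" and surj: "surj (pencil n A (cnj \<mu>))"
  shows "(\<Sum>q\<in>I. a q *\<^sub>C principal_fun c (v q) (h q) \<mu>) = 0"
proof -
  let ?V = "\<Sum>q\<in>I. a q *\<^sub>C principal_fun c (v q) (h q) \<mu>"
  obtain x where x: "?V = pencil n A (cnj \<mu>) x"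
    using surj by blast
  have "cinner ?V (pencil n A (cnj \<mu>) x) = (\<Sum>q\<in>I. a q *\<^sub>C
    polynomial_part n (\<lambda>j u. cinner u (A j x)) (derived_vector c (v q) (h q)) \<mu>)"
    by (simp add: cinner_sum_left cinner_scaleC_left adjoint_chain_imp_polynomial[OF ch \<mu>] scaleC_complex_def)
  also have "\<dots> = polynomial_part n (\<lambda>j u. cinner u (A j x))
    (\<lambda>i. \<Sum>q\<in>I. a q *\<^sub>C derived_vector c (v q) (h q) i) \<mu>"
    by (rule polynomial_part_sum[symmetric]) (rule clinear_map_cinner)
  also have "\<dots> = 0"
    by (simp add: polynomial_part_def zero)
  finally show ?thesis
    using x by (metis cinner_eq_zeroD)
qed

lemma cspan_image_finite:
  assumes "finite J" "x \<in> cspan (f ` J)"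
  shows "\<exists>\<beta>. x = (\<Sum>j\<in>J. \<beta> j *\<^sub>C f j)"
proof -
  let ?S = "{x. \<exists>\<beta>. x = (\<Sum>j\<in>J. \<beta> j *\<^sub>C f j)}"
  have "cspan (f ` J) \<subseteq> ?S"
  proof (rule complex_vector.span_minimal)
    show "f ` J \<subseteq> ?S"
    proof safe
      fix j assume "j \<in> J"
      then have "f j = (\<Sum>i\<in>J. (if i = j then 1 else 0) *\<^sub>C f i)"
        using assms(1) by (subst sum.remove[of _ j]) (auto intro!: sum.neutral)
      then show "\<exists>\<beta>. f j = (\<Sum>i\<in>J. \<beta> i *\<^sub>C f i)"
        by (rule exI[of _ "\<lambda>i. if i = j then 1 else 0"])
    qed
    show "complex_vector.subspace ?S"
    proof (rule complex_vector.subspaceI)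
      show "0 \<in> ?S"
        by (auto intro!: exI[of _ "\<lambda>_. 0"])
      show "x + y \<in> ?S" if xy: "x \<in> ?S" "y \<in> ?S" for x y
      proof -
        obtain \<beta> \<gamma> where "x = (\<Sum>j\<in>J. \<beta> j *\<^sub>C f j)" "y = (\<Sum>j\<in>J. \<gamma> j *\<^sub>C f j)"
          using xy by blast
        then have "x + y = (\<Sum>j\<in>J. (\<beta> j + \<gamma> j) *\<^sub>C f j)"
          by (simp add: scaleC_add_left sum.distrib)
        then have "\<exists>\<beta>. x + y = (\<Sum>j\<in>J. \<beta> j *\<^sub>C f j)"
          by (rule exI[of _ "\<lambda>j. \<beta> j + \<gamma> j"])
        then show ?thesis by simp
      qed
      show "a *\<^sub>C x \<in> ?S" if x: "x \<in> ?S" for a x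
      proof -
        obtain \<beta> where "x = (\<Sum>j\<in>J. \<beta> j *\<^sub>C f j)"
          using x by blast
        then have "a *\<^sub>C x = (\<Sum>j\<in>J. (a * \<beta> j) *\<^sub>C f j)"
          by (simp add: scaleC_sum_right scaleC_scaleC)
        then have "\<exists>\<beta>. a *\<^sub>C x = (\<Sum>j\<in>J. \<beta> j *\<^sub>C f j)"
          by (rule exI[of _ "\<lambda>j. a * \<beta> j"])
        then show ?thesis by simp
      qed
    qed
  qed
  with assms(2) show ?thesis by blast
qed

lemma sum_fun_apply: "(\<Sum>i\<in>I. f i) x = (\<Sum>i\<in>I. f i x)" for f :: "'i \<Rightarrow> 'j \<Rightarrow> 'b :: comm_monoid_add"
  by (induction I rule: infinite_finite_induct) (auto simp: zero_fun_def plus_fun_def)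

locale regular_eigenvalue = dissipative_pencil n A
  for n :: nat and A :: "nat \<Rightarrow> 'a \<Rightarrow> 'a :: complex_hilbert_space" +
  fixes c :: real and N :: nat and p :: "nat \<Rightarrow> nat" and w z :: "nat \<Rightarrow> nat \<Rightarrow> 'a" and eps :: "nat \<Rightarrow> int"
  assumes isolated: "complex_of_real c isolated_in op_spectrum (pencil n A)"
    and chain: "\<And>k. k < N \<Longrightarrow> chain_equations n A (of_real c) (p k) (w k)"
    and indep: "lin_indep_family (\<lambda>k. w k 0) {..<N}"
    and principal: "has_principal_part (\<lambda>\<mu>. inv (pencil n A \<mu>)) (of_real c)
      (keldysh_principal_part (of_real c) N p w z)"
    and regular: "\<And>k. k < N \<Longrightarrow> even (p k) \<Longrightarrow> eps k \<in> {1, -1} \<and>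
      derived_chain n (of_real c) (z k) (p k div 2)
        - of_int (eps k) *\<^sub>C derived_chain n (of_real c) (w k) (p k div 2)
      \<in> cspan {derived_chain n (of_real c) (w j) h | j h. j < N \<and> int h \<le> (int (p j) - 1) div 2}"
begin

abbreviation \<delta> :: "real \<Rightarrow> complex"
  where "\<delta> t \<equiv> of_real t - of_real c"

lemma invertible_near:
  "eventually (\<lambda>\<mu>. \<mu> \<noteq> of_real c \<and> bij (pencil n A \<mu>)) (at (of_real c))"
  using eventually_invertible[OF isolated] eventually_neq_at_within[of "complex_of_real c"]
  by eventually_elim simp

text \<open>\<open>A(\<mu>)\<inverse> A(\<mu>) x = x\<close> has no pole at \<open>c\<close>, and the polar coefficients of the left-hand side are the
  adjoint chain equations for \<open>z k\<close>.\<close>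

lemma adjoint_chain_z:
  assumes k: "k < N"
  shows "adjoint_chain n A c (p k) (z k)"
  unfolding adjoint_chain_iff
proof (intro allI impI)
  fix x s assume s: "s \<le> p k"
  let ?B = "\<lambda>d. taylor_coeff n A c d x"
  have "(\<Sum>i\<le>p k - (p k - s). cinner (?B (p k - (p k - s) - i)) (z k i)) = 0"
  proof (rule coefficients_of_inverse[OF isolated _ principal, where D = n and a = "\<lambda>k h. 0" and Y = "\<lambda>_. x"])
    show "taylor_coeff n A c d x = 0" if "n < d" for d
      using that by (simp add: taylor_coeff_def binomial_eq_0)
    show "eventually (\<lambda>\<mu>. inv (pencil n A \<mu>) (\<Sum>d\<le>n. (\<mu> - of_real c) ^ d *\<^sub>C ?B d) =
      (\<Sum>(k, h)\<in>Sigma {..<N} (\<lambda>k. {..p k}). 0 *\<^sub>C principal_fun c (w k) h \<mu>) + x) (at (of_real c))"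
      using invertible_near
      by eventually_elim (simp add: case_prod_unfold bij_is_inj flip: pencil_taylor)
    show "negligible_at (of_real c) (\<lambda>_. x)"
      by (rule negligible_at_tendsto[OF tendsto_const])
  qed (use k indep in auto)
  then have "(\<Sum>i\<le>s. cinner (?B (s - i)) (z k i)) = 0"
    using s by simp
  then have "cnj (\<Sum>i\<le>s. cinner (?B (s - i)) (z k i)) = 0"
    by simp
  then have "(\<Sum>i\<le>s. cinner (z k i) (?B (s - i))) = 0"
    unfolding cnj_sum cinner_commute[symmetric] .
  also have "(\<Sum>i\<le>s. cinner (z k i) (?B (s - i))) = (\<Sum>i\<le>s. cinner (z k (s - i)) (?B i))"
    by (rule sum.reindex_bij_witness[of _ "\<lambda>i. s - i" "\<lambda>i. s - i"]) auto
  finally show "(\<Sum>i\<le>s. cinner (z k (s - i)) (?B i)) = 0" .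
qed

text \<open>In terms of the full chain polynomial \<open>\<psi>\<close> below this is \<open>A \<psi> / (\<mu> - c)\<^bsup>p+1\<^esup>\<close>.\<close>

definition image_poly :: "nat \<Rightarrow> complex \<Rightarrow> 'a"
  where "image_poly k = polynomial_part n A (derived_vector c (w k) (p k))"

definition chain_poly :: "nat \<Rightarrow> real \<Rightarrow> 'a"
  where "chain_poly k t = (\<Sum>s\<le>p k. \<delta> t ^ s *\<^sub>C w k s)"

lemma pencil_principal_fun:
  "k < N \<Longrightarrow> \<mu> \<noteq> of_real c \<Longrightarrow> pencil n A \<mu> (principal_fun c (w k) (p k) \<mu>) = image_poly k \<mu>"
  unfolding pencil_def image_poly_def
  by (intro chain_equations_imp_polynomial clinear_A chain)

text \<open>The partial fraction of the chain \<open>w j\<close> is \<open>A(\<mu>)\<inverse>\<close> applied to the polynomial \<open>image_poly j\<close>. Comparison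
  with the principal part of \<open>A(\<mu>)\<inverse>\<close> in the poles of top order yields biorthogonality.\<close>

lemma biorthogonal:
  assumes jk: "j < N" "k < N"
  shows "cinner (image_poly j c) (z k 0) = (if j = k then 1 else 0)"
proof -
  obtain D u where u: "\<And>\<mu>. image_poly j \<mu> = (\<Sum>d\<le>D. (\<mu> - of_real c) ^ d *\<^sub>C u d)"
    using polynomial_at_polynomial_part[of "of_real c" n A] unfolding image_poly_def polynomial_at_def by blast
  define v where "v d = (if d \<le> D then u d else 0)" for d
  have v: "image_poly j \<mu> = (\<Sum>d\<le>D. (\<mu> - of_real c) ^ d *\<^sub>C v d)" for \<mu>
    by (simp add: u v_def)
  have v0: "image_poly j c = v 0"
    unfolding v by (subst sum.remove[of _ 0]) (auto intro!: sum.neutral)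
  define a :: "nat \<Rightarrow> nat \<Rightarrow> complex" where "a i h = (if (i, h) = (j, p j) then 1 else 0)" for i h
  have "(\<Sum>i\<le>p k - p k. cinner (v (p k - p k - i)) (z k i)) = a k (p k)"
  proof (rule coefficients_of_inverse[OF isolated _ principal, where D = D and Y = "\<lambda>_. 0"])
    show "eventually (\<lambda>\<mu>. inv (pencil n A \<mu>) (\<Sum>d\<le>D. (\<mu> - of_real c) ^ d *\<^sub>C v d) =
      (\<Sum>(k, h)\<in>Sigma {..<N} (\<lambda>k. {..p k}). a k h *\<^sub>C principal_fun c (w k) h \<mu>) + 0) (at (of_real c))"
      using invertible_near
    proof eventually_elim
      case (elim \<mu>)
      have "inv (pencil n A \<mu>) (\<Sum>d\<le>D. (\<mu> - of_real c) ^ d *\<^sub>C v d) = principal_fun c (w j) (p j) \<mu>"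
        using elim jk(1) pencil_principal_fun[of j \<mu>, symmetric] by (simp add: bij_is_inj flip: v)
      also have "\<dots> = (\<Sum>(k, h)\<in>Sigma {..<N} (\<lambda>k. {..p k}). a k h *\<^sub>C principal_fun c (w k) h \<mu>)"
        using jk(1) by (subst sum.remove[of _ "(j, p j)"]) (auto simp: a_def intro!: sum.neutral split: if_splits)
      finally show ?case by simp
    qed
    show "negligible_at (of_real c) (\<lambda>_. 0)"
      by (rule negligible_at_tendsto[OF tendsto_const])
  qed (use jk indep in \<open>auto simp: v_def\<close>)
  then show ?thesis
    by (auto simp: v0 a_def)
qed

subsection \<open>Estimates on the real axis\<close>

lemma chain_poly_tendsto: "(chain_poly k \<longlongrightarrow> w k 0) (at c)"
proof -
  have "(chain_poly k \<longlongrightarrow> (\<Sum>s\<le>p k. (of_real c - of_real c) ^ s *\<^sub>C w k s)) (at c)"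
    unfolding chain_poly_def[abs_def] by (intro tendsto_intros)
  also have "(\<Sum>s\<le>p k. (of_real c - of_real c) ^ s *\<^sub>C w k s) = w k 0"
    by (subst sum.remove[of _ 0]) (auto intro!: sum.neutral)
  finally show ?thesis .
qed

lemma chain_poly_first_order: "vanishes_to 1 c (\<lambda>t. chain_poly k t - w k 0)"
proof -
  define f where "f \<mu> = (\<Sum>s\<le>p k. (\<mu> - of_real c) ^ s *\<^sub>C w k s)" for \<mu>
  have "polynomial_at (of_real c) f"
    unfolding polynomial_at_def f_def by blast
  from polynomial_at_first_order[OF this]
  have "vanishes_to 1 c (\<lambda>t. f (of_real t) - f (of_real c))" .
  moreover have "f (of_real c) = w k 0"
    unfolding f_def by (subst sum.remove[of _ 0]) (auto intro!: sum.neutral)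
  moreover have "f (of_real t) = chain_poly k t" for t
    by (simp add: f_def chain_poly_def)
  ultimately show ?thesis
    by simp
qed

lemma chain_poly_eq:
  assumes "t \<noteq> c"
  shows "chain_poly k t = \<delta> t ^ Suc (p k) *\<^sub>C principal_fun c (w k) (p k) (of_real t)"
proof -
  have nz: "complex_of_real t - of_real c \<noteq> 0"
    using assms by simp
  have "\<delta> t ^ Suc (p k) *\<^sub>C principal_fun c (w k) (p k) (of_real t) =
    (\<Sum>r\<le>p k. \<delta> t ^ (p k - r) *\<^sub>C w k (p k - r))"
    unfolding principal_fun_def scaleC_sum_right scaleC_scaleC
  proof (rule sum.cong[OF refl])
    fix r assume "r \<in> {..p k}"
    then have "\<delta> t ^ Suc (p k) * (1 / \<delta> t ^ (r + 1)) =
      (of_real t - complex_of_real c) ^ (p k - r)"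
      using power_diff[OF nz, of "r + 1" "Suc (p k)"] by simp
    then show "(\<delta> t ^ Suc (p k) * (1 / \<delta> t ^ (r + 1))) *\<^sub>C w k (p k - r) =
      \<delta> t ^ (p k - r) *\<^sub>C w k (p k - r)"
      by simp
  qed
  also have "\<dots> = chain_poly k t"
    unfolding chain_poly_def
    by (rule sum.reindex_bij_witness[of _ "\<lambda>r. p k - r" "\<lambda>r. p k - r"]) auto
  finally show ?thesis ..
qed

lemma pencil_chain_poly:
  assumes "k < N" "t \<noteq> c"
  shows "pencil n A (of_real t) (chain_poly k t) = \<delta> t ^ Suc (p k) *\<^sub>C image_poly k (of_real t)"
  using assms by (simp only: chain_poly_eq clinear_map_scaleC[OF clinear_pencil] pencil_principal_fun of_real_eq_iff
      not_False_eq_True)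

lemma image_poly_tendsto: "((\<lambda>t. image_poly k (of_real t)) \<longlongrightarrow> image_poly k c) (at c)"
  unfolding image_poly_def by (rule polynomial_at_tendsto_real[OF polynomial_at_polynomial_part])

lemma chain_poly_order_0: "vanishes_to 0 c (chain_poly k)"
  by (rule vanishes_to_tendsto[OF chain_poly_tendsto])

lemma pencil_chain_poly_order:
  assumes "k < N"
  shows "vanishes_to (Suc (p k)) c (\<lambda>t. pencil n A (of_real t) (chain_poly k t))"
proof -
  have "vanishes_to (Suc (p k) + 0) c (\<lambda>t. \<delta> t ^ Suc (p k) *\<^sub>C image_poly k (of_real t))"
    by (intro vanishes_to_power_scaleC vanishes_to_tendsto[OF image_poly_tendsto])
  then have "vanishes_to (Suc (p k)) c (\<lambda>t. \<delta> t ^ Suc (p k) *\<^sub>C image_poly k (of_real t))"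
    by simp
  then show ?thesis
    by (rule vanishes_to_cong)
      (use eventually_neq_at_within[of c c] in eventually_elim, simp add: pencil_chain_poly[OF assms])
qed

text \<open>
  The energy of the chain is \<open>O((t - c)\<^bsup>p+1\<^esup>)\<close> because of the chain equations. Since it is non-negative
  on both sides of \<open>c\<close>, its order is even, which gains one power if \<open>p\<close> is even.
\<close>

lemma energy_chain_poly_order:
  assumes k: "k < N"
  shows "vanishes_to (2 * (p k div 2 + 1)) c (\<lambda>t. energy t (chain_poly k t) (chain_poly k t))"
proof -
  define g where "g t = - Im (cinner (image_poly k (of_real t)) (chain_poly k t))" for t
  have energy_eq: "energy t (chain_poly k t) (chain_poly k t) =
    \<delta> t ^ Suc (p k) *\<^sub>C complex_of_real (g t)" if "t \<noteq> c" for t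
  proof -
    have "Im (\<delta> t ^ Suc (p k) * x) = (t - c) ^ Suc (p k) * Im x" for x
      by (simp only: of_real_diff[symmetric] of_real_power[symmetric] Im_complex_of_real
          Re_complex_of_real times_complex.sel mult_zero_left add_0_right)
    then show ?thesis
      unfolding energy_self pencil_chain_poly[OF k that] cinner_scaleC_left
      by (simp add: g_def scaleC_complex_def del: power_Suc)
  qed
  have near: "eventually (\<lambda>t. \<delta> t ^ Suc (p k) *\<^sub>C complex_of_real (g t) =
      energy t (chain_poly k t) (chain_poly k t)) (at c)"
    using eventually_neq_at_within[of c c] by eventually_elim (simp only: energy_eq not_False_eq_True)
  have g_lim: "(g \<longlongrightarrow> - Im (cinner (image_poly k c) (w k 0))) (at c)"
    unfolding g_def[abs_def] by (intro tendsto_intros image_poly_tendsto chain_poly_tendsto)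
  show ?thesis
  proof (cases "even (p k)")
    case False
    have "vanishes_to (Suc (p k) + 0) c (\<lambda>t. \<delta> t ^ Suc (p k) *\<^sub>C complex_of_real (g t))"
      by (intro vanishes_to_power_scaleC vanishes_to_tendsto[OF tendsto_of_real[OF g_lim]])
    from vanishes_to_cong[OF this near] show ?thesis
      by (rule vanishes_to_mono) (use False in presburger)
  next
    case True
    have sgn: "0 \<le> (t - c) ^ Suc (p k) * g t" if "t \<noteq> c" for t
    proof -
      have "energy t (chain_poly k t) (chain_poly k t) = of_real ((t - c) ^ Suc (p k) * g t)"
        using energy_eq[OF that] by (simp only: scaleC_complex_def of_real_mult of_real_power of_real_diff)
      then show ?thesis
        using energy_nonneg[of t "chain_poly k t"] by (simp only: Re_complex_of_real)
    qed
    have "0 \<le> - Im (cinner (image_poly k c) (w k 0))"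
    proof (rule tendsto_lowerbound)
      show "(g \<longlongrightarrow> - Im (cinner (image_poly k c) (w k 0))) (at_right c)"
        using g_lim by (rule tendsto_within_subset) auto
      show "eventually (\<lambda>t. 0 \<le> g t) (at_right c)"
        using eventually_at_right_less[of c]
      proof eventually_elim
        case (elim t)
        then have "0 < (t - c) ^ Suc (p k)"
          by (simp del: power_Suc)
        from mult_le_cancel_left_pos[OF this, of 0 "g t"] show ?case
          using sgn[of t] elim by simp
      qed
    qed simp
    moreover have "- Im (cinner (image_poly k c) (w k 0)) \<le> 0"
    proof (rule tendsto_upperbound)
      show "(g \<longlongrightarrow> - Im (cinner (image_poly k c) (w k 0))) (at_left c)"
        using g_lim by (rule tendsto_within_subset) auto
      have "eventually (\<lambda>t. t < c) (at_left c)"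
        by (simp add: eventually_at_filter)
      then show "eventually (\<lambda>t. g t \<le> 0) (at_left c)"
      proof eventually_elim
        case (elim t)
        then have "(t - c) ^ Suc (p k) < 0"
          using True by (simp add: power_less_zero_eq del: power_Suc)
        from mult_le_cancel_left_neg[OF this, of 0 "g t"] show ?case
          using sgn[of t] elim by simp
      qed
    qed simp
    ultimately have g0: "Im (cinner (image_poly k c) (w k 0)) = 0"
      by linarith
    have "vanishes_to 1 c (\<lambda>t. complex_of_real (g t))"
    proof -
      have im1: "vanishes_to 1 c (\<lambda>t. image_poly k (of_real t) - image_poly k c)"
        unfolding image_poly_def by (rule polynomial_at_first_order[OF polynomial_at_polynomial_part])
      have "vanishes_to (1 + 0) c (\<lambda>t. cinner (image_poly k (of_real t) - image_poly k c) (chain_poly k t))"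
        by (rule vanishes_to_cinner[OF im1 chain_poly_order_0])
      moreover have "vanishes_to (0 + 1) c (\<lambda>t. cinner (image_poly k c) (chain_poly k t - w k 0))"
        by (rule vanishes_to_cinner[OF vanishes_to_tendsto[OF tendsto_const] chain_poly_first_order])
      ultimately have "vanishes_to 1 c (\<lambda>t. cinner (image_poly k (of_real t) - image_poly k c) (chain_poly k t)
        + cinner (image_poly k c) (chain_poly k t - w k 0))"
        by (intro vanishes_to_add) simp_all
      then have "vanishes_to 1 c (\<lambda>t. cinner (image_poly k (of_real t)) (chain_poly k t) -
        cinner (image_poly k c) (w k 0))"
        by (simp add: cinner_diff_left cinner_diff_right)
      then show ?thesis
      proof (rule vanishes_to_bound[where C = 1], intro always_eventually allI)
        fix t
        show "norm (complex_of_real (g t)) \<le> 1 * norm (cinner (image_poly k (of_real t)) (chain_poly k t) -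
          cinner (image_poly k c) (w k 0))"
          using abs_Im_le_cmod[of "cinner (image_poly k (of_real t)) (chain_poly k t) -
            cinner (image_poly k c) (w k 0)"]
          by (simp add: g_def g0)
      qed
    qed
    then have "vanishes_to (Suc (p k) + 1) c (\<lambda>t. \<delta> t ^ Suc (p k) *\<^sub>C complex_of_real (g t))"
      by (rule vanishes_to_power_scaleC)
    from vanishes_to_cong[OF this near] show ?thesis
      by (rule vanishes_to_mono) (use True in presburger)
  qed
qed

lemma form_chain_poly_order:
  assumes j: "j < N" and f: "vanishes_to 0 c f"
  shows "vanishes_to (Suc (p j)) c (\<lambda>t. form t (chain_poly j t) (f t))"
  using vanishes_to_cinner[OF pencil_chain_poly_order[OF j] f] by simp

lemma energy_order_0:
  assumes "vanishes_to 0 c f"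
  shows "vanishes_to (2 * 0) c (\<lambda>t. energy t (f t) (f t))"
proof -
  have "vanishes_to (0 + 0) c (\<lambda>t. form t (f t) (f t))"
    by (intro vanishes_to_cinner vanishes_to_pencil assms)
  then have "vanishes_to 0 c (\<lambda>t. form t (f t) (f t))"
    by simp
  then have "vanishes_to 0 c (\<lambda>t. energy t (f t) (f t))"
    by (rule vanishes_to_bound[where C = 1]) (simp add: energy_self abs_Im_le_cmod)
  then show ?thesis by simp
qed

text \<open>Exchanging the arguments of the form costs an energy term.\<close>

lemma vanishes_to_form_swap:
  assumes "vanishes_to m c (\<lambda>t. form t (g t) (f t))"
    and "vanishes_to m c (\<lambda>t. energy t (f t) (g t))"
  shows "vanishes_to m c (\<lambda>t. form t (f t) (g t))"
proof -
  have "vanishes_to m c (\<lambda>t. cnj (form t (g t) (f t)))"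
    by (rule vanishes_to_bound[where C = 1, OF assms(1)]) simp
  moreover have "vanishes_to m c (\<lambda>t. 2 * \<i> * energy t (f t) (g t))"
    by (rule vanishes_to_bound[where C = 2, OF assms(2)]) (simp add: norm_mult)
  ultimately have "vanishes_to m c (\<lambda>t. cnj (form t (g t) (f t)) - 2 * \<i> * energy t (f t) (g t))"
    by (rule vanishes_to_diff)
  then show ?thesis
    by (simp only: pencil_form_swap[symmetric])
qed

text \<open>With the chain polynomial as second argument no chain equation applies. The energy of the chain
  is small, however, and by Cauchy--Schwarz so is the price for moving it to the first argument.\<close>

lemma form_chain_poly_right_order:
  assumes k: "k < N" and f: "vanishes_to 0 c f"
  shows "vanishes_to (p k div 2 + 1) c (\<lambda>t. form t (f t) (chain_poly k t))"
proof (rule vanishes_to_form_swap)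
  show "vanishes_to (p k div 2 + 1) c (\<lambda>t. form t (chain_poly k t) (f t))"
    by (rule vanishes_to_mono[OF form_chain_poly_order[OF k f]]) simp
  show "vanishes_to (p k div 2 + 1) c (\<lambda>t. energy t (f t) (chain_poly k t))"
    using vanishes_to_energy[OF energy_order_0[OF f] energy_chain_poly_order[OF k]] by simp
qed

lemma form_chain_polys_order:
  assumes jk: "j < N" "k < N"
    and m: "m \<le> Suc (p j) \<or> m \<le> Suc (p k) \<and> m \<le> (p j div 2 + 1) + (p k div 2 + 1)"
  shows "vanishes_to m c (\<lambda>t. form t (chain_poly j t) (chain_poly k t))"
  using m
proof
  assume "m \<le> Suc (p j)"
  then show ?thesis
    by (rule vanishes_to_mono[OF form_chain_poly_order[OF jk(1) chain_poly_order_0]])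
next
  assume m: "m \<le> Suc (p k) \<and> m \<le> (p j div 2 + 1) + (p k div 2 + 1)"
  show ?thesis
  proof (rule vanishes_to_form_swap)
    show "vanishes_to m c (\<lambda>t. form t (chain_poly k t) (chain_poly j t))"
      using m by (intro vanishes_to_mono[OF form_chain_poly_order[OF jk(2) chain_poly_order_0]]) simp
    show "vanishes_to m c (\<lambda>t. energy t (chain_poly j t) (chain_poly k t))"
      using m by (intro vanishes_to_mono[OF
          vanishes_to_energy[OF energy_chain_poly_order[OF jk(1)] energy_chain_poly_order[OF jk(2)]]]) simp
  qed
qed

lemma form_quotient_tendsto:
  assumes j: "j < N"
  shows "((\<lambda>t. (1 / \<delta> t ^ Suc (p j)) *\<^sub>C
    form t (chain_poly j t) (chain_poly k t)) \<longlongrightarrow>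
    cinner (image_poly j c) (w k 0)) (at c)"
proof (rule Lim_transform_eventually)
  show "((\<lambda>t. cinner (image_poly j (of_real t)) (chain_poly k t)) \<longlongrightarrow> cinner (image_poly j c) (w k 0)) (at c)"
    by (intro tendsto_intros image_poly_tendsto chain_poly_tendsto)
  show "eventually (\<lambda>t. cinner (image_poly j (of_real t)) (chain_poly k t) =
    (1 / \<delta> t ^ Suc (p j)) *\<^sub>C
    form t (chain_poly j t) (chain_poly k t)) (at c)"
    using eventually_neq_at_within[of c c]
    by eventually_elim (simp add: pencil_chain_poly[OF j] cinner_scaleC_left scaleC_complex_def del: power_Suc)
qed

text \<open>The form of the two chain polynomials vanishes to an order above \<open>p j + 1\<close>, whereas its coefficient
  of that order is the inner product in question.\<close>

lemma longer_chain_orthogonal: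
  assumes jk: "j < N" "k < N" and "even (p j)" "p j < p k"
  shows "cinner (image_poly j c) (w k 0) = 0"
proof -
  have "Suc (Suc (p j)) \<le> (p j div 2 + 1) + (p k div 2 + 1)"
    using assms(3,4) by presburger
  then have "vanishes_to (Suc (Suc (p j))) c
    (\<lambda>t. form t (chain_poly j t) (chain_poly k t))"
    using assms(4) by (intro form_chain_polys_order jk) auto
  from tendsto_unique[OF _ form_quotient_tendsto[OF jk(1)] vanishes_to_imp_tendsto[OF this]]
  show ?thesis
    by simp
qed

text \<open>For fixed \<open>x\<close> the polynomial \<open>cinner (chain_poly k t) (pencil n A (of_real t) x)\<close> vanishes at \<open>c\<close> to the order
  \<open>p k div 2 + 1\<close>, and its lower coefficients are the left-hand sides of the adjoint chain equations.\<close>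

lemma adjoint_chain_w:
  assumes k: "k < N"
  shows "adjoint_chain n A c (p k div 2) (w k)"
  unfolding adjoint_chain_iff
proof (intro allI impI)
  fix x s assume s: "s \<le> p k div 2"
  let ?B = "\<lambda>d. taylor_coeff n A c d x"
  \<comment> \<open>The chain is padded by zeros so that the product of the two polynomials can be summed by degree.\<close>
  define v where "v i = (if i \<le> p k then w k i else 0)" for i
  define e where "e s = (\<Sum>i\<le>s. cinner (v (s - i)) (?B i))" for s
  have B0: "?B d = 0" if "n < d" for d
    using that by (simp add: taylor_coeff_def binomial_eq_0)
  have "vanishes_to (p k div 2 + 1) c (\<lambda>t. cinner (chain_poly k t) (pencil n A (of_real t) x))"
    using form_chain_poly_right_order[OF k vanishes_to_tendsto[OF tendsto_const[of x]]]
    by (rule vanishes_to_bound[where C = 1])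
      (auto intro!: always_eventually simp: cinner_commute[of "chain_poly k _"])
  moreover have "cinner (chain_poly k t) (pencil n A (of_real t) x) =
    (\<Sum>d\<le>p k + n. \<delta> t ^ d *\<^sub>C e d)" for t
  proof -
    have left: "cinner (chain_poly k t) y = (\<Sum>a\<le>p k. \<delta> t ^ a * cinner (w k a) y)" for y
      by (simp add: chain_poly_def cinner_sum_left cinner_scaleC_left)
    have right: "cinner y (pencil n A (of_real t) x) = (\<Sum>i\<le>n. \<delta> t ^ i * cinner y (?B i))" for y
      by (simp add: pencil_taylor[of n A "of_real t" x "of_real c"] cinner_sum_right cinner_scaleC_right)
    have "cinner (chain_poly k t) (pencil n A (of_real t) x) =
      (\<Sum>a\<le>p k. \<Sum>i\<le>n. \<delta> t ^ (a + i) * cinner (w k a) (?B i))"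
      unfolding left unfolding right by (simp add: power_add sum_distrib_left mult.assoc)
    also have "\<dots> = (\<Sum>(a, i)\<in>{..p k} \<times> {..n}. \<delta> t ^ (a + i) * cinner (w k a) (?B i))"
      by (simp add: sum.cartesian_product)
    also have "\<dots> = (\<Sum>(a, i)\<in>{(a, i). a + i \<le> p k + n}. \<delta> t ^ (a + i) * cinner (v a) (?B i))"
      by (rule sum.mono_neutral_cong_left)
        (auto simp: v_def intro: finite_subset[of _ "{..p k + n} \<times> {..p k + n}"] split: if_splits,
          metis B0 cinner_zero_right not_le)
    also have "\<dots> = (\<Sum>(d, i)\<in>Sigma {..p k + n} (\<lambda>d. {..d}). \<delta> t ^ d * cinner (v (d - i)) (?B i))"
      by (rule sum.reindex_bij_witness[of _ "\<lambda>(d, i). (d - i, i)" "\<lambda>(a, i). (a + i, i)"]) auto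
    also have "\<dots> = (\<Sum>d\<le>p k + n. \<delta> t ^ d *\<^sub>C e d)"
      by (simp add: sum.Sigma[symmetric] e_def scaleC_complex_def sum_distrib_left)
    finally show ?thesis .
  qed
  ultimately have "vanishes_to (p k div 2 + 1) c (\<lambda>t. \<Sum>d\<le>p k + n. \<delta> t ^ d *\<^sub>C e d)"
    by simp
  then have "e s = 0"
    by (rule vanishes_to_polynomial) (use s in auto)
  moreover have "s - i \<le> p k" for i
    using s by presburger
  ultimately show "(\<Sum>i\<le>s. cinner (w k (s - i)) (?B i)) = 0"
    by (simp add: e_def v_def)
qed

subsection \<open>Sign characteristics and residues\<close>

text \<open>
  Regularity is a relation between derived chains of length \<open>n\<close>. All chains in it are adjoint
  chains, hence it lifts to their partial fractions, and the poles of top order give a relation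
  between eigenvectors. A vector with the index of the middle of the \<open>k\<close>-th chain that precedes the
  middle of its own chain belongs to a longer chain.
\<close>

lemma eigenvector_relation:
  assumes k: "k < N" "even (p k)"
  obtains J \<beta> where "finite J" "\<forall>(i, h)\<in>J. i < N \<and> (h = p k div 2 \<longrightarrow> p k < p i)"
    "z k 0 = of_int (eps k) *\<^sub>C w k 0 + (\<Sum>(i, h)\<in>J. if h = p k div 2 then \<beta> i h *\<^sub>C w i 0 else 0)"
proof -
  define m where "m = p k div 2"
  define J where "J = {(i, h). i < N \<and> int h \<le> (int (p i) - 1) div 2}"
  have J_sub: "J \<subseteq> Sigma {..<N} (\<lambda>i. {..p i})"
    by (auto simp: J_def)
  have J: "finite J" "J \<subseteq> {..<N} \<times> UNIV"
    by (rule finite_subset[OF J_sub]) (auto simp: J_def)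
  have half: "h \<le> p i div 2" if "(i, h) \<in> J" for i h
    using that by (auto simp: J_def)
  have "{derived_chain n c (w j) h | j h. j < N \<and> int h \<le> (int (p j) - 1) div 2} =
    (\<lambda>(i, h). derived_chain n c (w i) h) ` J"
    by (auto simp: J_def)
  then have "derived_chain n c (z k) m - of_int (eps k) *\<^sub>C derived_chain n c (w k) m
    \<in> cspan ((\<lambda>(i, h). derived_chain n c (w i) h) ` J)"
    using regular[OF k] by (simp add: m_def)
  from cspan_image_finite[OF J(1) this] obtain \<beta> where
    \<beta>: "derived_chain n c (z k) m - of_int (eps k) *\<^sub>C derived_chain n c (w k) m =
      (\<Sum>q\<in>J. \<beta> q *\<^sub>C (\<lambda>(i, h). derived_chain n c (w i) h) q)"
    by blast
  \<comment> \<open>The members of the linear combination: the chains in \<open>J\<close>, then \<open>z k\<close> and \<open>w k\<close>.\<close>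
  define v where "v q = (case q of Inl (i, h) \<Rightarrow> w i | Inr b \<Rightarrow> if b then z k else w k)" for q :: "nat \<times> nat + bool"
  define l where "l q = (case q of Inl (i, h) \<Rightarrow> h | Inr b \<Rightarrow> m)" for q :: "nat \<times> nat + bool"
  define a where "a q = (case q of Inl q \<Rightarrow> - \<beta> q | Inr b \<Rightarrow> if b then 1 else - of_int (eps k))" for q :: "nat \<times> nat + bool"
  have sum_split: "(\<Sum>q\<in>J <+> UNIV. a q *\<^sub>C f (v q) (l q)) =
    (\<Sum>(i, h)\<in>J. - \<beta> (i, h) *\<^sub>C f (w i) h) + (f (z k) m - of_int (eps k) *\<^sub>C f (w k) m)"
    for f :: "(nat \<Rightarrow> 'a) \<Rightarrow> nat \<Rightarrow> 'a"
    using J(1) by (simp add: sum.Plus UNIV_bool v_def l_def a_def case_prod_unfold)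
  have adj: "adjoint_chain n A c (l q) (v q)" if "q \<in> J <+> UNIV" for q
  proof (cases q)
    case (Inl r)
    then show ?thesis
      using that J(2) adjoint_chain_mono[OF adjoint_chain_w half]
      by (auto simp: v_def l_def)
  next
    case (Inr b)
    then show ?thesis
      using adjoint_chain_w[OF k(1)] adjoint_chain_mono[OF adjoint_chain_z[OF k(1)], of m]
      by (simp add: v_def l_def m_def)
  qed
  have derived: "(\<Sum>q\<in>J <+> UNIV. a q *\<^sub>C derived_vector c (v q) (l q) i) = 0" if "i < n" for i
  proof -
    have "derived_vector c (z k) m i - of_int (eps k) *\<^sub>C derived_vector c (w k) m i =
      (\<Sum>(j, h)\<in>J. \<beta> (j, h) *\<^sub>C derived_vector c (w j) h i)"
      using fun_cong[OF \<beta>, of i] that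
      by (simp add: derived_chain_eq sum_fun_apply scaleC_fun_def case_prod_unfold)
    then show ?thesis
      unfolding sum_split[of "\<lambda>x y. derived_vector c x y i"]
      by (simp add: case_prod_unfold sum_negf)
  qed
  have "filterlim cnj (at (complex_of_real c)) (at (of_real c))"
    using filterlim_cnj_at[of "of_real c"] by simp
  from filterlim_iff[THEN iffD1, OF this, rule_format, OF invertible_near]
  have "eventually (\<lambda>\<mu>. (\<Sum>(i, h)\<in>J. - \<beta> (i, h) *\<^sub>C principal_fun c (w i) h \<mu>) +
    (principal_fun c (z k) m \<mu> - of_int (eps k) *\<^sub>C principal_fun c (w k) m \<mu>) = 0)
    (at (of_real c))"
  proof eventually_elim
    case (elim \<mu>)
    then have "(\<Sum>q\<in>J <+> UNIV. a q *\<^sub>C principal_fun c (v q) (l q) \<mu>) = 0"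
      by (intro adjoint_chains_cancel[where n = n and A = A] adj derived) (auto simp: bij_is_surj)
    then show ?case
      unfolding sum_split[of "\<lambda>x y. principal_fun c x y \<mu>"] .
  qed
  moreover have "((\<lambda>\<mu>. (\<mu> - of_real c) ^ (m + 1) *\<^sub>C
    (principal_fun c (z k) m \<mu> - of_int (eps k) *\<^sub>C principal_fun c (w k) m \<mu>)) \<longlongrightarrow>
    z k 0 - of_int (eps k) *\<^sub>C w k 0) (at (of_real c))"
  proof -
    have lim: "((\<lambda>\<mu>. (\<mu> - of_real c) ^ (m + 1) *\<^sub>C principal_fun c x m \<mu>) \<longlongrightarrow> x 0) (at (of_real c))"
      for x :: "nat \<Rightarrow> 'a"
      using principal_fun_scaled_limit[of m m "of_real c" x] by simp
    have "((\<lambda>\<mu>. (\<mu> - of_real c) ^ (m + 1) *\<^sub>C principal_fun c (z k) m \<mu> -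
      of_int (eps k) *\<^sub>C (\<mu> - of_real c) ^ (m + 1) *\<^sub>C principal_fun c (w k) m \<mu>) \<longlongrightarrow>
      z k 0 - of_int (eps k) *\<^sub>C w k 0) (at (of_real c))"
      by (intro tendsto_diff tendsto_scaleC[OF tendsto_const] lim)
    then show ?thesis
      by (simp add: complex_vector.scale_right_diff_distrib scaleC_scaleC mult_ac)
  qed
  ultimately have rel: "(\<Sum>(i, h)\<in>J. if h = m then - \<beta> (i, h) *\<^sub>C w i 0 else 0) +
    (z k 0 - of_int (eps k) *\<^sub>C w k 0) = 0"
    by (rule leading_coefficients(2)[where w = w and N = N and a = "\<lambda>i h. - \<beta> (i, h)", OF indep J])
  show ?thesis
  proof (rule that[OF J(1), of "\<lambda>i h. \<beta> (i, h)"])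
    have "i < N \<and> (h = p k div 2 \<longrightarrow> p k < p i)" if "(i, h) \<in> J" for i h
    proof -
      have "i < N" "int h \<le> (int (p i) - 1) div 2"
        using that by (auto simp: J_def)
      then show ?thesis
        using k(2) by presburger
    qed
    then show "\<forall>(i, h)\<in>J. i < N \<and> (h = p k div 2 \<longrightarrow> p k < p i)"
      by blast
    have "(\<Sum>(i, h)\<in>J. if h = m then - \<beta> (i, h) *\<^sub>C w i 0 else 0) =
      - (\<Sum>(i, h)\<in>J. if h = m then \<beta> (i, h) *\<^sub>C w i 0 else 0)"
      unfolding sum_negf[symmetric] by (intro sum.cong) auto
    with rel show "z k 0 = of_int (eps k) *\<^sub>C w k 0 +
      (\<Sum>(i, h)\<in>J. if h = p k div 2 then \<beta> (i, h) *\<^sub>C w i 0 else 0)"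
      by (simp add: m_def algebra_simps)
  qed
qed

text \<open>Pairing the eigenvector relation with \<open>image_poly j c\<close> removes the longer chains, and biorthogonality
  evaluates the other side.\<close>

lemma sign_characteristic:
  assumes jk: "j < N" "k < N" and p: "p j = p k" "even (p k)"
  shows "cinner (image_poly j c) (w k 0) = (if j = k then of_int (eps k) else 0)"
proof -
  obtain J \<beta> where J: "finite J" "\<forall>(i, h)\<in>J. i < N \<and> (h = p k div 2 \<longrightarrow> p k < p i)"
    and z: "z k 0 = of_int (eps k) *\<^sub>C w k 0 + (\<Sum>(i, h)\<in>J. if h = p k div 2 then \<beta> i h *\<^sub>C w i 0 else 0)"
    using eigenvector_relation[OF jk(2) p(2)] .
  let ?y = "image_poly j c"
  have "cinner ?y (case q of (i, h) \<Rightarrow> if h = p k div 2 then \<beta> i h *\<^sub>C w i 0 else 0) = 0" if "q \<in> J" for q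
    using that J(2) longer_chain_orthogonal[OF jk(1)] p by (auto simp: cinner_scaleC_right split: prod.splits)
  then have "cinner ?y (z k 0) = of_int (eps k) * cinner ?y (w k 0)"
    unfolding z cinner_add_right cinner_sum_right by (simp add: cinner_scaleC_right)
  then have "of_int (eps k) * cinner ?y (w k 0) = (if j = k then 1 else 0)"
    using biorthogonal[OF jk] by simp
  moreover have "eps k = 1 \<or> eps k = -1"
    using regular[OF jk(2) p(2)] by simp
  ultimately show ?thesis
    by (auto simp: minus_equation_iff)
qed

lemma principal_fun_chain_poly:
  assumes h: "h \<le> p k"
  shows "vanishes_to 0 c (\<lambda>t. principal_fun c (w k) h (of_real t) -
    (1 / \<delta> t ^ (h + 1)) *\<^sub>C chain_poly k t)"
proof -
  define g where "g t = - (\<Sum>s\<in>{h<..p k}. \<delta> t ^ (s - (h + 1)) *\<^sub>C w k s)" for t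
  have "vanishes_to 0 c g"
    unfolding g_def by (intro vanishes_to_minus vanishes_to_tendsto[where
        x = "\<Sum>s\<in>{h<..p k}. (of_real c - of_real c) ^ (s - (h + 1)) *\<^sub>C w k s"] tendsto_intros)
  moreover have "eventually (\<lambda>t. g t = principal_fun c (w k) h (of_real t) -
    (1 / \<delta> t ^ (h + 1)) *\<^sub>C chain_poly k t) (at c)"
    using eventually_neq_at_within[of c c]
  proof eventually_elim
    case (elim t)
    then have nz: "complex_of_real t - of_real c \<noteq> 0"
      by simp
    define e where "e = complex_of_real t - of_real c"
    have e: "e \<noteq> 0"
      using nz by (simp add: e_def)
    have "{..p k} = {..h} \<union> {h<..p k}" "{..h} \<inter> {h<..p k} = {}"
      using h by auto
    then have "(1 / e ^ (h + 1)) *\<^sub>C chain_poly k t =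
      (\<Sum>s\<le>h. (1 / e ^ (h + 1) * e ^ s) *\<^sub>C w k s) + (\<Sum>s\<in>{h<..p k}. (1 / e ^ (h + 1) * e ^ s) *\<^sub>C w k s)"
      unfolding chain_poly_def e_def[symmetric] scaleC_sum_right scaleC_scaleC
      by (simp add: sum.union_disjoint)
    also have "(\<Sum>s\<in>{h<..p k}. (1 / e ^ (h + 1) * e ^ s) *\<^sub>C w k s) = - g t"
    proof -
      have "1 / e ^ (h + 1) * e ^ s = e ^ (s - (h + 1))" if "s \<in> {h<..p k}" for s
        using that e power_diff[OF e, of "h + 1" s] by simp
      then show ?thesis
        by (simp add: g_def e_def)
    qed
    also have "(\<Sum>s\<le>h. (1 / e ^ (h + 1) * e ^ s) *\<^sub>C w k s) = principal_fun c (w k) h (of_real t)"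
    proof -
      have "1 / e ^ (h + 1) * e ^ s = 1 / e ^ (h - s + 1)" if "s \<le> h" for s
      proof -
        have "e ^ (h + 1) = e ^ (h - s + 1) * e ^ s"
          using that by (simp flip: power_add)
        then show ?thesis
          using e by simp
      qed
      then show ?thesis
        unfolding principal_fun_def e_def[symmetric]
        by (intro sum.reindex_bij_witness[of _ "\<lambda>r. h - r" "\<lambda>s. h - s"]) auto
    qed
    finally show ?case
      by (simp add: e_def)
  qed
  ultimately show ?thesis
    by (rule vanishes_to_cong)
qed

text \<open>
  Unless both vectors are the middles of chains of equal length, \<open>h + g + 1\<close> does not exceed the larger
  one of \<open>p j\<close> and \<open>p k\<close>, and the form vanishes to a higher order. In the remaining case the limit is
  the coefficient that the sign characteristic determines.
\<close>

lemma form_pair_limit: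
  assumes jk: "j < N" "k < N" and hg: "h \<le> p j div 2" "g \<le> p k div 2"
  shows "((\<lambda>t. (1 / \<delta> t ^ (h + g + 1)) *\<^sub>C form t (chain_poly j t) (chain_poly k t)) \<longlongrightarrow>
    (if j = k \<and> h = g \<and> p k = 2 * h then of_int (eps k) else 0)) (at c)"
proof (cases "p j = p k \<and> p j = 2 * h \<and> p k = 2 * g")
  case True
  then have deg: "h + g + 1 = Suc (p j)" "p j = p k" "even (p k)"
    and cond: "(j = k \<and> h = g \<and> p k = 2 * h) = (j = k)"
    by auto
  show ?thesis
    using form_quotient_tendsto[OF jk(1), of k]
    unfolding deg(1) cond sign_characteristic[OF jk deg(2,3)] .
next
  case False
  have "2 * h \<le> p j" "2 * g \<le> p k"
    using hg by linarith+
  with False have "h + g + 1 \<le> p j \<or> h + g + 1 \<le> p k"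
    by linarith
  then have "vanishes_to (Suc (h + g + 1)) c (\<lambda>t. form t (chain_poly j t) (chain_poly k t))"
    using hg by (intro form_chain_polys_order jk) linarith
  moreover have "\<not> (j = k \<and> h = g \<and> p k = 2 * h)"
    using False by auto
  ultimately show ?thesis
    by (simp only: if_False vanishes_to_imp_tendsto)
qed

text \<open>
  Up to bounded terms the partial fractions are multiples of the full chain polynomials, whose
  forms have been estimated. Pairs with a bounded function \<open>Y\<close> do not contribute, since a first half
  is short enough for the estimates with one chain polynomial.
\<close>

lemma form_residue:
  assumes J: "finite J" "\<And>k h. (k, h) \<in> J \<Longrightarrow> k < N \<and> h \<le> p k div 2"
    and X: "vanishes_to 0 c X"
    and V: "\<And>t. t \<noteq> c \<Longrightarrow> V t = (\<Sum>(k, h)\<in>J. a k h *\<^sub>C principal_fun c (w k) h (of_real t)) + X t"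
  shows "((\<lambda>t. \<delta> t * form t (V t) (V t)) \<longlongrightarrow>
    (\<Sum>(k, h)\<in>J. if p k = 2 * h then of_int (eps k) * of_real ((cmod (a k h))\<^sup>2) else 0)) (at c)"
proof -
  define U where "U = (\<lambda>(k, h) t. (a k h / \<delta> t ^ (h + 1)) *\<^sub>C chain_poly k t)"
  define Y where "Y t = X t + (\<Sum>(k, h)\<in>J. a k h *\<^sub>C (principal_fun c (w k) h (of_real t) -
    (1 / \<delta> t ^ (h + 1)) *\<^sub>C chain_poly k t))" for t
  define Q where "Q t x y = \<delta> t * form t x y" for t x y
  define L where "L = (\<lambda>(j, h) (k, g). a j h * cnj (a k g) *
    (if j = k \<and> h = g \<and> p k = 2 * h then of_int (eps k) else 0))"
  have Q_add_left: "Q t (x + y) v = Q t x v + Q t y v"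
    and Q_add_right: "Q t v (x + y) = Q t v x + Q t v y" for t x y v
    by (simp_all add: Q_def clinear_map_add[OF clinear_pencil] cinner_add_left cinner_add_right distrib_left)
  have Q_sum_left: "Q t (\<Sum>q\<in>J. f q) v = (\<Sum>q\<in>J. Q t (f q) v)"
    and Q_sum_right: "Q t v (\<Sum>q\<in>J. f q) = (\<Sum>q\<in>J. Q t v (f q))" for t f v
    by (simp_all add: Q_def clinear_map_sum[OF clinear_pencil] cinner_sum_left cinner_sum_right sum_distrib_left)
  have Y: "vanishes_to 0 c Y"
    unfolding Y_def case_prod_unfold
  proof (intro vanishes_to_add X vanishes_to_sum)
    fix q assume "q \<in> J"
    then have "vanishes_to 0 c (\<lambda>t. principal_fun c (w (fst q)) (snd q) (of_real t) -
      (1 / \<delta> t ^ (snd q + 1)) *\<^sub>C chain_poly (fst q) t)"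
      using J(2)[of "fst q" "snd q"] by (intro principal_fun_chain_poly) auto
    then show "vanishes_to 0 c (\<lambda>t. a (fst q) (snd q) *\<^sub>C (principal_fun c (w (fst q)) (snd q) (of_real t) -
      (1 / \<delta> t ^ (snd q + 1)) *\<^sub>C chain_poly (fst q) t))"
      by (rule vanishes_to_bound[where C = "cmod (a (fst q) (snd q))"]) simp
  qed
  have V_eq: "V t = (\<Sum>q\<in>J. U q t) + Y t" if "t \<noteq> c" for t
    unfolding V[OF that] Y_def U_def
    by (simp add: case_prod_unfold complex_vector.scale_right_diff_distrib sum_subtractf scaleC_scaleC)
  note Q_simps = Q_def U_def clinear_map_scaleC[OF clinear_pencil] cinner_scaleC_left cinner_scaleC_right
    scaleC_complex_def power_add mult_ac
  have scaled: "((\<lambda>t. Q t (f t) (g t)) \<longlongrightarrow> b * s) (at c)"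
    if "(F \<longlongrightarrow> s) (at c)" "\<And>t. t \<noteq> c \<Longrightarrow> Q t (f t) (g t) = b * F t" for F b s f g
    using tendsto_mult[OF tendsto_const that(1), of b]
    by (rule Lim_transform_eventually) (use that(2) in \<open>simp add: eventually_at_filter\<close>)
  have UU: "((\<lambda>t. Q t (U q t) (U r t)) \<longlongrightarrow> L q r) (at c)" if qr: "q \<in> J" "r \<in> J" for q r
  proof -
    obtain j h k g where q: "q = (j, h)" "r = (k, g)"
      by (cases q, cases r)
    show ?thesis
      unfolding L_def q prod.case
      by (rule scaled[OF form_pair_limit]) (use J(2) qr q in \<open>auto simp: Q_simps\<close>)
  qed
  have UY: "((\<lambda>t. Q t (U q t) (Y t)) \<longlongrightarrow> 0) (at c)" and YU: "((\<lambda>t. Q t (Y t) (U q t)) \<longlongrightarrow> 0) (at c)"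
    if "q \<in> J" for q
  proof -
    obtain k h where q: "q = (k, h)"
      by (cases q)
    have k: "k < N" and h: "h \<le> p k div 2"
      using J(2) that q by auto
    have 1: "((\<lambda>t. (1 / \<delta> t ^ h) *\<^sub>C form t (chain_poly k t) (Y t)) \<longlongrightarrow> 0) (at c)"
      using h by (intro vanishes_to_imp_tendsto vanishes_to_mono[OF form_chain_poly_order[OF k Y]]) auto
    have 2: "((\<lambda>t. (1 / \<delta> t ^ h) *\<^sub>C form t (Y t) (chain_poly k t)) \<longlongrightarrow> 0) (at c)"
      using h by (intro vanishes_to_imp_tendsto vanishes_to_mono[OF form_chain_poly_right_order[OF k Y]]) auto
    show "((\<lambda>t. Q t (U q t) (Y t)) \<longlongrightarrow> 0) (at c)"
      using scaled[OF 1, of "\<lambda>t. U q t" Y "a k h"] by (simp add: q Q_simps)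
    show "((\<lambda>t. Q t (Y t) (U q t)) \<longlongrightarrow> 0) (at c)"
      using scaled[OF 2, of Y "\<lambda>t. U q t" "cnj (a k h)"] by (simp add: q Q_simps)
  qed
  have YY: "((\<lambda>t. Q t (Y t) (Y t)) \<longlongrightarrow> 0) (at c)"
  proof -
    have "vanishes_to (1 + (0 + 0)) c (\<lambda>t. \<delta> t ^ 1 *\<^sub>C form t (Y t) (Y t))"
      by (intro vanishes_to_power_scaleC vanishes_to_cinner vanishes_to_pencil Y)
    then have "vanishes_to (Suc 0) c (\<lambda>t. Q t (Y t) (Y t))"
      by (simp add: Q_def scaleC_complex_def)
    from vanishes_to_imp_tendsto[OF this] show ?thesis
      by simp
  qed
  let ?E = "\<lambda>t. (\<Sum>q\<in>J. \<Sum>r\<in>J. Q t (U q t) (U r t)) + (\<Sum>q\<in>J. Q t (U q t) (Y t)) +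
    (\<Sum>q\<in>J. Q t (Y t) (U q t)) + Q t (Y t) (Y t)"
  have "(?E \<longlongrightarrow> (\<Sum>q\<in>J. \<Sum>r\<in>J. L q r) + (\<Sum>q\<in>J. 0) + (\<Sum>q\<in>J. 0) + 0) (at c)"
    by (intro tendsto_add tendsto_sum UU UY YU YY)
  moreover have "eventually (\<lambda>t. ?E t = \<delta> t * form t (V t) (V t)) (at c)"
    using eventually_neq_at_within[of c c]
  proof eventually_elim
    case (elim t)
    define S where "S = (\<Sum>q\<in>J. U q t)"
    have US: "Q t x S = (\<Sum>q\<in>J. Q t x (U q t))" for x
      unfolding S_def by (rule Q_sum_right)
    have "Q t S S = (\<Sum>q\<in>J. Q t (U q t) S)" and SY: "Q t S (Y t) = (\<Sum>q\<in>J. Q t (U q t) (Y t))"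
      unfolding S_def by (rule Q_sum_left)+
    then have SS: "Q t S S = (\<Sum>q\<in>J. \<Sum>r\<in>J. Q t (U q t) (U r t))"
      by (simp only: US[of "U _ t"])
    have "Q t (S + Y t) (S + Y t) = Q t S S + Q t S (Y t) + Q t (Y t) S + Q t (Y t) (Y t)"
      by (simp add: Q_add_left Q_add_right)
    then have "Q t (V t) (V t) = ?E t"
      unfolding SS SY US[of "Y t"] V_eq[OF elim] S_def[symmetric] .
    then show ?case
      by (simp add: Q_def)
  qed
  ultimately have "((\<lambda>t. \<delta> t * form t (V t) (V t)) \<longlongrightarrow>
      (\<Sum>q\<in>J. \<Sum>r\<in>J. L q r) + (\<Sum>q\<in>J. 0) + (\<Sum>q\<in>J. 0) + 0) (at c)"
    by (rule Lim_transform_eventually)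
  moreover have "(\<Sum>r\<in>J. L q r) = (case q of (k, h) \<Rightarrow>
    if p k = 2 * h then of_int (eps k) * of_real ((cmod (a k h))\<^sup>2) else 0)" if "q \<in> J" for q
  proof -
    have "L q r = 0" if "r \<noteq> q" for r
      using that by (cases q, cases r) (auto simp: L_def)
    then have "(\<Sum>r\<in>J. L q r) = L q q"
      using J(1) that by (subst sum.remove[of _ q]) (auto intro!: sum.neutral)
    also have "\<dots> = (case q of (k, h) \<Rightarrow>
      if p k = 2 * h then of_int (eps k) * of_real ((cmod (a k h))\<^sup>2) else 0)"
      unfolding complex_norm_square by (auto simp: L_def mult.commute split: prod.splits)
    finally show ?thesis .
  qed
  ultimately show ?thesis
    by simp
qed

end

section \<open>Combinations of one half of the chains\<close>

lemma principal_fun_tendsto_0: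
  fixes w :: "nat \<Rightarrow> 'a :: complex_hilbert_space"
  shows "(principal_fun c w h \<longlongrightarrow> 0) at_infinity"
proof -
  have "((\<lambda>\<mu>. 1 / (\<mu> - c) ^ (r + 1)) \<longlongrightarrow> 0) at_infinity" for r
  proof -
    have "filterlim (\<lambda>\<mu>. (\<mu> - c) ^ (r + 1)) at_infinity at_infinity"
      by (rule Limits.filterlim_power_at_infinity[OF filterlim_minus_const_at_infinity]) simp
    then show ?thesis
      by (rule tendsto_divide_0[OF tendsto_const])
  qed
  then have "((\<lambda>\<mu>. \<Sum>r\<le>h. (1 / (\<mu> - c) ^ (r + 1)) *\<^sub>C w (h - r)) \<longlongrightarrow> (\<Sum>r\<le>h. 0 *\<^sub>C w (h - r))) at_infinity"
    by (intro tendsto_intros)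
  then show ?thesis
    by (simp add: principal_fun_def[abs_def])
qed

lemma principal_fun_tendsto:
  fixes w :: "nat \<Rightarrow> 'a :: complex_hilbert_space"
  assumes "b \<noteq> c"
  shows "(principal_fun c w h \<longlongrightarrow> principal_fun c w h b) (at b)"
  unfolding principal_fun_def[abs_def] using assms by (intro tendsto_intros) auto

lemma polynomial_at_poly: "polynomial_at c (\<lambda>\<mu>. poly p \<mu> *\<^sub>C x)"
proof -
  have "(\<lambda>\<mu>. poly p \<mu> *\<^sub>C x) = (\<lambda>\<mu>. \<Sum>i\<le>degree p. \<mu> ^ i *\<^sub>C coeff p i *\<^sub>C x)"
    by (simp add: poly_altdef scaleC_sum_left scaleC_scaleC mult.commute)
  then show ?thesis
    by (simp only:) (intro polynomial_at_sum polynomial_at_monomial)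
qed

context dissipative_pencil
begin

text \<open>At a point whose numerical range avoids \<open>0\<close>, the lowest Taylor coefficient of a polynomial is
  detected by the quadratic form.\<close>

lemma isotropic_polynomial_eq_zero:
  fixes Q :: "complex \<Rightarrow> 'a"
  assumes nondeg: "\<And>x. cinner (pencil n A (of_real t0) x) x = 0 \<Longrightarrow> x = 0"
    and Q: "polynomial_at (of_real t0) Q"
    and zero: "eventually (\<lambda>t. cinner (pencil n A (of_real t) (Q (of_real t))) (Q (of_real t)) = 0) (at t0)"
  shows "Q \<mu> = 0"
proof -
  obtain D u where Q_eq: "\<And>\<mu>. Q \<mu> = (\<Sum>d\<le>D. (\<mu> - of_real t0) ^ d *\<^sub>C u d)"
    using Q by (auto simp: polynomial_at_def)
  have "d \<le> D \<Longrightarrow> u d = 0" for d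
  proof (induction d rule: less_induct)
    case (less m)
    define g where "g t = (\<Sum>d\<in>{m..D}. (of_real t - of_real t0) ^ (d - m) *\<^sub>C u d)" for t
    have Q_g: "Q (of_real t) = (of_real t - of_real t0) ^ m *\<^sub>C g t" for t
    proof -
      have "Q (of_real t) = (\<Sum>d\<in>{m..D}. (of_real t - of_real t0) ^ d *\<^sub>C u d)"
        unfolding Q_eq using less by (intro sum.mono_neutral_right) (auto simp: not_le)
      then show ?thesis
        by (simp add: g_def scaleC_sum_right scaleC_scaleC flip: power_add)
    qed
    have g: "(g \<longlongrightarrow> u m) (at t0)"
    proof -
      have "(g \<longlongrightarrow> (\<Sum>d\<in>{m..D}. (of_real t0 - of_real t0) ^ (d - m) *\<^sub>C u d)) (at t0)"
        unfolding g_def[abs_def] by (intro tendsto_intros)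
      also have "(\<Sum>d\<in>{m..D}. (of_real t0 - of_real t0) ^ (d - m) *\<^sub>C u d) = u m"
        using less.prems by (subst sum.remove[of _ m]) (auto intro!: sum.neutral)
      finally show ?thesis .
    qed
    have "((\<lambda>t. \<Sum>j\<le>n. of_real t ^ j *\<^sub>C A j (g t)) \<longlongrightarrow> (\<Sum>j\<le>n. of_real t0 ^ j *\<^sub>C A j (u m))) (at t0)"
      by (intro tendsto_intros bounded_linear.tendsto[OF _ g]) (use bounded in \<open>auto simp: bounded_clinear_def\<close>)
    then have "((\<lambda>t. cinner (pencil n A (of_real t) (g t)) (g t)) \<longlongrightarrow> cinner (pencil n A (of_real t0) (u m)) (u m)) (at t0)"
      unfolding pencil_def by (intro tendsto_cinner g)
    moreover have "eventually (\<lambda>t. cinner (pencil n A (of_real t) (g t)) (g t) = 0) (at t0)"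
      using zero eventually_neq_at_within[of t0 t0]
    proof eventually_elim
      case (elim t)
      then show ?case
        by (simp add: Q_g clinear_map_scaleC[OF clinear_pencil] cinner_scaleC_left cinner_scaleC_right)
    qed
    ultimately have "cinner (pencil n A (of_real t0) (u m)) (u m) = 0"
      using tendsto_unique[OF at_neq_bot _ tendsto_eventually] by blast
    then show ?case
      by (rule nondeg)
  qed
  then show ?thesis
    by (simp add: Q_eq)
qed

end

text \<open>
  A linear relation (\<open>cancel\<close>) between derived chains of length \<open>l\<close>, with coefficients \<open>a\<close>, that only
  involves eigenvalues in one closed half plane. The sign \<open>sg\<close> tells which one, and \<open>real_half\<close> is what
  the lengths \<open>[(p \<plusminus> \<epsilon>)/2]\<close> amount to at real eigenvalues: a middle vector occurs only if the sign
  characteristic of its chain agrees with \<open>sg\<close>.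
\<close>

locale half_combination = dissipative_pencil n A
  for n :: nat and A :: "nat \<Rightarrow> 'a \<Rightarrow> 'a :: complex_hilbert_space" +
  fixes l :: nat and sg t0 :: real and N :: "complex \<Rightarrow> nat" and p :: "complex \<Rightarrow> nat \<Rightarrow> nat"
    and w :: "complex \<Rightarrow> nat \<Rightarrow> nat \<Rightarrow> 'a" and eps :: "complex \<Rightarrow> nat \<Rightarrow> int"
    and I :: "(complex \<times> nat \<times> nat) set" and a :: "complex \<times> nat \<times> nat \<Rightarrow> complex"
  assumes degree: "n = 2 * l" and sg: "sg = 1 \<or> sg = -1" and finite_I: "finite I"
    and nondegenerate: "\<And>x. cinner (pencil n A (of_real t0) x) x = 0 \<Longrightarrow> x = 0"
    and index: "\<And>c k h. (c, k, h) \<in> I \<Longrightarrow> k < N c \<and> h \<le> p c k"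
    and chain: "\<And>c k h. (c, k, h) \<in> I \<Longrightarrow> chain_equations n A c (p c k) (w c k)"
    and indep: "\<And>c k h. (c, k, h) \<in> I \<Longrightarrow> lin_indep_family (\<lambda>k. w c k 0) {..<N c}"
    and side: "\<And>c k h. (c, k, h) \<in> I \<Longrightarrow> 0 \<le> sg * Im c"
    and regular: "\<And>c k h. (c, k, h) \<in> I \<Longrightarrow> Im c = 0 \<Longrightarrow>
      \<exists>z. regular_eigenvalue n A (Re c) (N c) (p c) (w c) z (eps c)"
    and real_half: "\<And>c k h. (c, k, h) \<in> I \<Longrightarrow> Im c = 0 \<Longrightarrow>
      h \<le> p c k div 2 \<and> (p c k = 2 * h \<longrightarrow> 0 \<le> sg * of_int (eps c k))"
    and cancel: "\<And>i. i < l \<Longrightarrow> (\<Sum>(c, k, h)\<in>I. a (c, k, h) *\<^sub>C derived_vector c (w c k) h i) = 0"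
begin

definition poles :: "complex set"
  where "poles = fst ` I"

definition summand :: "complex \<times> nat \<times> nat \<Rightarrow> complex \<Rightarrow> 'a"
  where "summand = (\<lambda>(c, k, h) \<mu>. a (c, k, h) *\<^sub>C principal_fun c (w c k) h \<mu>)"

definition V :: "complex \<Rightarrow> 'a"
  where "V \<mu> = (\<Sum>q\<in>I. summand q \<mu>)"

text \<open>The coefficients of the expansion of \<open>V\<close> at infinity: \<open>jump i\<close> is the jump of the \<open>i\<close>-th derivative
  (up to a power of \<open>\<i>\<close>) of the corresponding solution, extended by \<open>0\<close> to the negative half axis.\<close>

definition jump :: "nat \<Rightarrow> 'a"
  where "jump i = (\<Sum>(c, k, h)\<in>I. a (c, k, h) *\<^sub>C derived_vector c (w c k) h i)"

definition V_image :: "complex \<Rightarrow> 'a"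
  where "V_image = polynomial_part n A jump"

definition \<phi> :: "complex \<Rightarrow> complex"
  where "\<phi> \<mu> = cinner (V_image \<mu>) (V (cnj \<mu>))"

definition local_index :: "complex \<Rightarrow> (nat \<times> nat) set"
  where "local_index c = {(k, h). (c, k, h) \<in> I}"

definition rest :: "complex \<Rightarrow> complex \<Rightarrow> 'a"
  where "rest c \<mu> = (\<Sum>q\<in>{q \<in> I. fst q \<noteq> c}. summand q \<mu>)"

lemma finite_poles: "finite poles"
  by (simp add: poles_def finite_I)

lemma not_pole: "\<mu> \<notin> poles \<Longrightarrow> (c, k, h) \<in> I \<Longrightarrow> \<mu> \<noteq> c"
  by (force simp: poles_def)

lemma eventually_not_pole: "eventually (\<lambda>\<mu>. \<mu> \<notin> poles) (at b)"
  using finite_poles by (rule eventually_notin_finite)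

lemma finite_local_index: "finite (local_index c)"
  by (rule finite_subset[of _ "snd ` I"]) (force simp: local_index_def finite_I)+

lemma V_local:
  "V \<mu> = (\<Sum>(k, h)\<in>local_index c. a (c, k, h) *\<^sub>C principal_fun c (w c k) h \<mu>) + rest c \<mu>"
proof -
  have "V \<mu> = (\<Sum>q\<in>{q \<in> I. fst q = c}. summand q \<mu>) + (\<Sum>q\<in>{q \<in> I. fst q \<noteq> c}. summand q \<mu>)"
    unfolding V_def using finite_I by (subst sum.union_disjoint[symmetric]) (auto intro!: sum.cong)
  also have "(\<Sum>q\<in>{q \<in> I. fst q = c}. summand q \<mu>) =
    (\<Sum>(k, h)\<in>local_index c. a (c, k, h) *\<^sub>C principal_fun c (w c k) h \<mu>)"
    by (rule sum.reindex_bij_witness[of _ "\<lambda>(k, h). (c, k, h)" snd])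
      (auto simp: local_index_def summand_def)
  finally show ?thesis
    by (simp add: rest_def)
qed

lemma rest_tendsto: "(rest c \<longlongrightarrow> rest c c) (at c)"
  unfolding rest_def[abs_def]
proof (rule tendsto_sum)
  fix q assume "q \<in> {q \<in> I. fst q \<noteq> c}"
  then obtain b k h where q: "q = (b, k, h)" "c \<noteq> b"
    by (cases q) auto
  then show "(summand q \<longlongrightarrow> summand q c) (at c)"
    unfolding q summand_def prod.case by (intro tendsto_scaleC tendsto_const principal_fun_tendsto)
qed

lemma pencil_V:
  assumes "\<mu> \<notin> poles"
  shows "pencil n A \<mu> (V \<mu>) = V_image \<mu>"
proof -
  have "pencil n A \<mu> (summand q \<mu>) = (case q of (c, k, h) \<Rightarrow>
    a (c, k, h) *\<^sub>C polynomial_part n A (derived_vector c (w c k) h) \<mu>)" if q: "q \<in> I" for q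
  proof -
    obtain c k h where ckh: "q = (c, k, h)"
      by (cases q)
    have "pencil n A \<mu> (principal_fun c (w c k) h \<mu>) = polynomial_part n A (derived_vector c (w c k) h) \<mu>"
      unfolding pencil_def using q ckh index[of c k h] not_pole[OF assms]
      by (intro chain_equations_imp_polynomial clinear_A chain_equations_mono[OF chain]) auto
    then show ?thesis
      by (simp add: ckh summand_def clinear_map_scaleC[OF clinear_pencil])
  qed
  then have "pencil n A \<mu> (V \<mu>) = (\<Sum>q\<in>I. case q of (c, k, h) \<Rightarrow>
    a (c, k, h) *\<^sub>C polynomial_part n A (derived_vector c (w c k) h) \<mu>)"
    by (simp add: V_def clinear_map_sum[OF clinear_pencil])
  also have "\<dots> = V_image \<mu>"
    using polynomial_part_sum[where I = I and a = a and d = "\<lambda>(c, k, h). derived_vector c (w c k) h" and G = A and n = n,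
        OF clinear_A]
    by (simp add: V_image_def jump_def[abs_def] case_prod_unfold)
  finally show ?thesis .
qed

lemma \<phi>_real:
  assumes "of_real t \<notin> poles"
  shows "\<phi> (of_real t) = form t (V (of_real t)) (V (of_real t))"
  by (simp add: \<phi>_def pencil_V[OF assms])

text \<open>The function \<open>\<phi>\<close> is rational: a combination of the functions \<open>\<mu>\<^sup>i / (\<mu> - cnj c)\<^bsup>r+1\<^esup>\<close>.\<close>

lemma \<phi>_expansion:
  "\<phi> \<mu> = (\<Sum>(c, k, h)\<in>I. cnj (a (c, k, h)) * (\<Sum>r\<le>h.
    (1 / (\<mu> - cnj c) ^ (r + 1)) * (\<Sum>j\<le>n. \<Sum>i<j. \<mu> ^ (j - 1 - i) * cinner (A j (jump i)) (w c k (h - r)))))"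
  by (simp add: \<phi>_def V_def summand_def V_image_def polynomial_part_def principal_fun_def case_prod_unfold
      cinner_sum_right cinner_scaleC_right cinner_sum_left cinner_scaleC_left)

lemma \<phi>_holomorphic: "\<phi> holomorphic_on - cnj ` poles"
  unfolding \<phi>_expansion[abs_def] case_prod_unfold
  by (intro holomorphic_intros) (force simp: poles_def)

lemma \<phi>_meromorphic: "\<phi> meromorphic_on B"
  unfolding \<phi>_expansion[abs_def] case_prod_unfold
  by (intro meromorphic_intros)

text \<open>The first \<open>l\<close> coefficients of the expansion at infinity cancel, so \<open>\<mu>\<^sup>m V\<close> still is a combination of
  partial fractions for \<open>m \<le> l\<close>.\<close>

lemma power_V_tendsto_0:
  assumes "m \<le> l"
  shows "((\<lambda>\<mu>. \<mu> ^ m *\<^sub>C V \<mu>) \<longlongrightarrow> 0) at_infinity"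
proof -
  define W where "W \<mu> = (\<Sum>(c, k, h)\<in>I. a (c, k, h) *\<^sub>C
    (\<Sum>r\<le>h. (of_nat (m choose r) * c ^ (m - r)) *\<^sub>C principal_fun c (w c k) (h - r) \<mu>))" for \<mu>
  have "(W \<longlongrightarrow> (\<Sum>q\<in>I. a q *\<^sub>C (\<Sum>r\<le>snd (snd q). (of_nat (m choose r) * fst q ^ (m - r)) *\<^sub>C 0))) at_infinity"
    unfolding W_def[abs_def] case_prod_unfold prod.collapse
    by (intro tendsto_intros principal_fun_tendsto_0)
  then have lim: "(W \<longlongrightarrow> 0) at_infinity"
    by simp
  have "W \<mu> = \<mu> ^ m *\<^sub>C V \<mu>" if \<mu>: "\<mu> \<notin> poles" for \<mu>
  proof -
    have "\<mu> ^ m *\<^sub>C V \<mu> = (\<Sum>(c, k, h)\<in>I. a (c, k, h) *\<^sub>C \<mu> ^ m *\<^sub>C principal_fun c (w c k) h \<mu>)"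
      by (simp add: V_def summand_def scaleC_sum_right scaleC_scaleC mult.commute case_prod_unfold)
    also have "\<dots> = (\<Sum>(c, k, h)\<in>I. (\<Sum>i<m. \<mu> ^ (m - 1 - i) *\<^sub>C a (c, k, h) *\<^sub>C derived_vector c (w c k) h i) +
      a (c, k, h) *\<^sub>C (\<Sum>r\<le>h. (of_nat (m choose r) * c ^ (m - r)) *\<^sub>C principal_fun c (w c k) (h - r) \<mu>))"
    proof (rule sum.cong[OF refl])
      fix q assume "q \<in> I"
      then have "\<mu> \<noteq> fst q"
        using \<mu> by (auto simp: poles_def)
      then show "(case q of (c, k, h) \<Rightarrow> a (c, k, h) *\<^sub>C \<mu> ^ m *\<^sub>C principal_fun c (w c k) h \<mu>) =
        (case q of (c, k, h) \<Rightarrow> (\<Sum>i<m. \<mu> ^ (m - 1 - i) *\<^sub>C a (c, k, h) *\<^sub>C derived_vector c (w c k) h i) +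
          a (c, k, h) *\<^sub>C (\<Sum>r\<le>h. (of_nat (m choose r) * c ^ (m - r)) *\<^sub>C principal_fun c (w c k) (h - r) \<mu>))"
        unfolding case_prod_unfold power_times_principal_fun[OF \<open>\<mu> \<noteq> fst q\<close>]
        by (simp add: scaleC_add_right scaleC_sum_right scaleC_scaleC mult.commute)
    qed
    also have "\<dots> = (\<Sum>i<m. \<mu> ^ (m - 1 - i) *\<^sub>C jump i) + W \<mu>"
      unfolding W_def jump_def scaleC_sum_right case_prod_unfold sum.distrib by (subst sum.swap) simp
    also have "(\<Sum>i<m. \<mu> ^ (m - 1 - i) *\<^sub>C jump i) = 0"
      using cancel assms by (simp add: jump_def)
    finally show ?thesis by simp
  qed
  moreover have "eventually (\<lambda>\<mu>. \<mu> \<notin> poles) at_infinity"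
    using finite_poles by (rule eventually_notin_finite_at_infinity)
  ultimately show ?thesis
    using lim by (auto elim!: Lim_transform_eventually eventually_mono)
qed

text \<open>In \<open>\<mu> \<phi>(\<mu>)\<close> the power \<open>\<mu>\<^bsup>j-i\<^esup>\<close> comes with \<open>jump i\<close>, which is \<open>0\<close> for \<open>i < l\<close>. Because of \<open>n = 2 * l\<close> the
  remaining exponents do not exceed \<open>l\<close>.\<close>

lemma \<phi>_infinity: "((\<lambda>\<mu>. \<mu> * \<phi> \<mu>) \<longlongrightarrow> 0) at_infinity"
proof -
  have "((\<lambda>\<mu>. \<mu> * (\<mu> ^ (j - 1 - i) * cinner (A j (jump i)) (V (cnj \<mu>)))) \<longlongrightarrow> 0) at_infinity"
    if ij: "j \<le> n" "i < j" for i j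
  proof (cases "i < l")
    case True
    then have "jump i = 0"
      using cancel by (simp add: jump_def)
    then show ?thesis
      using ij by (simp add: clinear_map_zero[OF clinear_A])
  next
    case False
    have "((\<lambda>\<mu>. cinner (A j (jump i)) (cnj \<mu> ^ (j - i) *\<^sub>C V (cnj \<mu>))) \<longlongrightarrow> cinner (A j (jump i)) 0) at_infinity"
      using False ij degree
      by (intro tendsto_cinner tendsto_const filterlim_compose[OF power_V_tendsto_0 filterlim_cnj_at_infinity]) auto
    then have "((\<lambda>\<mu>. \<mu> ^ (j - i) * cinner (A j (jump i)) (V (cnj \<mu>))) \<longlongrightarrow> 0) at_infinity"
      by (simp add: cinner_scaleC_right)
    moreover have step: "\<mu> * (\<mu> ^ (j - 1 - i) * x) = \<mu> ^ (j - i) * x" for \<mu> x :: complex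
    proof -
      have "j - i = Suc (j - 1 - i)"
        using ij by simp
      then show ?thesis by simp
    qed
    ultimately show ?thesis
      unfolding step by simp
  qed
  then have "((\<lambda>\<mu>. \<Sum>j\<le>n. \<Sum>i<j. \<mu> * (\<mu> ^ (j - 1 - i) * cinner (A j (jump i)) (V (cnj \<mu>)))) \<longlongrightarrow> 0) at_infinity"
    by (intro tendsto_null_sum) auto
  then show ?thesis
    by (simp add: \<phi>_def V_image_def polynomial_part_def cinner_sum_left cinner_scaleC_left sum_distrib_left)
qed

definition residue_sum :: "complex \<Rightarrow> real"
  where "residue_sum c = (\<Sum>(k, h)\<in>local_index c.
    if p c k = 2 * h then of_int (eps c k) * (cmod (a (c, k, h)))\<^sup>2 else 0)"

lemma residue_sum_sign: "Im c = 0 \<Longrightarrow> 0 \<le> sg * residue_sum c"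
  unfolding residue_sum_def sum_distrib_left
proof (rule sum_nonneg)
  fix x assume c: "Im c = 0" and x: "x \<in> local_index c"
  obtain k h where kh: "x = (k, h)"
    by (cases x)
  have "p c k = 2 * h \<Longrightarrow> 0 \<le> sg * of_int (eps c k) * (cmod (a (c, k, h)))\<^sup>2"
    using real_half[of c k h] c x by (simp add: kh local_index_def)
  then show "0 \<le> sg * (case x of (k, h) \<Rightarrow>
    if p c k = 2 * h then of_int (eps c k) * (cmod (a (c, k, h)))\<^sup>2 else 0)"
    by (simp add: kh mult.assoc)
qed

lemma \<phi>_residue:
  assumes c: "c \<in> poles" "Im c = 0"
  shows "((\<lambda>\<mu>. (\<mu> - c) * \<phi> \<mu>) \<longlongrightarrow> of_real (residue_sum c)) (at c)"
proof -
  define b where "b = Re c"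
  have b: "c = of_real b"
    using c(2) by (simp add: b_def complex_eq_iff)
  obtain k h where "(c, k, h) \<in> I"
    using c(1) by (force simp: poles_def)
  then obtain z where reg: "regular_eigenvalue n A b (N c) (p c) (w c) z (eps c)"
    using regular c(2) unfolding b_def by blast
  interpret regular_eigenvalue n A b "N c" "p c" "w c" z "eps c"
    by (rule reg)
  have real: "filterlim of_real (at c) (at b)"
    unfolding b by (rule filterlim_of_real_at)
  have "((\<lambda>t. (of_real t - of_real b) * form t (V (of_real t)) (V (of_real t))) \<longlongrightarrow>
    (\<Sum>(k, h)\<in>local_index c. if p c k = 2 * h then of_int (eps c k) * of_real ((cmod (a (c, k, h)))\<^sup>2) else 0)) (at b)"
  proof (rule form_residue[OF finite_local_index])
    show "k < N c \<and> h \<le> p c k div 2" if "(k, h) \<in> local_index c" for k h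
      using that index real_half c(2) by (auto simp: local_index_def)
    show "vanishes_to 0 b (\<lambda>t. rest c (of_real t))"
      by (rule vanishes_to_tendsto[OF filterlim_compose[OF rest_tendsto real]])
    show "V (of_real t) = (\<Sum>(k, h)\<in>local_index c. a (c, k, h) *\<^sub>C
      principal_fun (of_real b) (w c k) h (of_real t)) + rest c (of_real t)" for t
      using V_local[of "of_real t" c] unfolding b .
  qed
  also have "(\<Sum>(k, h)\<in>local_index c. if p c k = 2 * h then of_int (eps c k) * of_real ((cmod (a (c, k, h)))\<^sup>2) else 0) =
    complex_of_real (residue_sum c)"
    unfolding residue_sum_def of_real_sum by (intro sum.cong) auto
  finally have "((\<lambda>t. (of_real t - c) * \<phi> (of_real t)) \<longlongrightarrow> of_real (residue_sum c)) (at b)"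
  proof (rule Lim_transform_eventually)
    show "eventually (\<lambda>t. (of_real t - of_real b) * form t (V (of_real t)) (V (of_real t)) =
      (of_real t - c) * \<phi> (of_real t)) (at b)"
      using filterlim_iff[THEN iffD1, OF real, rule_format, OF eventually_not_pole]
      by eventually_elim (simp add: \<phi>_real b)
  qed
  then show ?thesis
    unfolding b by (intro complex_limit_from_real_limit meromorphic_intros \<phi>_meromorphic)
qed

lemma \<phi>_zero: "\<mu> \<notin> cnj ` poles \<Longrightarrow> \<phi> \<mu> = 0"
proof (rule vanishing_poles_half_plane[OF sg, where \<phi> = \<phi> and S = "cnj ` poles" and \<rho> = residue_sum])
  show "sg * Im s \<le> 0" if "s \<in> cnj ` poles" for s
    using that side by (force simp: poles_def)
  show "0 \<le> sg * residue_sum s \<and> ((\<lambda>z. (z - s) * \<phi> z) \<longlongrightarrow> of_real (residue_sum s)) (at s)"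
    if s: "s \<in> cnj ` poles" "Im s = 0" for s
  proof -
    have "cnj s = s"
      using s(2) by (simp add: complex_eq_iff)
    then have "s \<in> poles"
      using s(1) by (metis complex_cnj_cnj imageE)
    then show ?thesis
      using residue_sum_sign \<phi>_residue s(2) by blast
  qed
  show "Im (\<phi> (of_real t)) \<le> 0" if "of_real t \<notin> cnj ` poles" for t :: real
  proof -
    have "complex_of_real t \<notin> poles"
      using that by (metis complex_cnj_complex_of_real imageI)
    then show ?thesis
      using dissipative by (simp add: \<phi>_real)
  qed
qed (simp_all add: finite_poles \<phi>_holomorphic \<phi>_infinity)

text \<open>The summand multiplied by the common denominator of \<open>V\<close>, with the common factors cancelled in order
  to have a polynomial that is also correct at the poles.\<close>

definition cleared_summand :: "complex \<times> nat \<times> nat \<Rightarrow> complex \<Rightarrow> 'a"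
  where "cleared_summand = (\<lambda>(c, k, h) \<mu>. \<Sum>r\<le>h. poly ([:- c, 1:] ^ (h - r) *
    (\<Prod>(b, k', g)\<in>I - {(c, k, h)}. [:- b, 1:] ^ (g + 1))) \<mu> *\<^sub>C a (c, k, h) *\<^sub>C w c k (h - r))"

text \<open>The polynomial \<open>D V\<close>, where \<open>D\<close> is the common denominator, is isotropic for \<open>A(t)\<close> at all real \<open>t\<close>
  outside the poles, because \<open>\<phi>\<close> vanishes there.\<close>

lemma V_zero:
  assumes \<mu>: "\<mu> \<notin> poles"
  shows "V \<mu> = 0"
proof -
  define D where "D \<mu> = (\<Prod>(c, k, h)\<in>I. (\<mu> - c) ^ (h + 1))" for \<mu>
  define Q where "Q \<mu> = (\<Sum>q\<in>I. cleared_summand q \<mu>)" for \<mu>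
  have Q_poly: "polynomial_at b Q" for b
    unfolding Q_def[abs_def] cleared_summand_def case_prod_unfold
    by (intro polynomial_at_sum polynomial_at_poly)
  have Q_eq: "Q \<mu> = D \<mu> *\<^sub>C V \<mu>" if \<mu>: "\<mu> \<notin> poles" for \<mu>
  proof -
    have "cleared_summand q \<mu> = D \<mu> *\<^sub>C summand q \<mu>" if q: "q \<in> I" for q
    proof -
      obtain c k h where ckh: "q = (c, k, h)"
        by (cases q)
      define E where "E = (\<Prod>(b, k', g)\<in>I - {(c, k, h)}. (\<mu> - b) ^ (g + 1))"
      have nz: "\<mu> - c \<noteq> 0"
        using not_pole[OF \<mu>] q ckh by auto
      have D_eq: "D \<mu> = (\<mu> - c) ^ (h + 1) * E"
        unfolding D_def E_def using finite_I q ckh by (subst prod.remove[of _ "(c, k, h)"]) auto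
      have "poly ([:- c, 1:] ^ (h - r) * (\<Prod>(b, k', g)\<in>I - {(c, k, h)}. [:- b, 1:] ^ (g + 1))) \<mu> =
        D \<mu> * (1 / (\<mu> - c) ^ (r + 1))" if "r \<le> h" for r
      proof -
        have "(\<mu> - c) ^ (h + 1) = (\<mu> - c) ^ (h - r) * (\<mu> - c) ^ (r + 1)"
          using that by (simp flip: power_add)
        then have "D \<mu> * (1 / (\<mu> - c) ^ (r + 1)) = (\<mu> - c) ^ (h - r) * E"
          using nz by (simp add: D_eq)
        then show ?thesis
          by (simp add: E_def poly_prod case_prod_unfold flip: power_Suc)
      qed
      then show ?thesis
        by (simp add: ckh cleared_summand_def summand_def principal_fun_def scaleC_sum_right scaleC_scaleC mult_ac)
    qed
    then show ?thesis
      by (simp add: Q_def V_def scaleC_sum_right)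
  qed
  have near: "eventually (\<lambda>t. complex_of_real t \<notin> poles) (at t0)"
    by (rule filterlim_iff[THEN iffD1, OF filterlim_of_real_at, rule_format, OF eventually_not_pole])
  have "Q \<mu> = 0"
  proof (rule isotropic_polynomial_eq_zero[OF nondegenerate Q_poly])
    show "eventually (\<lambda>t. form t (Q (of_real t)) (Q (of_real t)) = 0) (at t0)"
      using near
    proof eventually_elim
      case (elim t)
      have "complex_of_real t \<notin> cnj ` poles"
        using elim by (metis complex_cnj_cnj complex_cnj_complex_of_real imageE)
      then have "form t (V (of_real t)) (V (of_real t)) = 0"
        using \<phi>_zero \<phi>_real[OF elim] by simp
      then show ?case
        by (simp add: Q_eq[OF elim] clinear_map_scaleC[OF clinear_pencil] cinner_scaleC_left cinner_scaleC_right)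
    qed
  qed
  moreover have "D \<mu> \<noteq> 0"
    using not_pole[OF \<mu>] finite_I by (auto simp: D_def prod_zero_iff)
  ultimately show ?thesis
    using Q_eq[OF \<mu>] by simp
qed

theorem coefficients_zero:
  assumes "(c, k, h) \<in> I"
  shows "a (c, k, h) = 0"
proof (rule coefficients_eq_zero[where w = "w c" and N = "N c" and c = c and J = "local_index c" and a = "\<lambda>k h. a (c, k, h)" and X = "rest c"])
  show "lin_indep_family (\<lambda>k. w c k 0) {..<N c}" "finite (local_index c)"
    by (rule indep[OF assms], rule finite_local_index)
  show "local_index c \<subseteq> {..<N c} \<times> UNIV"
    using index by (auto simp: local_index_def)
  show "eventually (\<lambda>\<mu>. (\<Sum>(k, h)\<in>local_index c. a (c, k, h) *\<^sub>C principal_fun c (w c k) h \<mu>) + rest c \<mu> = 0) (at c)"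
    using eventually_not_pole by eventually_elim (simp add: V_zero flip: V_local)
  show "((\<lambda>\<mu>. (\<mu> - c) *\<^sub>C rest c \<mu>) \<longlongrightarrow> 0) (at c)"
    using negligible_at_tendsto[OF rest_tendsto] by (simp add: negligible_at_def)
  show "(k, h) \<in> local_index c"
    using assms by (simp add: local_index_def)
qed

end

section \<open>Independence of the half systems\<close>

lemma numerical_range_nonzero:
  assumes lin: "clinear_map B" and nz: "0 \<notin> numerical_range B" and x: "cinner (B x) x = 0"
  shows "x = 0"
proof (rule ccontr)
  assume "x \<noteq> 0"
  define u where "u = complex_of_real (1 / norm x) *\<^sub>C x"
  have "norm u = 1"
    using \<open>x \<noteq> 0\<close> by (simp add: u_def norm_divide)
  moreover have "cinner (B u) u = 0"
    by (simp add: u_def clinear_map_scaleC[OF lin] cinner_scaleC_left cinner_scaleC_right x)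
  ultimately have "0 \<in> numerical_range B"
    unfolding numerical_range_def by (metis (mono_tags, lifting) mem_Collect_eq)
  with nz show False by contradiction
qed

lemma canonical_systemD:
  assumes "canonical_system (pencil n A) c N p w"
  shows "lin_indep_family (\<lambda>k. w k 0) {..<N}"
    and "k < N \<Longrightarrow> chain_equations n A c (p k) (w k)"
  using assms by (auto simp: canonical_system_def chain_family_def is_chain_pencil_iff)

lemma (in dissipative_pencil) regular_system_imp_regular_eigenvalue:
  assumes c: "c \<in> discrete_spectrum (pencil n A)" "c \<in> \<real>"
    and reg: "regular_system n (pencil n A) c N p w eps"
  shows "\<exists>z. regular_eigenvalue n A (Re c) N p w z eps"
proof -
  have c_eq: "complex_of_real (Re c) = c"
    using c(2) by (simp add: of_real_Re)
  then have cnj: "cnj c = c"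
    by (metis complex_cnj_complex_of_real)
  obtain z where z: "adjoint_canonical_system (pencil n A) c N p w z"
    and mid: "\<And>k. k < N \<Longrightarrow> even (p k) \<Longrightarrow> eps k \<in> {1, -1} \<and>
      derived_chain n (cnj c) (z k) (p k div 2) - of_int (eps k) *\<^sub>C derived_chain n c (w k) (p k div 2)
      \<in> cspan {derived_chain n c (w j) h | j h. j < N \<and> int h \<le> (int (p j) - 1) div 2}"
    using reg unfolding regular_system_def by meson
  have "canonical_system (pencil n A) c N p w"
    using reg by (simp add: regular_system_def)
  note canonical = canonical_systemD[OF this]
  have "regular_eigenvalue n A (Re c) N p w z eps"
  proof (unfold_locales, unfold c_eq)
    show "c isolated_in op_spectrum (pencil n A)"
      using c(1) by (simp add: discrete_spectrum_def)
    show "chain_equations n A c (p k) (w k)" if "k < N" for k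
      using that by (rule canonical(2))
    show "has_principal_part (\<lambda>\<mu>. inv (pencil n A \<mu>)) c (keldysh_principal_part c N p w z)"
      using z by (simp add: adjoint_canonical_system_def)
  qed (rule canonical(1), rule mid[unfolded cnj])
  then show ?thesis
    by blast
qed

lemma (in dissipative_pencil) half_system_independent:
  fixes sg :: int
  assumes degree: "n = 2 * l" and sg: "sg = 1 \<or> sg = -1"
    and nondeg: "0 \<notin> numerical_range (pencil n A (of_real t0))"
    and canonical: "\<And>c. c \<in> discrete_spectrum (pencil n A) \<Longrightarrow> c \<notin> \<real> \<Longrightarrow>
      canonical_system (pencil n A) c (N c) (p c) (w c)"
    and regular: "\<And>c. c \<in> discrete_spectrum (pencil n A) \<Longrightarrow> c \<in> \<real> \<Longrightarrow>
      regular_system n (pencil n A) c (N c) (p c) (w c) (eps c)"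
  shows "lin_indep_family (half_system l w) (half_index (pencil n A) N p eps sg)"
proof (rule lin_indep_familyI)
  fix J a q
  assume J: "finite J" "J \<subseteq> half_index (pencil n A) N p eps sg"
    and zero: "(\<Sum>q\<in>J. a q *\<^sub>C half_system l w q) = 0" and q: "q \<in> J"
  have mem: "c \<in> discrete_spectrum (pencil n A) \<and> k < N c \<and>
      (of_int sg * Im c > 0 \<and> h \<le> p c k \<or>
       c \<in> \<real> \<and> int h \<le> (int (p c k) + sg * eps c k) div 2)" if "(c, k, h) \<in> J" for c k h
    using that J(2) by (auto simp: half_index_def)
  have canon: "canonical_system (pencil n A) c (N c) (p c) (w c)"
    if "c \<in> discrete_spectrum (pencil n A)" for c
    using canonical[OF that] regular[OF that] by (cases "c \<in> \<real>") (auto simp: regular_system_def)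
  have signs: "if even (p c k) then eps c k = 1 \<or> eps c k = -1 else eps c k = 0"
    if "(c, k, h) \<in> J" "c \<in> \<real>" for c k h
    using regular[of c] mem[OF that(1)] that(2) unfolding regular_system_def
    by (auto split: if_splits)
  \<comment> \<open>For even \<open>p\<close> the quotient \<open>(p + sg * eps) div 2\<close> is \<open>p div 2\<close> if \<open>sg * eps = 1\<close>, and \<open>p div 2 - 1\<close> if \<open>sg * eps = -1\<close>.\<close>
  have half: "h \<le> p c k div 2 \<and> (p c k = 2 * h \<longrightarrow> 0 \<le> sg * eps c k)"
    if ckh: "(c, k, h) \<in> J" "c \<in> \<real>" for c k h
  proof -
    have h: "int h \<le> (int (p c k) + sg * eps c k) div 2"
      using mem[OF ckh(1)] ckh(2) by (auto simp: complex_is_Real_iff)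
    consider "even (p c k)" "sg * eps c k = 1" | "even (p c k)" "sg * eps c k = -1"
      | "odd (p c k)" "sg * eps c k = 0"
      using signs[OF ckh] sg by (auto split: if_splits)
    then show ?thesis
    proof cases
      case 1
      then show ?thesis using h by simp
    next
      case 2
      then show ?thesis using h by simp presburger
    next
      case 3
      then show ?thesis using h unfolding 3(2) by presburger
    qed
  qed
  interpret half_combination n A l "of_int sg" t0 N p w eps J a
  proof
    show "n = 2 * l" "finite J"
      by (fact degree, fact J(1))
    show "real_of_int sg = 1 \<or> real_of_int sg = -1"
      using sg by auto
    show "x = 0" if "cinner (pencil n A (of_real t0) x) x = 0" for x
      using clinear_pencil nondeg that by (rule numerical_range_nonzero)
    show "lin_indep_family (\<lambda>k. w c k 0) {..<N c}" if "(c, k, h) \<in> J" for c k h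
      using mem[OF that] canon by (blast intro: canonical_systemD(1))
    show "chain_equations n A c (p c k) (w c k)" if "(c, k, h) \<in> J" for c k h
      using mem[OF that] canon by (blast intro: canonical_systemD(2))
    show "k < N c \<and> h \<le> p c k" if "(c, k, h) \<in> J" for c k h
      using mem[OF that] half[OF that] by (auto intro: order_trans)
    show "0 \<le> of_int sg * Im c" if "(c, k, h) \<in> J" for c k h
      using mem[OF that] by (auto simp: complex_is_Real_iff)
    show "\<exists>z. regular_eigenvalue n A (Re c) (N c) (p c) (w c) z (eps c)"
      if "(c, k, h) \<in> J" "Im c = 0" for c k h
      using mem[OF that(1)] that(2) regular
      by (intro regular_system_imp_regular_eigenvalue) (auto simp: complex_is_Real_iff)
    show "h \<le> p c k div 2 \<and> (p c k = 2 * h \<longrightarrow> 0 \<le> real_of_int sg * real_of_int (eps c k))"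
      if "(c, k, h) \<in> J" "Im c = 0" for c k h
      using half[OF that(1)] that(2) by (simp add: complex_is_Real_iff flip: of_int_mult)
    show "(\<Sum>(c, k, h)\<in>J. a (c, k, h) *\<^sub>C derived_vector c (w c k) h i) = 0" if "i < l" for i
      using fun_cong[OF zero, of i] that
      by (simp add: half_system_def derived_chain_eq sum_fun_apply scaleC_fun_def case_prod_unfold)
  qed
  obtain c k h where "q = (c, k, h)"
    by (cases q)
  then show "a q = 0"
    using coefficients_zero q by simp
qed

theorem theorem7p4:
  fixes A :: "nat \<Rightarrow> 'a \<Rightarrow> 'a :: complex_hilbert_space"
    and n l :: nat
    and N :: "complex \<Rightarrow> nat"
    and p :: "complex \<Rightarrow> nat \<Rightarrow> nat"
    and w :: "complex \<Rightarrow> nat \<Rightarrow> nat \<Rightarrow> 'a"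
    and eps :: "complex \<Rightarrow> nat \<Rightarrow> int"
  assumes even_degree: "n = 2 * l"
    and bounded: "\<forall>j\<le>n. bounded_clinear (A j)"
    and dissipative: "\<forall>x. \<forall>t :: real. Im (cinner (pencil n A (of_real t) x) x) \<le> 0"
    and nondegenerate: "\<exists>t0 :: real. 0 \<notin> numerical_range (pencil n A (of_real t0))"
    and canonical: "\<forall>c \<in> discrete_spectrum (pencil n A) - \<real>.
      canonical_system (pencil n A) c (N c) (p c) (w c)"
    and regular: "\<forall>c \<in> discrete_spectrum (pencil n A) \<inter> \<real>.
      regular_system n (pencil n A) c (N c) (p c) (w c) (eps c)"
  shows "lin_indep_family (half_system l w) (half_index (pencil n A) N p eps 1)
    \<and> lin_indep_family (half_system l w) (half_index (pencil n A) N p eps (-1))"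
proof -
  interpret dissipative_pencil n A
    using bounded dissipative by unfold_locales auto
  obtain t0 where "0 \<notin> numerical_range (pencil n A (of_real t0))"
    using nondegenerate by blast
  then show ?thesis
    using canonical regular by (intro conjI half_system_independent[OF even_degree]) auto
qed

end
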